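(* Let $V$ be a non-empty finite set, let $\mu$ be a probability measure on $V^V$, and let $S,m_\mu,p,\eta,\nu,e,L,G,R,H,\gamma,C,\eta^L,W_\mu,W$ be as in the context. Let $(\mathbb X,N)$, $\mathbb X=(X^1,\dots,X^{m_\mu})$, be an $m_\mu$-particle $\mu$-evolution (not necessarily stationary) such that the sequences $X^1,\dots,X^{m_\mu}$ are distinct a.s., i.e. almost surely $X^i\ne X^j$ (as sequences indexed by $\mathbb Z$) whenever $i\ne j$. Set $\Lambda_k(\cdot):=\mathbb P(\mathbb X_k\in\cdot)$ for $k\in\mathbb Z$. Then: (a) For every $k\in\mathbb Z$, the states $X^1_k,\dots,X^{m_\mu}_k$ are distinct and form an F-clique, a.s. (b) $(\Lambda_k)_{k\in\mathbb Z}$ is a sequence in $\mathcal P(V^{m_\mu}_\times)$ satisfying $\Lambda_k=\mu*\Lambda_{k-1}$ for all $k\in\mathbb Z$, and there exist $\Lambda^0_W,\dots,\Lambda^{p-1}_W\in\mathcal P(W)$ and constants $\alpha_0,\dots,\alpha_{p-1}\ge0$ with $\alpha_0+\cdots+\alpha_{p-1}=1$ such that $$\Lambda_k=\sum_{r=0}^{p-1}\alpha_r\,\eta^L*\delta_{\gamma^{k+r}}*\omega_H*\Lambda^r_W\quad\text{for all }k\in\mathbb Z.\qquad(\ast)$$ (i) For each fixed $k\in\mathbb Z$, $\mathbb X_k\in W_\mu=LGW$ a.s. and $\mathbb X_k^L$ has law $\eta^L$. Moreover there exist a $C$-valued random variable $Y_C$, $H$-valued random variables $U_k$ ($k\in\mathbb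 Z$) and a $W$-valued random variable $\mathbb Z_W$ such that: (ii) $\mathbb X_k^G=(\gamma^kY_C)^C\,U_k$ a.s. for all $k\in\mathbb Z$, and each $U_k$ is uniform on $H$. (iii) $\mathbb X_k^W=\mathbb Z_W$ a.s. for all $k\in\mathbb Z$. (iv) Writing $M^G_j:=\mathbb X^G_j(\mathbb X^G_{j-1})^{-1}$ for $j\in\mathbb Z$ and $M^G_{k,j}:=\mathbb X^G_k(\mathbb X^G_j)^{-1}=M^G_kM^G_{k-1}\cdots M^G_{j+1}$ for $j\le k$ (inverses in the group $G$), $$\mathbb X_j=\mathbb X_j^L\,(M^G_{k,j})^{-1}\,(\gamma^kY_C)^C\,U_k\,\mathbb Z_W\quad\text{a.s. for all }j\le k.$$ (v) For every $k\in\mathbb Z$, $$\mathcal F^{\mathbb X}_k=\mathcal G^N_k\vee\mathcal F^{\mathbb X}_{-\infty}\vee\sigma(U_k)\quad\text{a.s.},$$ where $\mathcal G^N_k:=\sigma(\mathbb X^L_j,M^G_j:j\le k)$ satisfies $\mathcal G^N_k\subset\mathcal F^N_k$ a.s.; the three $\sigma$-fields $\sigma(N)$, $\mathcal F^{\mathbb X}_{-\infty}$ and $\sigma(U_k)$ are independent; and $\mathcal F^{\mathbb X}_{-\infty}=\sigma(Y_C,\mathbb Z_W)$ a.s. (vi) With $\alpha_0,\dots,\alpha_{p-1}$ and $\Lambda^0_W,\dots,\Lambda^{p-1}_W$ as in $(\ast)$, the joint law of $Y_C$ and $\mathbb Z_W$ is $$\mathbb P(Y_C=\gamma^r,\ \mathbb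 Z_W=\mathbf w)=\alpha_r\,\Lambda^r_W\{\mathbf w\}\quad\text{for } r=0,\dots,p-1\text{ and }\mathbf w\in W.$$
   Context: **Basic notation.** $V^V$ is the finite semigroup of maps $V\to V$ under composition; $fx$ denotes $f(x)$, and $f$ acts componentwise on $V^m$: $f(x^1,\dots,x^m)=(fx^1,\dots,fx^m)$. $V^m_\times$ is the set of $(x^1,\dots,x^m)\in V^m$ with distinct entries. $\mathcal P(A)$ is the set of probability measures on a finite set $A$, $\omega_A$ the uniform one, $\delta_a$ the Dirac mass; measures on subsets are regarded as measures on the larger set. $\mathcal S(\rho)$ is the support of $\rho$. For $\rho_1,\rho_2\in\mathcal P(V^V)$, $\rho_1*\rho_2$ is the law of $F_1F_2$ with $F_1,F_2$ independent of laws $\rho_1,\rho_2$; for $\rho\in\mathcal P(V^V)$, $\Lambda\in\mathcal P(V^m)$, $\rho*\Lambda$ is the law of $F\mathbf X$ with $F,\mathbf X$ independent of laws $\rho,\Lambda$. $\mu^n$ is the $n$-fold convolution. $E(A)$ is the set of idempotents in $A$; $AB=\{ab:a\in A,b\in B\}$. **Semigroup data.** $S=\bigcup_{n\ge1}\mathcal S(\mu)^n$ is the semigroup generated by $\mathcal S(\mu)$, and $m_\mu=\min\{\#(fV):f\in S\}$. It is known that the set of subsequential limits of $(\mu^n)$ is a cyclic group under convolution of some order $p$, $\{\eta,\mu*\eta,\dots,\mu^{p-1}*\eta\}$, with identity $\eta$ (so $\eta^2=\eta$ and $\mu^p*\eta=\eta$). Put $\nu=\frac1p\sum_{k=0}^{p-1}\mu^k*\eta=\lim_n\frac1n\sum_{k=1}^n\mu^k$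 (with $\mu^0*\eta=\eta$); $\mathcal S(\nu)$ is the kernel (least ideal) of $S$. Fix $e\in E(\mathcal S(\eta))$ and set $L=E(\mathcal S(\eta)e)$, $R=E(e\mathcal S(\eta))$, $G=e\mathcal S(\nu)e$, $H=e\mathcal S(\eta)e$. It is known that $G$ is a group with identity $e$, $H$ is a normal subgroup of $G$, and the product maps $L\times G\times R\to\mathcal S(\nu)$ and $L\times H\times R\to\mathcal S(\eta)$ are bijections; write $z\mapsto(z^L,z^G,z^R)$ for the inverse of the first. $\eta^L,\eta^R$ are the images of $\eta$ under $z\mapsto z^L$, $z\mapsto z^R$; then $\nu=\eta^L*\omega_G*\eta^R$ and $\eta=\eta^L*\omega_H*\eta^R$. Fix $\gamma\in G$ with $\gamma^p\in H$, $G/H=\{H,\gamma H,\dots,\gamma^{p-1}H\}$ (distinct cosets) and $\mu^r*\eta=\eta^L*\delta_{\gamma^r}*\omega_H*\eta^R$ for $r=0,\dots,p-1$ (such $\gamma$ exists; powers of $\gamma$ are taken in $G$, $\gamma^0=e$). Put $C=\{e,\gamma,\dots,\gamma^{p-1}\}$; each $g\in G$ is uniquely $g=g^Cg^H$ with $g^C\in C$, $g^H\in H$. **F-cliques, $W_\mu$ and $W$.** A pair $\{x,y\}$ in $V$ is a deadlock if $gx\ne gy$ for all $g\in S$. $F\subset V$ is an F-clique if every pair of distinct elements of $F$ is a deadlock and $F=gV$ for some $g\in S$. $W_\mu$ is the set of $(x^1,\dots,x^{m_\mu})\in V^{m_\mu}_\times$ such that $\{x^1,\dots,x^{m_\mu}\}$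 is an F-clique. $W$ is an arbitrary fixed (inclusion-)minimal subset of $eW_\mu$ with $eW_\mu=GW$. The product map $L\times G\times W\to W_\mu$, $(f,g,\mathbf w)\mapsto fg\mathbf w$, is a bijection, with inverse $\mathbf x\mapsto(\mathbf x^L,\mathbf x^G,\mathbf x^W)$. **Evolutions.** An $m$-particle $\mu$-evolution is a pair $(\mathbb X,N)$ of a $V^m$-valued process $\mathbb X=(\mathbb X_k)_{k\in\mathbb Z}$, $\mathbb X_k=(X^1_k,\dots,X^m_k)$, and an iid $V^V$-valued process $N=(N_k)_{k\in\mathbb Z}$ on a probability space such that for each $k\in\mathbb Z$: $\mathbb X_k=N_k\mathbb X_{k-1}$ a.s.; $N_k$ is independent of $\sigma(\mathbb X_j,N_j:j\le k-1)$; $N_k$ has law $\mu$. $\mathcal F^{\mathbb X}_k=\sigma(\mathbb X_j:j\le k)$, $\mathcal F^N_k=\sigma(N_j:j\le k)$, $\mathcal F^{\mathbb X}_{-\infty}=\bigcap_k\mathcal F^{\mathbb X}_k$, $\sigma(N)=\sigma(N_j:j\in\mathbb Z)$. $\mathcal A\vee\mathcal B=\sigma(\mathcal A\cup\mathcal B)$; "$\mathcal A\subset\mathcal B$ a.s." means $\mathcal A\subset\mathcal B\vee\mathcal N$ and "$\mathcal A=\mathcal B$ a.s." means $\mathcal A\vee\mathcal N=\mathcal B\vee\mathcal N$, where $\mathcal N$ is the family of null events. *)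

theory Defs
  imports "HOL-Probability.Probability" "HOL-Algebra.Left_Coset"
begin

section \<open>Random maps on a finite set\<close>

text \<open>
  The finite non-empty set \<open>V\<close> is the universe of a type \<open>'v :: finite\<close>, so \<open>V\<^sup>V\<close> is the finite type
  \<open>'v \<Rightarrow> 'v\<close>. Since \<open>m\<close> depends on \<open>\<mu>\<close>, an \<open>m\<close>-tuple is a list of length \<open>m\<close>, on which maps
  act by \<^const>\<open>map\<close>. Probability measures on finite sets are \<open>pmf\<close>s; a measure on a subset \<open>A\<close> is a
  \<open>pmf\<close> whose support is contained in \<open>A\<close>, \<^const>\<open>return_pmf\<close> is the Dirac mass and
  \<^const>\<open>pmf_of_set\<close> the uniform measure.
\<close>

definition conv :: "('v \<Rightarrow> 'v) pmf \<Rightarrow> ('v \<Rightarrow> 'v) pmf \<Rightarrow> ('v \<Rightarrow> 'v) pmf" (infixl "\<star>" 70)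
  where "\<rho>1 \<star> \<rho>2 = map_pmf (\<lambda>(f, g). f \<circ> g) (pair_pmf \<rho>1 \<rho>2)"

definition act :: "('v \<Rightarrow> 'v) pmf \<Rightarrow> 'v list pmf \<Rightarrow> 'v list pmf" (infixl "\<triangleright>" 70)
  where "\<rho> \<triangleright> \<Lambda> = map_pmf (\<lambda>(f, xs). map f xs) (pair_pmf \<rho> \<Lambda>)"

primrec conv_pow :: "('v \<Rightarrow> 'v) pmf \<Rightarrow> nat \<Rightarrow> ('v \<Rightarrow> 'v) pmf"
  where
    "conv_pow \<mu> 0 = return_pmf id"
  | "conv_pow \<mu> (Suc n) = \<mu> \<star> conv_pow \<mu> n"

definition set_comp :: "('v \<Rightarrow> 'v) set \<Rightarrow> ('v \<Rightarrow> 'v) set \<Rightarrow> ('v \<Rightarrow> 'v) set"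
  where "set_comp A B = {a \<circ> b | a b. a \<in> A \<and> b \<in> B}"

primrec set_pow :: "('v \<Rightarrow> 'v) set \<Rightarrow> nat \<Rightarrow> ('v \<Rightarrow> 'v) set"
  where
    "set_pow A 0 = {id}"
  | "set_pow A (Suc n) = set_comp A (set_pow A n)"

definition idempotents :: "('v \<Rightarrow> 'v) set \<Rightarrow> ('v \<Rightarrow> 'v) set"
  where "idempotents A = {f \<in> A. f \<circ> f = f}"


section \<open>Semigroup data\<close>

definition S_of :: "('v \<Rightarrow> 'v) pmf \<Rightarrow> ('v \<Rightarrow> 'v) set"
  where "S_of \<mu> = (\<Union>n\<in>{1..}. set_pow (set_pmf \<mu>) n)"

definition m_of :: "('v :: finite \<Rightarrow> 'v) pmf \<Rightarrow> nat"
  where "m_of \<mu> = Min ((\<lambda>f. card (range f)) ` S_of \<mu>)"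

text \<open>
  \<open>V\<^sup>V\<close> being finite, convergence of measures on it is pointwise convergence of the mass functions.
\<close>

definition subseq_limits :: "('v \<Rightarrow> 'v) pmf \<Rightarrow> ('v \<Rightarrow> 'v) pmf set"
  where "subseq_limits \<mu> =
    {\<rho>. \<exists>s :: nat \<Rightarrow> nat. strict_mono s \<and>
         (\<forall>f. (\<lambda>n. pmf (conv_pow \<mu> (s n)) f) \<longlonglongrightarrow> pmf \<rho> f)}"

definition p_of :: "('v \<Rightarrow> 'v) pmf \<Rightarrow> nat"
  where "p_of \<mu> = card (subseq_limits \<mu>)"

definition eta_of :: "('v \<Rightarrow> 'v) pmf \<Rightarrow> ('v \<Rightarrow> 'v) pmf"
  where "eta_of \<mu> = (THE \<eta>. \<eta> \<in> subseq_limits \<mu> \<and>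
    (\<forall>\<rho>\<in>subseq_limits \<mu>. \<eta> \<star> \<rho> = \<rho> \<and> \<rho> \<star> \<eta> = \<rho>))"

definition nu_of :: "('v \<Rightarrow> 'v) pmf \<Rightarrow> ('v \<Rightarrow> 'v) pmf"
  where "nu_of \<mu> = bind_pmf (pmf_of_set {..<p_of \<mu>}) (\<lambda>k. conv_pow \<mu> k \<star> eta_of \<mu>)"

definition L_of :: "('v \<Rightarrow> 'v) pmf \<Rightarrow> ('v \<Rightarrow> 'v) \<Rightarrow> ('v \<Rightarrow> 'v) set"
  where "L_of \<mu> e = idempotents (set_comp (set_pmf (eta_of \<mu>)) {e})"

definition R_of :: "('v \<Rightarrow> 'v) pmf \<Rightarrow> ('v \<Rightarrow> 'v) \<Rightarrow> ('v \<Rightarrow> 'v) set"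
  where "R_of \<mu> e = idempotents (set_comp {e} (set_pmf (eta_of \<mu>)))"

definition G_of :: "('v \<Rightarrow> 'v) pmf \<Rightarrow> ('v \<Rightarrow> 'v) \<Rightarrow> ('v \<Rightarrow> 'v) monoid"
  where "G_of \<mu> e =
    \<lparr>carrier = set_comp (set_comp {e} (set_pmf (nu_of \<mu>))) {e}, mult = (\<circ>), one = e\<rparr>"

definition H_of :: "('v \<Rightarrow> 'v) pmf \<Rightarrow> ('v \<Rightarrow> 'v) \<Rightarrow> ('v \<Rightarrow> 'v) set"
  where "H_of \<mu> e = set_comp (set_comp {e} (set_pmf (eta_of \<mu>))) {e}"

text \<open>The map \<open>z \<mapsto> (z\<^sup>L, z\<^sup>G, z\<^sup>R)\<close> is meaningful on \<open>set_pmf (nu_of \<mu>) = L G R\<close> only.\<close>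

definition LGR_inv ::
  "('v \<Rightarrow> 'v) pmf \<Rightarrow> ('v \<Rightarrow> 'v) \<Rightarrow> ('v \<Rightarrow> 'v) \<Rightarrow> ('v \<Rightarrow> 'v) \<times> ('v \<Rightarrow> 'v) \<times> ('v \<Rightarrow> 'v)"
  where "LGR_inv \<mu> e =
    the_inv_into (L_of \<mu> e \<times> carrier (G_of \<mu> e) \<times> R_of \<mu> e) (\<lambda>(l, g, r). l \<circ> g \<circ> r)"

definition etaL_of :: "('v \<Rightarrow> 'v) pmf \<Rightarrow> ('v \<Rightarrow> 'v) \<Rightarrow> ('v \<Rightarrow> 'v) pmf"
  where "etaL_of \<mu> e = map_pmf (\<lambda>z. fst (LGR_inv \<mu> e z)) (eta_of \<mu>)"

definition etaR_of :: "('v \<Rightarrow> 'v) pmf \<Rightarrow> ('v \<Rightarrow> 'v) \<Rightarrow> ('v \<Rightarrow> 'v) pmf"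
  where "etaR_of \<mu> e = map_pmf (\<lambda>z. snd (snd (LGR_inv \<mu> e z))) (eta_of \<mu>)"

definition admissible_gamma :: "('v \<Rightarrow> 'v) pmf \<Rightarrow> ('v \<Rightarrow> 'v) \<Rightarrow> ('v \<Rightarrow> 'v) \<Rightarrow> bool"
  where "admissible_gamma \<mu> e \<gamma> \<longleftrightarrow>
    (let G = G_of \<mu> e; H = H_of \<mu> e; p = p_of \<mu> in
      \<gamma> \<in> carrier G \<and>
      \<gamma> [^]\<^bsub>G\<^esub> p \<in> H \<and>
      bij_betw (\<lambda>r. (\<gamma> [^]\<^bsub>G\<^esub> r) <#\<^bsub>G\<^esub> H) {..<p} (lcosets\<^bsub>G\<^esub> H) \<and>
      (\<forall>r<p. conv_pow \<mu> r \<star> eta_of \<mu> =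
        etaL_of \<mu> e \<star> return_pmf (\<gamma> [^]\<^bsub>G\<^esub> r) \<star> pmf_of_set H \<star> etaR_of \<mu> e))"

definition C_of :: "('v \<Rightarrow> 'v) pmf \<Rightarrow> ('v \<Rightarrow> 'v) \<Rightarrow> ('v \<Rightarrow> 'v) \<Rightarrow> ('v \<Rightarrow> 'v) set"
  where "C_of \<mu> e \<gamma> = {\<gamma> [^]\<^bsub>G_of \<mu> e\<^esub> r | r. r < p_of \<mu>}"

definition C_part :: "('v \<Rightarrow> 'v) pmf \<Rightarrow> ('v \<Rightarrow> 'v) \<Rightarrow> ('v \<Rightarrow> 'v) \<Rightarrow> ('v \<Rightarrow> 'v) \<Rightarrow> ('v \<Rightarrow> 'v)"
  where "C_part \<mu> e \<gamma> g = (THE c. c \<in> C_of \<mu> e \<gamma> \<and> (\<exists>h\<in>H_of \<mu> e. g = c \<circ> h))"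


section \<open>F-cliques\<close>

definition deadlock :: "('v \<Rightarrow> 'v) pmf \<Rightarrow> 'v \<Rightarrow> 'v \<Rightarrow> bool"
  where "deadlock \<mu> x y \<longleftrightarrow> (\<forall>g\<in>S_of \<mu>. g x \<noteq> g y)"

definition F_clique :: "('v \<Rightarrow> 'v) pmf \<Rightarrow> 'v set \<Rightarrow> bool"
  where "F_clique \<mu> F \<longleftrightarrow>
    (\<forall>x\<in>F. \<forall>y\<in>F. x \<noteq> y \<longrightarrow> deadlock \<mu> x y) \<and> (\<exists>g\<in>S_of \<mu>. F = range g)"

definition tuples :: "nat \<Rightarrow> 'v list set"
  where "tuples m = {xs. length xs = m}"

definition distinct_tuples :: "nat \<Rightarrow> 'v list set"
  where "distinct_tuples m = {xs. length xs = m \<and> distinct xs}"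

definition W_mu :: "('v :: finite \<Rightarrow> 'v) pmf \<Rightarrow> 'v list set"
  where "W_mu \<mu> = {xs \<in> distinct_tuples (m_of \<mu>). F_clique \<mu> (set xs)}"

definition set_act :: "('v \<Rightarrow> 'v) set \<Rightarrow> 'v list set \<Rightarrow> 'v list set"
  where "set_act A B = {map f xs | f xs. f \<in> A \<and> xs \<in> B}"

definition minimal_W :: "('v :: finite \<Rightarrow> 'v) pmf \<Rightarrow> ('v \<Rightarrow> 'v) \<Rightarrow> 'v list set \<Rightarrow> bool"
  where "minimal_W \<mu> e W \<longleftrightarrow>
    (let eW = set_act {e} (W_mu \<mu>); G = carrier (G_of \<mu> e) in
      W \<subseteq> eW \<and> eW = set_act G W \<and> \<not> (\<exists>W'. W' \<subset> W \<and> eW = set_act G W'))"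

text \<open>The map \<open>x \<mapsto> (x\<^sup>L, x\<^sup>G, x\<^sup>W)\<close> is meaningful on \<open>W_mu \<mu> = L G W\<close> only.\<close>

definition LGW_inv :: "('v :: finite \<Rightarrow> 'v) pmf \<Rightarrow> ('v \<Rightarrow> 'v) \<Rightarrow> 'v list set \<Rightarrow>
    'v list \<Rightarrow> ('v \<Rightarrow> 'v) \<times> ('v \<Rightarrow> 'v) \<times> 'v list"
  where "LGW_inv \<mu> e W =
    the_inv_into (L_of \<mu> e \<times> carrier (G_of \<mu> e) \<times> W) (\<lambda>(f, g, w). map (f \<circ> g) w)"

definition L_comp :: "('v :: finite \<Rightarrow> 'v) pmf \<Rightarrow> ('v \<Rightarrow> 'v) \<Rightarrow> 'v list set \<Rightarrow> 'v list \<Rightarrow> ('v \<Rightarrow> 'v)"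
  where "L_comp \<mu> e W x = fst (LGW_inv \<mu> e W x)"

definition G_comp :: "('v :: finite \<Rightarrow> 'v) pmf \<Rightarrow> ('v \<Rightarrow> 'v) \<Rightarrow> 'v list set \<Rightarrow> 'v list \<Rightarrow> ('v \<Rightarrow> 'v)"
  where "G_comp \<mu> e W x = fst (snd (LGW_inv \<mu> e W x))"

definition G_quot :: "('v :: finite \<Rightarrow> 'v) pmf \<Rightarrow> ('v \<Rightarrow> 'v) \<Rightarrow> 'v list set \<Rightarrow>
    'v list \<Rightarrow> 'v list \<Rightarrow> ('v \<Rightarrow> 'v)"
  where "G_quot \<mu> e W x y =
    G_comp \<mu> e W x \<otimes>\<^bsub>G_of \<mu> e\<^esub> inv\<^bsub>G_of \<mu> e\<^esub> (G_comp \<mu> e W y)"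

definition W_comp :: "('v :: finite \<Rightarrow> 'v) pmf \<Rightarrow> ('v \<Rightarrow> 'v) \<Rightarrow> 'v list set \<Rightarrow> 'v list \<Rightarrow> 'v list"
  where "W_comp \<mu> e W x = snd (snd (LGW_inv \<mu> e W x))"

definition phase_decomposition :: "('v :: finite \<Rightarrow> 'v) pmf \<Rightarrow> ('v \<Rightarrow> 'v) \<Rightarrow> ('v \<Rightarrow> 'v) \<Rightarrow> 'v list set \<Rightarrow>
    (int \<Rightarrow> 'v list pmf) \<Rightarrow> (nat \<Rightarrow> real) \<Rightarrow> (nat \<Rightarrow> 'v list pmf) \<Rightarrow> bool"
  where "phase_decomposition \<mu> e \<gamma> W \<Lambda> \<alpha> \<Lambda>W \<longleftrightarrow>
    (\<forall>r<p_of \<mu>. set_pmf (\<Lambda>W r) \<subseteq> W) \<and>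
    (\<forall>r<p_of \<mu>. 0 \<le> \<alpha> r) \<and> (\<Sum>r<p_of \<mu>. \<alpha> r) = 1 \<and>
    (\<forall>k x. pmf (\<Lambda> k) x =
      (\<Sum>r<p_of \<mu>. \<alpha> r *
        pmf (etaL_of \<mu> e \<star> return_pmf (\<gamma> [^]\<^bsub>G_of \<mu> e\<^esub> (k + int r)) \<star> pmf_of_set (H_of \<mu> e) \<triangleright> \<Lambda>W r) x))"


section \<open>Sub-sigma-fields and evolutions\<close>

text \<open>
  Sub-\<open>\<sigma>\<close>-fields of a probability space \<open>M\<close> are represented as sets of events. All
  random variables below are finite-valued, so their targets carry the discrete \<open>\<sigma>\<close>-field.
\<close>

definition sigma_rv :: "'a measure \<Rightarrow> ('a \<Rightarrow> 'b) \<Rightarrow> 'a set set"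
  where "sigma_rv M Z = sets (vimage_algebra (space M) Z (count_space UNIV))"

definition sigma_family :: "'a measure \<Rightarrow> 'i set \<Rightarrow> ('i \<Rightarrow> 'a \<Rightarrow> 'b) \<Rightarrow> 'a set set"
  where "sigma_family M J Z = sigma_sets (space M) (\<Union>j\<in>J. sigma_rv M (Z j))"

definition sigma_join :: "'a measure \<Rightarrow> 'a set set \<Rightarrow> 'a set set \<Rightarrow> 'a set set"
  where "sigma_join M A B = sigma_sets (space M) (A \<union> B)"

definition as_subset :: "'a measure \<Rightarrow> 'a set set \<Rightarrow> 'a set set \<Rightarrow> bool"
  where "as_subset M A B \<longleftrightarrow> A \<subseteq> sigma_join M B (null_sets M)"

definition as_equal :: "'a measure \<Rightarrow> 'a set set \<Rightarrow> 'a set set \<Rightarrow> bool"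
  where "as_equal M A B \<longleftrightarrow> sigma_join M A (null_sets M) = sigma_join M B (null_sets M)"

definition evolution :: "('v \<Rightarrow> 'v) pmf \<Rightarrow> nat \<Rightarrow> 'a measure \<Rightarrow>
    (int \<Rightarrow> 'a \<Rightarrow> 'v list) \<Rightarrow> (int \<Rightarrow> 'a \<Rightarrow> 'v \<Rightarrow> 'v) \<Rightarrow> bool"
  where "evolution \<mu> m M X N \<longleftrightarrow>
    prob_space M \<and>
    (\<forall>k. X k \<in> measurable M (count_space (tuples m))) \<and>
    (\<forall>k. N k \<in> measurable M (count_space UNIV)) \<and>
    prob_space.indep_vars M (\<lambda>_. count_space UNIV) N UNIV \<and>
    (\<forall>k. AE \<omega> in M. X k \<omega> = map (N k \<omega>) (X (k - 1) \<omega>)) \<and>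
    (\<forall>k. prob_space.indep_set M (sigma_rv M (N k))
           (sigma_family M {..k - 1} (\<lambda>j \<omega>. (X j \<omega>, N j \<omega>)))) \<and>
    (\<forall>k. distr M (count_space UNIV) (N k) = measure_pmf \<mu>)"

definition past :: "'a measure \<Rightarrow> (int \<Rightarrow> 'a \<Rightarrow> 'b) \<Rightarrow> int \<Rightarrow> 'a set set"
  where "past M Z k = sigma_family M {..k} Z"

definition remote_past :: "'a measure \<Rightarrow> (int \<Rightarrow> 'a \<Rightarrow> 'b) \<Rightarrow> 'a set set"
  where "remote_past M Z = (\<Inter>k. past M Z k)"

end

theory Submission
  imports Defs
begin

text \<open>
  Some power \<open>\<rho> = \<mu>\<^sup>N\<close> has a support closed under composition. A two-sided \<open>\<rho>\<close>-invariant law \<open>\<pi>\<close> satisfies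
  \<open>\<rho> \<ge> c \<pi>\<close> for some \<open>c > 0\<close>, so \<open>\<rho>\<^sup>n \<rightarrow> \<pi> = \<eta>\<close>; the limit points of \<open>\<mu>\<^sup>n\<close> are then the \<open>\<mu>\<^sup>r \<star> \<eta>\<close>. The supports of these
  laws consist of maps of one and the same rank, and from the constancy of the rank all the product
  decompositions follow, as maps of the semigroup are injective on the ranges of such maps.

  If the states at time \<open>j\<close> were not deadlocked, they would merge with probability bounded below in boundedly
  many steps; as \<open>j \<rightarrow> -\<infinity>\<close> the states at time \<open>j\<close> are distinct with probability tending to 1, which forces
  deadlocks. So \<open>X\<^bsub>k\<^esub>\<close> is an image of an F-clique. On F-cliques the \<open>W\<close>-component is preserved and the coset
  of the \<open>G\<close>-component moves deterministically by \<open>\<gamma>\<close>; call \<open>Y\<close> the resulting invariant. Writing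
  \<open>X\<^bsub>k\<^esub>\<close> as the image of \<open>X\<^bsub>k-Qn\<^esub>\<close> under independent noise of law \<open>\<mu>\<^bsup>Qn\<^esup> \<rightarrow> \<eta>\<close> shows that, given the remote past,
  \<open>X\<^bsub>k\<^esub>\<close> has the law \<open>\<eta>\<^sup>L \<star> \<omega>\<close> on the class of tuples with invariant \<open>Y\<close>, where \<open>\<omega>\<close> is uniform on a coset of \<open>H\<close>.
  All assertions follow from this identity.
\<close>

text \<open>The facts recalled as known (the cyclic group of limit points, the group
  \<open>G\<close>, normality of \<open>H\<close>, the product bijections) are not hypotheses of the
  theorem; apart from what \<open>admissible_gamma\<close> and \<open>minimal_W\<close> assert, they
  have to be derived from the definitions. The law of \<open>X j\<close> need not converge as j
  tends to -\<infinity>, so there is no limiting state to start from. Only the transition law over a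
  block of noise converges. Summed against the limit of that law, the state at the start of the
  block counts only through the invariant \<open>Y\<close>, whose law does not depend on j; this
  replaces stationarity. The residual \<open>U k\<close> is independent of the whole noise, past and
  future, although \<open>X k\<close> is moved by the noise. The reason is that the noise multiplies
  the \<open>G\<close>-component from the left while \<open>H\<close> can act on it from the right,
  and the two actions commute.\<close>

no_notation convolution (infix "\<star>" 50)

section \<open>Convolution of laws of random maps\<close>

lemma sum_pmf_UNIV: "(\<Sum>f\<in>UNIV. pmf \<rho> f) = (1::real)" for \<rho> :: "('b :: finite) pmf"
  by (simp add: sum_pmf_eq_1)

lemma conv_eq_bind: "\<rho>1 \<star> \<rho>2 = bind_pmf \<rho>1 (\<lambda>f. map_pmf (\<lambda>g. f \<circ> g) \<rho>2)"
  by (simp add: conv_def pair_pmf_def map_bind_pmf map_pmf_def bind_assoc_pmf bind_return_pmf)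

lemma act_eq_bind: "\<rho> \<triangleright> \<Lambda> = bind_pmf \<rho> (\<lambda>f. map_pmf (map f) \<Lambda>)"
  by (simp add: act_def pair_pmf_def map_bind_pmf map_pmf_def bind_assoc_pmf bind_return_pmf)

lemma conv_assoc: "(a \<star> b) \<star> c = a \<star> (b \<star> c)"
  by (simp add: conv_eq_bind map_pmf_def bind_assoc_pmf bind_return_pmf comp_assoc)

lemma conv_act: "(a \<star> b) \<triangleright> \<Lambda> = a \<triangleright> (b \<triangleright> \<Lambda>)"
  by (simp add: conv_eq_bind act_eq_bind map_pmf_def bind_assoc_pmf bind_return_pmf)

lemma conv_return_id [simp]: "return_pmf id \<star> a = a" "a \<star> return_pmf id = a"
  by (simp_all add: conv_eq_bind bind_return_pmf bind_return_pmf' map_pmf_def)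

lemma set_pmf_conv: "set_pmf (a \<star> b) = set_comp (set_pmf a) (set_pmf b)"
  by (auto simp: conv_eq_bind set_comp_def)

text \<open>A polynomial in the point masses: in this form pointwise limits and pointwise
  inequalities pass through a convolution.\<close>

lemma pmf_conv:
  fixes a b :: "('v :: finite \<Rightarrow> 'v) pmf"
  shows "pmf (a \<star> b) h = (\<Sum>f\<in>UNIV. \<Sum>g\<in>UNIV. pmf a f * pmf b g * of_bool (f \<circ> g = h))"
proof -
  have "pmf (a \<star> b) h = (\<integral>f. pmf (map_pmf (\<lambda>g. f \<circ> g) b) h \<partial>measure_pmf a)"
    by (simp add: conv_eq_bind pmf_bind)
  also have "\<dots> = (\<Sum>f\<in>UNIV. pmf a f * pmf (map_pmf (\<lambda>g. f \<circ> g) b) h)"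
    by (subst integral_measure_pmf_real[where A=UNIV]) (auto simp: mult.commute)
  finally have outer: "pmf (a \<star> b) h = (\<Sum>f\<in>UNIV. pmf a f * pmf (map_pmf (\<lambda>g. f \<circ> g) b) h)" .
  have inner: "pmf (map_pmf (\<lambda>g. f \<circ> g) b) h = (\<Sum>g\<in>UNIV. pmf b g * of_bool (f \<circ> g = h))" for f
  proof -
    have "pmf (map_pmf (\<lambda>g. f \<circ> g) b) h = measure (measure_pmf b) {g. f \<circ> g = h}"
      by (simp add: pmf_map vimage_def)
    also have "\<dots> = (\<Sum>g\<in>{g. f \<circ> g = h}. pmf b g)"
      by (rule measure_measure_pmf_finite) simp
    also have "\<dots> = (\<Sum>g\<in>UNIV. pmf b g * of_bool (f \<circ> g = h))"
      by (intro sum.mono_neutral_cong_left) auto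
    finally show ?thesis .
  qed
  show ?thesis unfolding outer inner by (simp only: sum_distrib_left mult.assoc)
qed

lemma conv_pow_add: "conv_pow \<mu> (m + n) = conv_pow \<mu> m \<star> conv_pow \<mu> n"
  by (induction m) (simp_all add: conv_assoc)

lemma conv_pow_commute: "conv_pow \<mu> m \<star> conv_pow \<mu> n = conv_pow \<mu> n \<star> conv_pow \<mu> m"
  by (metis conv_pow_add add.commute)

lemma conv_pow_fixed:
  assumes "\<pi> \<star> \<rho> = \<pi>"
  shows "\<pi> \<star> conv_pow \<rho> k = \<pi>"
  by (induction k) (simp_all add: assms flip: conv_assoc)

lemma conv_pow_1 [simp]: "conv_pow \<mu> (Suc 0) = \<mu>"
  by simp

lemma set_pmf_conv_pow: "set_pmf (conv_pow \<mu> n) = set_pow (set_pmf \<mu>) n"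
  by (induction n) (simp_all add: set_pmf_conv)

lemma set_comp_assoc: "set_comp (set_comp A B) C = set_comp A (set_comp B C)"
proof -
  have "(\<exists>a b. x = a \<circ> b \<and> (\<exists>c d. a = c \<circ> d \<and> c \<in> A \<and> d \<in> B) \<and> b \<in> C) \<longleftrightarrow>
    (\<exists>a b. x = a \<circ> b \<and> a \<in> A \<and> (\<exists>c d. b = c \<circ> d \<and> c \<in> B \<and> d \<in> C))" for x
    by (metis comp_assoc)
  then show ?thesis by (simp add: set_comp_def)
qed

lemma set_comp_id [simp]: "set_comp {id} A = A" "set_comp A {id} = A"
  by (auto simp: set_comp_def)

lemma set_compI: "a \<in> A \<Longrightarrow> b \<in> B \<Longrightarrow> a \<circ> b \<in> set_comp A B"
  by (auto simp: set_comp_def)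

lemma set_compE:
  assumes "x \<in> set_comp A B"
  obtains a b where "a \<in> A" "b \<in> B" "x = a \<circ> b"
  using assms unfolding set_comp_def by blast

lemma set_pow_add: "set_pow A (m + n) = set_comp (set_pow A m) (set_pow A n)"
  by (induction m) (simp_all add: set_comp_assoc)

lemma set_pow_in_S: "0 < n \<Longrightarrow> set_pow (set_pmf \<mu>) n \<subseteq> S_of \<mu>"
  by (force simp: S_of_def)

lemma S_of_comp: "f \<in> S_of \<mu> \<Longrightarrow> g \<in> S_of \<mu> \<Longrightarrow> f \<circ> g \<in> S_of \<mu>"
proof -
  assume "f \<in> S_of \<mu>" "g \<in> S_of \<mu>"
  then obtain m n where "m \<ge> 1" "n \<ge> 1" "f \<in> set_pow (set_pmf \<mu>) m" "g \<in> set_pow (set_pmf \<mu>) n"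
    by (auto simp: S_of_def)
  then have "f \<circ> g \<in> set_pow (set_pmf \<mu>) (m + n)" "m + n \<ge> 1"
    by (auto simp: set_pow_add intro: set_compI)
  then show ?thesis by (auto simp: S_of_def)
qed

section \<open>Limits of the convolution powers\<close>

text \<open>By pigeonhole in the finite power set of the maps, the powers of \<open>A\<close> are
  eventually periodic; a multiple of the period beyond the preperiod is idempotent.\<close>

lemma exists_idempotent_power:
  fixes A :: "('v :: finite \<Rightarrow> 'v) set"
  shows "\<exists>n>0. set_comp (set_pow A n) (set_pow A n) = set_pow A n"
proof -
  have "\<not> inj (set_pow A)"
    using finite_imageD[of "set_pow A" UNIV] by (meson finite infinite_UNIV_nat)
  then obtain i d where d: "d > 0" "set_pow A (i + d) = set_pow A i"
    unfolding inj_def by (metis less_imp_add_positive nat_neq_iff)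
  have step: "set_pow A (i + k + t * d) = set_pow A (i + k)" for k t
  proof (induction t)
    case (Suc t)
    have "set_pow A (i + k + Suc t * d) = set_comp (set_pow A (i + d)) (set_pow A (k + t * d))"
      by (simp flip: set_pow_add add: algebra_simps)
    also have "\<dots> = set_pow A (i + k + t * d)"
      using d by (simp flip: set_pow_add add: algebra_simps)
    finally show ?case using Suc by simp
  qed simp
  \<comment> \<open>A multiple of the period \<open>d\<close>; since \<open>d\<close> is positive,
    the factor \<open>i + 1\<close> makes it both positive and at least \<open>i\<close>.\<close>
  define n where "n = (i + 1) * d"
  have "i \<le> n" "n > 0" using d(1) by (cases d; simp add: n_def)+
  then have "set_pow A (n + n) = set_pow A n"
    using step[of "n - i" "i + 1"] by (simp add: n_def)
  with \<open>n > 0\<close> show ?thesis by (metis set_pow_add)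
qed

text \<open>Two-sided invariant laws are limits of Cesaro means.\<close>

lemma exists_invariant_law:
  fixes \<rho> :: "('v :: finite \<Rightarrow> 'v) pmf"
  shows "\<exists>\<pi>. \<rho> \<star> \<pi> = \<pi> \<and> \<pi> \<star> \<rho> = \<pi> \<and> \<pi> \<star> \<pi> = \<pi> \<and> set_pmf \<pi> \<subseteq> (\<Union>n\<in>{1..}. set_pow (set_pmf \<rho>) n)"
proof -
  \<comment> \<open>The means start at the first power, so that the support of a limit stays in the
    generated semigroup, without the identity map being adjoined.\<close>
  define c where "c n f = (\<Sum>k<Suc n. pmf (conv_pow \<rho> (Suc k)) f) / real (Suc n)" for n f
  \<comment> \<open>Packed as a Euclidean vector in order to extract a convergent subsequence by
    Bolzano-Weierstrass.\<close>
  define v :: "nat \<Rightarrow> real ^ ('v \<Rightarrow> 'v)" where "v n = (\<chi> f. c n f)" for n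
  have c_nonneg: "0 \<le> c n f" for n f by (simp add: c_def sum_nonneg)
  have c_le: "c n f \<le> 1" for n f
  proof -
    have "(\<Sum>k<Suc n. pmf (conv_pow \<rho> (Suc k)) f) \<le> (\<Sum>k<Suc n. 1)"
      by (intro sum_mono pmf_le_1)
    then show ?thesis by (simp add: c_def field_simps del: sum.lessThan_Suc)
  qed
  have c_sum: "(\<Sum>f\<in>UNIV. c n f) = 1" for n
  proof -
    have "(\<Sum>f\<in>UNIV. c n f) = (\<Sum>k<Suc n. \<Sum>f\<in>UNIV. pmf (conv_pow \<rho> (Suc k)) f) / real (Suc n)"
      unfolding c_def by (subst sum.swap) (simp add: sum_divide_distrib del: sum.lessThan_Suc)
    then show ?thesis by (simp add: sum_pmf_UNIV del: sum.lessThan_Suc)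
  qed
  have "bounded (range v)"
  proof (rule boundedI)
    fix x assume "x \<in> range v"
    then obtain n where x: "x = v n" by auto
    have "norm x \<le> (\<Sum>f\<in>UNIV. \<bar>x $ f\<bar>)" by (rule norm_le_l1_cart)
    also have "\<dots> = 1" using c_sum[of n] c_nonneg by (simp add: x v_def)
    finally show "norm x \<le> 1" .
  qed
  then obtain w r where r: "strict_mono r" and lim: "(v \<circ> r) \<longlonglongrightarrow> w"
    using bounded_imp_convergent_subsequence by blast
  have lim_c: "(\<lambda>n. c (r n) f) \<longlonglongrightarrow> w $ f" for f
    using tendsto_vec_nth[OF lim, of f] by (simp add: v_def comp_def)
  have w_nonneg: "0 \<le> w $ f" for f
    by (rule LIMSEQ_le_const[OF lim_c]) (simp add: c_nonneg)
  have "(\<lambda>n. \<Sum>f\<in>UNIV. c (r n) f) \<longlonglongrightarrow> (\<Sum>f\<in>UNIV. w $ f)"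
    by (intro tendsto_sum lim_c)
  then have w_sum: "(\<Sum>f\<in>UNIV. w $ f) = 1"
    by (simp add: c_sum LIMSEQ_const_iff)
  define \<pi> where "\<pi> = embed_pmf (\<lambda>f. w $ f)"
  have pmf_\<pi>: "pmf \<pi> f = w $ f" for f
    unfolding \<pi>_def
  proof (rule pmf_embed_pmf)
    show "(\<integral>\<^sup>+ x. ennreal (w $ x) \<partial>count_space UNIV) = 1"
      by (simp add: nn_integral_count_space_finite sum_nonneg w_nonneg w_sum)
  qed (rule w_nonneg)
  have inv0: "(\<lambda>n. 1 / real (Suc (r n))) \<longlonglongrightarrow> 0"
    using LIMSEQ_subseq_LIMSEQ[OF LIMSEQ_Suc[OF lim_1_over_n] r] by (simp add: comp_def)
  \<comment> \<open>Raising all exponents by one exchanges a single summand, so the mean changes by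
    at most the reciprocal of the number of summands.\<close>
  have shift: "(\<lambda>n. (\<Sum>k<Suc (r n). pmf (conv_pow \<rho> (Suc (Suc k))) h) / real (Suc (r n))) \<longlonglongrightarrow> w $ h" for h
  proof -
    have eq: "(\<Sum>k<Suc (r n). pmf (conv_pow \<rho> (Suc (Suc k))) h) / real (Suc (r n)) =
       c (r n) h + (pmf (conv_pow \<rho> (Suc (Suc (r n)))) h - pmf (conv_pow \<rho> (Suc 0)) h) * (1 / real (Suc (r n)))" for n
    proof -
      have "(\<Sum>k<Suc (r n). pmf (conv_pow \<rho> (Suc (Suc k))) h) - (\<Sum>k<Suc (r n). pmf (conv_pow \<rho> (Suc k)) h)
        = pmf (conv_pow \<rho> (Suc (Suc (r n)))) h - pmf (conv_pow \<rho> (Suc 0)) h"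
        unfolding sum_subtractf[symmetric]
        by (rule sum_lessThan_telescope)
      then show ?thesis unfolding c_def by (simp add: diff_divide_distrib[symmetric] add_divide_distrib[symmetric] del: sum.lessThan_Suc conv_pow.simps)
    qed
    have "(\<lambda>n. (pmf (conv_pow \<rho> (Suc (Suc (r n)))) h - pmf (conv_pow \<rho> (Suc 0)) h) * (1 / real (Suc (r n)))) \<longlonglongrightarrow> 0"
    proof (rule Lim_null_comparison[OF always_eventually inv0], rule allI)
      fix n
      have "\<bar>pmf (conv_pow \<rho> (Suc (Suc (r n)))) h - pmf (conv_pow \<rho> (Suc 0)) h\<bar> \<le> 1"
        using pmf_nonneg pmf_le_1 by (smt (verit))
      then have "\<bar>pmf (conv_pow \<rho> (Suc (Suc (r n)))) h - pmf (conv_pow \<rho> (Suc 0)) h\<bar> * (1 / real (Suc (r n)))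
          \<le> 1 * (1 / real (Suc (r n)))"
        by (intro mult_right_mono) auto
      then show "norm ((pmf (conv_pow \<rho> (Suc (Suc (r n)))) h - pmf (conv_pow \<rho> (Suc 0)) h) * (1 / real (Suc (r n))))
          \<le> 1 / real (Suc (r n))"
        by (simp add: abs_mult del: conv_pow.simps)
    qed
    from tendsto_add[OF lim_c[of h] this] show ?thesis unfolding eq by simp
  qed
  have conv_c: "(\<Sum>f\<in>UNIV. \<Sum>g\<in>UNIV. pmf a f * c n g * of_bool (f \<circ> g = h)) =
      (\<Sum>k<Suc n. pmf (a \<star> conv_pow \<rho> (Suc k)) h) / real (Suc n)" for a n h
  proof -
    have "(\<Sum>f\<in>UNIV. \<Sum>g\<in>UNIV. pmf a f * c n g * of_bool (f \<circ> g = h)) =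
      (\<Sum>f\<in>UNIV. \<Sum>g\<in>UNIV. \<Sum>k<Suc n. pmf a f * pmf (conv_pow \<rho> (Suc k)) g * of_bool (f \<circ> g = h) / real (Suc n))"
      unfolding c_def by (simp add: sum_distrib_left sum_distrib_right sum_divide_distrib del: sum.lessThan_Suc conv_pow.simps)
    also have "\<dots> = (\<Sum>k<Suc n. \<Sum>f\<in>UNIV. \<Sum>g\<in>UNIV. pmf a f * pmf (conv_pow \<rho> (Suc k)) g * of_bool (f \<circ> g = h) / real (Suc n))"
      by (rule trans[OF sum.cong[OF refl sum.swap] sum.swap])
    finally show ?thesis by (simp only: pmf_conv sum_divide_distrib)
  qed
  have c_conv: "(\<Sum>f\<in>UNIV. \<Sum>g\<in>UNIV. c n f * pmf a g * of_bool (f \<circ> g = h)) =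
      (\<Sum>k<Suc n. pmf (conv_pow \<rho> (Suc k) \<star> a) h) / real (Suc n)" for a n h
  proof -
    have "(\<Sum>f\<in>UNIV. \<Sum>g\<in>UNIV. c n f * pmf a g * of_bool (f \<circ> g = h)) =
      (\<Sum>f\<in>UNIV. \<Sum>g\<in>UNIV. \<Sum>k<Suc n. pmf (conv_pow \<rho> (Suc k)) f * pmf a g * of_bool (f \<circ> g = h) / real (Suc n))"
      unfolding c_def by (simp add: sum_distrib_left sum_distrib_right sum_divide_distrib del: sum.lessThan_Suc conv_pow.simps)
    also have "\<dots> = (\<Sum>k<Suc n. \<Sum>f\<in>UNIV. \<Sum>g\<in>UNIV. pmf (conv_pow \<rho> (Suc k)) f * pmf a g * of_bool (f \<circ> g = h) / real (Suc n))"
      by (rule trans[OF sum.cong[OF refl sum.swap] sum.swap])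
    finally show ?thesis by (simp only: pmf_conv sum_divide_distrib)
  qed
  have lim_left: "(\<lambda>n. (\<Sum>k<Suc (r n). pmf (a \<star> conv_pow \<rho> (Suc k)) h) / real (Suc (r n))) \<longlonglongrightarrow> pmf (a \<star> \<pi>) h" for a h
    unfolding conv_c[symmetric] pmf_conv[of a "\<pi>"] pmf_\<pi> by (intro tendsto_intros lim_c)
  have lim_right: "(\<lambda>n. (\<Sum>k<Suc (r n). pmf (conv_pow \<rho> (Suc k) \<star> a) h) / real (Suc (r n))) \<longlonglongrightarrow> pmf (\<pi> \<star> a) h" for a h
    unfolding c_conv[symmetric] pmf_conv[of "\<pi>" a] pmf_\<pi> by (intro tendsto_intros lim_c)
  have left: "\<rho> \<star> \<pi> = \<pi>"
  proof (rule pmf_eqI)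
    fix h show "pmf (\<rho> \<star> \<pi>) h = pmf \<pi> h"
      using LIMSEQ_unique[OF lim_left[of \<rho> h]] shift[of h] by (simp add: pmf_\<pi> del: sum.lessThan_Suc)
  qed
  have right: "\<pi> \<star> \<rho> = \<pi>"
  proof (rule pmf_eqI)
    have "conv_pow \<rho> (Suc k) \<star> \<rho> = conv_pow \<rho> (Suc (Suc k))" for k
      using conv_pow_commute[of \<rho> "Suc k" 1] by simp
    then show "pmf (\<pi> \<star> \<rho>) h = pmf \<pi> h" for h
      using LIMSEQ_unique[OF lim_right[of \<rho> h]] shift[of h] by (simp add: pmf_\<pi> del: sum.lessThan_Suc conv_pow.simps)
  qed
  \<comment> \<open>Since \<pi> absorbs every power of \<rho>, the means of \<pi> convolved with
    these powers are constantly \<pi>, while they tend to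
    \<open>\<pi> \<star> \<pi>\<close>.\<close>
  have idem: "\<pi> \<star> \<pi> = \<pi>"
    using LIMSEQ_unique[OF lim_left[of \<pi>]] conv_pow_fixed[OF right]
    by (intro pmf_eqI) (simp add: LIMSEQ_const_iff del: sum.lessThan_Suc conv_pow.simps)
  have "f \<in> (\<Union>n\<in>{1..}. set_pow (set_pmf \<rho>) n)" if "f \<in> set_pmf \<pi>" for f
  proof (rule ccontr)
    assume "f \<notin> (\<Union>n\<in>{1..}. set_pow (set_pmf \<rho>) n)"
    then have "pmf (conv_pow \<rho> (Suc k)) f = 0" for k
      by (auto simp: set_pmf_conv_pow pmf_eq_0_set_pmf simp del: conv_pow.simps set_pow.simps)
    then have "c n f = 0" for n by (simp add: c_def del: conv_pow.simps)
    then have "w $ f = 0" using lim_c[of f] by (simp add: LIMSEQ_const_iff)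
    then show False using that by (simp add: set_pmf_iff pmf_\<pi>)
  qed
  then show ?thesis using left right idem by blast
qed

text \<open>If \<open>\<rho> \<ge> c \<pi>\<close> pointwise, then \<open>\<rho>\<^sup>n \<ge> (1 - (1 - c)\<^sup>n) \<pi>\<close>, and both sides have almost the same mass.\<close>

lemma conv_pow_tendsto:
  fixes \<rho> \<pi> :: "('v :: finite \<Rightarrow> 'v) pmf"
  assumes left: "\<rho> \<star> \<pi> = \<pi>" and right: "\<pi> \<star> \<rho> = \<pi>" and idem: "\<pi> \<star> \<pi> = \<pi>"
    and supp: "set_pmf \<pi> \<subseteq> set_pmf \<rho>"
  shows "(\<lambda>n. pmf (conv_pow \<rho> n) f) \<longlonglongrightarrow> pmf \<pi> f"
proof -
  \<comment> \<open>The least mass of \<rho> on its support. The masses of \<pi> are at most 1 and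
    its support lies in that of \<rho>, hence c \<pi> \<le> \<rho>.\<close>
  define c where "c = Min ((\<lambda>f. pmf \<rho> f) ` set_pmf \<rho>)"
  have c_mem: "c \<in> (\<lambda>f. pmf \<rho> f) ` set_pmf \<rho>"
    unfolding c_def by (rule Min_in) (auto simp: set_pmf_not_empty)
  then have c: "0 < c" "c \<le> 1" by (auto simp: pmf_positive pmf_le_1)
  have minor: "c * pmf \<pi> f \<le> pmf \<rho> f" for f
  proof (cases "f \<in> set_pmf \<pi>")
    case True
    then have "c \<le> pmf \<rho> f" unfolding c_def using supp by (intro Min_le) auto
    moreover have "c * pmf \<pi> f \<le> c * 1" using c by (intro mult_left_mono pmf_le_1) auto
    ultimately show ?thesis by simp
  qed (simp add: pmf_eq_0_set_pmf[THEN iffD2])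
  define a where "a n = 1 - (1 - c) ^ n" for n
  have lower: "a n * pmf \<pi> h \<le> pmf (conv_pow \<rho> n) h" for n h
  proof (induction n arbitrary: h)
    case (Suc n)
    \<comment> \<open>The convolution of the nonnegative remainders \<rho> - c \<pi> and \<rho>^n -
      a_n \<pi>. By invariance all mixed terms are multiples of \<pi>, and a_n + c - c a_n is
      a_(n+1).\<close>
    have "0 \<le> (\<Sum>f\<in>UNIV. \<Sum>g\<in>UNIV. (pmf \<rho> f - c * pmf \<pi> f) * (pmf (conv_pow \<rho> n) g - a n * pmf \<pi> g) * of_bool (f \<circ> g = h))"
      using minor Suc by (intro sum_nonneg mult_nonneg_nonneg) auto
    also have "\<dots> = pmf (\<rho> \<star> conv_pow \<rho> n) h - a n * pmf (\<rho> \<star> \<pi>) h - c * pmf (\<pi> \<star> conv_pow \<rho> n) h + c * a n * pmf (\<pi> \<star> \<pi>) h"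
      unfolding pmf_conv sum_distrib_left sum_subtractf[symmetric] sum.distrib[symmetric]
      by (intro sum.cong refl) (simp add: algebra_simps)
    also have "\<dots> = pmf (conv_pow \<rho> (Suc n)) h - a (Suc n) * pmf \<pi> h"
      by (simp add: left idem conv_pow_fixed[OF right] a_def algebra_simps)
    finally show ?case by simp
  qed (simp add: a_def)
  have upper: "pmf (conv_pow \<rho> n) f \<le> a n * pmf \<pi> f + (1 - a n)" for n
  proof -
    \<comment> \<open>The excess over a_n \<pi> at one point is at most the total excess, which is 1
      - a_n.\<close>
    have "pmf (conv_pow \<rho> n) f - a n * pmf \<pi> f \<le> (\<Sum>g\<in>UNIV. pmf (conv_pow \<rho> n) g - a n * pmf \<pi> g)"
      using lower by (intro member_le_sum) auto
    also have "\<dots> = 1 - a n" by (simp add: sum_subtractf sum_pmf_UNIV flip: sum_distrib_left)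
    finally show ?thesis by simp
  qed
  have a: "a \<longlonglongrightarrow> 1" unfolding a_def using c by (auto intro!: tendsto_eq_intros LIMSEQ_power_zero)
  have l: "(\<lambda>n. a n * pmf \<pi> f) \<longlonglongrightarrow> pmf \<pi> f" "(\<lambda>n. a n * pmf \<pi> f + (1 - a n)) \<longlonglongrightarrow> pmf \<pi> f"
    using a by (auto intro!: tendsto_eq_intros)
  show ?thesis
    by (rule tendsto_sandwich[OF always_eventually always_eventually l]) (use lower upper in auto)
qed

lemma pmf_conv_tendsto:
  fixes a :: "('v :: finite \<Rightarrow> 'v) pmf"
  assumes "\<And>f. (\<lambda>n. pmf (b n) f) \<longlonglongrightarrow> pmf c f"
  shows "(\<lambda>n. pmf (a \<star> b n) f) \<longlonglongrightarrow> pmf (a \<star> c) f"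
  unfolding pmf_conv by (intro tendsto_intros assms)

lemma conv_pow_mult: "conv_pow \<mu> (N * n) = conv_pow (conv_pow \<mu> N) n"
  by (induction n) (simp_all add: conv_pow_add)

text \<open>The choice of \<open>N\<close> by \<open>exists_idempotent_power\<close> makes all
  positive powers of \<rho> share one support. The invariant law is supported in their union, hence
  in the support of \<rho>, as \<open>conv_pow_tendsto\<close> requires. Commutation with \<mu> is
  inherited in the limit from the powers of \<mu>.\<close>

lemma exists_periodic_limit:
  fixes \<mu> :: "('v :: finite \<Rightarrow> 'v) pmf"
  obtains N \<pi> where "N > 0" "\<pi> \<star> \<pi> = \<pi>" "\<mu> \<star> \<pi> = \<pi> \<star> \<mu>" "conv_pow \<mu> N \<star> \<pi> = \<pi>"
    "set_pmf \<pi> \<subseteq> S_of \<mu>" "\<And>f. (\<lambda>n. pmf (conv_pow \<mu> (N * n)) f) \<longlonglongrightarrow> pmf \<pi> f"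
proof -
  obtain N where N: "N > 0" "set_comp (set_pow (set_pmf \<mu>) N) (set_pow (set_pmf \<mu>) N) = set_pow (set_pmf \<mu>) N"
    using exists_idempotent_power by blast
  define \<rho> where "\<rho> = conv_pow \<mu> N"
  obtain \<pi> where \<pi>: "\<rho> \<star> \<pi> = \<pi>" "\<pi> \<star> \<rho> = \<pi>" "\<pi> \<star> \<pi> = \<pi>"
      "set_pmf \<pi> \<subseteq> (\<Union>n\<in>{1..}. set_pow (set_pmf \<rho>) n)"
    using exists_invariant_law by blast
  have "set_pow (set_pmf \<rho>) (Suc n) = set_pmf \<rho>" for n
    by (induction n) (use N in \<open>simp_all add: \<rho>_def set_pmf_conv_pow\<close>)
  then have "set_pow (set_pmf \<rho>) n = set_pmf \<rho>" if "n \<ge> 1" for n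
    using that by (metis Suc_le_D One_nat_def)
  with \<pi>(4) have supp: "set_pmf \<pi> \<subseteq> set_pmf \<rho>" by auto
  have lim: "(\<lambda>n. pmf (conv_pow \<mu> (N * n)) f) \<longlonglongrightarrow> pmf \<pi> f" for f
    using conv_pow_tendsto[OF \<pi>(1-3) supp] by (simp add: conv_pow_mult \<rho>_def)
  have "\<mu> \<star> \<pi> = \<pi> \<star> \<mu>"
  proof (rule pmf_eqI)
    fix f
    have "(\<lambda>n. pmf (\<mu> \<star> conv_pow \<mu> (N * n)) f) \<longlonglongrightarrow> pmf (\<mu> \<star> \<pi>) f"
      unfolding pmf_conv by (intro tendsto_intros lim)
    moreover have "(\<lambda>n. pmf (conv_pow \<mu> (N * n) \<star> \<mu>) f) \<longlonglongrightarrow> pmf (\<pi> \<star> \<mu>) f"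
      unfolding pmf_conv by (intro tendsto_intros lim)
    moreover have "conv_pow \<mu> (N * n) \<star> \<mu> = \<mu> \<star> conv_pow \<mu> (N * n)" for n
      using conv_pow_commute[of \<mu> "N * n" "Suc 0"] by simp
    ultimately show "pmf (\<mu> \<star> \<pi>) f = pmf (\<pi> \<star> \<mu>) f"
      using LIMSEQ_unique by auto
  qed
  moreover have "set_pmf \<pi> \<subseteq> S_of \<mu>"
    using supp set_pow_in_S[OF N(1), of \<mu>] by (auto simp: \<rho>_def set_pmf_conv_pow)
  ultimately show thesis using that[OF N(1) \<pi>(3)] \<pi>(1) lim by (simp add: \<rho>_def)
qed

section \<open>The cyclic group of limit points, its identity and its order\<close>

lemma conv_pow_commute_fixed:
  assumes "\<mu> \<star> \<pi> = \<pi> \<star> \<mu>"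
  shows "conv_pow \<mu> k \<star> \<pi> = \<pi> \<star> conv_pow \<mu> k"
proof (induction k)
  case (Suc k)
  have "conv_pow \<mu> (Suc k) \<star> \<pi> = (\<mu> \<star> \<pi>) \<star> conv_pow \<mu> k" by (simp add: Suc conv_assoc)
  then show ?case by (simp add: assms conv_assoc)
qed simp

text \<open>Here \<eta> is any law with these properties; \<open>eta_of_eq\<close> shows that they
  force it to be the law selected by \<open>eta_of\<close>. The period \<open>N\<close> need not be
  the least one.\<close>

locale periodic_limit =
  fixes \<mu> \<eta> :: "('v :: finite \<Rightarrow> 'v) pmf" and N :: nat
  assumes N: "N > 0" and idem: "\<eta> \<star> \<eta> = \<eta>" and commute: "\<mu> \<star> \<eta> = \<eta> \<star> \<mu>"
    and period: "conv_pow \<mu> N \<star> \<eta> = \<eta>" and supp: "set_pmf \<eta> \<subseteq> S_of \<mu>"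
    and lim: "(\<lambda>n. pmf (conv_pow \<mu> (N * n)) f) \<longlonglongrightarrow> pmf \<eta> f"
begin

lemma pow_commute: "conv_pow \<mu> k \<star> \<eta> = \<eta> \<star> conv_pow \<mu> k"
  by (rule conv_pow_commute_fixed[OF commute])

lemma pow_eta_conv: "(conv_pow \<mu> i \<star> \<eta>) \<star> (conv_pow \<mu> j \<star> \<eta>) = conv_pow \<mu> (i + j) \<star> \<eta>"
proof -
  have "(conv_pow \<mu> i \<star> \<eta>) \<star> (conv_pow \<mu> j \<star> \<eta>) = conv_pow \<mu> i \<star> (\<eta> \<star> \<eta>) \<star> conv_pow \<mu> j"
    by (simp add: pow_commute[of j] conv_assoc)
  also have "\<dots> = conv_pow \<mu> i \<star> (\<eta> \<star> conv_pow \<mu> j)" by (simp only: idem conv_assoc)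
  also have "\<dots> = conv_pow \<mu> (i + j) \<star> \<eta>"
    by (simp add: pow_commute[of j, symmetric] conv_pow_add conv_assoc)
  finally show ?thesis .
qed

lemma pow_mult_period:
  assumes "conv_pow \<mu> q \<star> \<eta> = \<eta>"
  shows "conv_pow \<mu> (i + q * t) \<star> \<eta> = conv_pow \<mu> i \<star> \<eta>"
proof (induction t)
  case (Suc t)
  have "conv_pow \<mu> (i + q * Suc t) \<star> \<eta> = conv_pow \<mu> (i + q * t) \<star> (conv_pow \<mu> q \<star> \<eta>)"
    by (simp flip: conv_pow_add conv_assoc add: algebra_simps)
  then show ?case by (simp add: assms Suc)
qed simp

text \<open>Infinitely many exponents of a given subsequence lie in one residue class r modulo
  \<open>N\<close>, and along these the powers converge to the r-th power of \<mu> convolved with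
  \<eta>.\<close>

lemma subseq_limits_eq: "subseq_limits \<mu> = range (\<lambda>r. conv_pow \<mu> r \<star> \<eta>)"
proof (intro equalityI subsetI)
  fix \<rho> assume "\<rho> \<in> range (\<lambda>r. conv_pow \<mu> r \<star> \<eta>)"
  then obtain r where \<rho>: "\<rho> = conv_pow \<mu> r \<star> \<eta>" by auto
  have "(\<lambda>n. pmf (conv_pow \<mu> (r + N * n)) f) \<longlonglongrightarrow> pmf \<rho> f" for f
    unfolding conv_pow_add \<rho> by (rule pmf_conv_tendsto[OF lim])
  moreover have "strict_mono (\<lambda>n. r + N * n)" using N by (intro strict_monoI) simp
  ultimately show "\<rho> \<in> subseq_limits \<mu>" unfolding subseq_limits_def by blast
next
  fix \<rho> assume "\<rho> \<in> subseq_limits \<mu>"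
  then obtain s where s: "strict_mono s" "\<And>f. (\<lambda>n. pmf (conv_pow \<mu> (s n)) f) \<longlonglongrightarrow> pmf \<rho> f"
    unfolding subseq_limits_def by blast
  have "\<exists>r\<in>{..<N}. infinite {n \<in> UNIV. s n mod N = r}"
    by (rule pigeonhole_infinite_rel) (use N in auto)
  then obtain r where r: "infinite {n. s n mod N = r}" by auto
  define t where "t = enumerate {n. s n mod N = r}"
  have t: "strict_mono t" "\<And>n. s (t n) mod N = r"
    using r enumerate_in_set[OF r] unfolding t_def by (auto simp: strict_mono_enumerate)
  have "(\<lambda>n. pmf (conv_pow \<mu> (s (t n))) f) \<longlonglongrightarrow> pmf (conv_pow \<mu> r \<star> \<eta>) f" for f
  proof -
    have "s (t n) = r + N * (s (t n) div N)" for n using t(2)[of n] mod_mult_div_eq[of "s (t n)" N] by simp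
    then have eq: "conv_pow \<mu> (s (t n)) = conv_pow \<mu> r \<star> conv_pow \<mu> (N * (s (t n) div N))" for n
      by (metis conv_pow_add)
    have "filterlim (\<lambda>n. s (t n) div N) at_top sequentially"
    proof (rule filterlim_at_top_mono)
      show "filterlim (\<lambda>n. n div N) at_top sequentially"
        unfolding filterlim_at_top
      proof
        fix Z show "\<forall>\<^sub>F n in sequentially. Z \<le> n div N"
          using N by (intro eventually_sequentiallyI[of "Z * N"]) (simp add: less_eq_div_iff_mult_less_eq)
      qed
      show "\<forall>\<^sub>F n in sequentially. n div N \<le> s (t n) div N"
        using seq_suble[OF s(1)] seq_suble[OF t(1)] by (intro always_eventually allI div_le_mono) (meson order.trans)
    qed
    then have "(\<lambda>n. pmf (conv_pow \<mu> (N * (s (t n) div N))) f) \<longlonglongrightarrow> pmf \<eta> f" for f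
      by (rule filterlim_compose[OF lim])
    then show ?thesis unfolding eq by (rule pmf_conv_tendsto)
  qed
  moreover have "(\<lambda>n. pmf (conv_pow \<mu> (s (t n))) f) \<longlonglongrightarrow> pmf \<rho> f" for f
    using LIMSEQ_subseq_LIMSEQ[OF s(2) t(1)] by (simp add: comp_def)
  ultimately have "\<rho> = conv_pow \<mu> r \<star> \<eta>"
    by (intro pmf_eqI) (blast intro: LIMSEQ_unique)
  then show "\<rho> \<in> range (\<lambda>r. conv_pow \<mu> r \<star> \<eta>)" by blast
qed

lemma eta_of_eq: "eta_of \<mu> = \<eta>"
  unfolding eta_of_def
proof (rule the_equality)
  have mem: "\<eta> \<in> subseq_limits \<mu>" unfolding subseq_limits_eq by (rule range_eqI[of _ _ 0]) simp
  have neutral: "\<forall>\<rho>\<in>subseq_limits \<mu>. \<eta> \<star> \<rho> = \<rho> \<and> \<rho> \<star> \<eta> = \<rho>"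
  proof
    fix \<rho> assume "\<rho> \<in> subseq_limits \<mu>"
    then obtain r where "\<rho> = conv_pow \<mu> r \<star> \<eta>" unfolding subseq_limits_eq by auto
    then show "\<eta> \<star> \<rho> = \<rho> \<and> \<rho> \<star> \<eta> = \<rho>"
      using pow_eta_conv[of 0 r] pow_eta_conv[of r 0] by simp
  qed
  show "\<eta> \<in> subseq_limits \<mu> \<and> (\<forall>\<rho>\<in>subseq_limits \<mu>. \<eta> \<star> \<rho> = \<rho> \<and> \<rho> \<star> \<eta> = \<rho>)"
    using mem neutral by blast
  show "x = \<eta>" if "x \<in> subseq_limits \<mu> \<and> (\<forall>\<rho>\<in>subseq_limits \<mu>. x \<star> \<rho> = \<rho> \<and> \<rho> \<star> x = \<rho>)" for x
    using that mem neutral by metis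
qed

text \<open>\<open>p_of\<close> is defined as a cardinality; it is identified with the least
  positive period q, because the exponents below q give pairwise distinct laws and exhaust the limit
  points.\<close>

lemma p_of_period: "p_of \<mu> > 0" "conv_pow \<mu> (p_of \<mu>) \<star> \<eta> = \<eta>"
proof -
  define q where "q = (LEAST q. q > 0 \<and> conv_pow \<mu> q \<star> \<eta> = \<eta>)"
  have q: "q > 0" "conv_pow \<mu> q \<star> \<eta> = \<eta>"
    using LeastI[of "\<lambda>q. q > 0 \<and> conv_pow \<mu> q \<star> \<eta> = \<eta>" N] N period by (auto simp: q_def)
  have least: "\<not> (0 < t \<and> t < q \<and> conv_pow \<mu> t \<star> \<eta> = \<eta>)" for t
    using not_less_Least[of t "\<lambda>q. q > 0 \<and> conv_pow \<mu> q \<star> \<eta> = \<eta>"] by (auto simp: q_def)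
  \<comment> \<open>Multiplying by the power \<open>q - b\<close> of \<mu> turns a coincidence at a
    < b into the period \<open>q - b + a\<close>, which is positive and smaller than q.\<close>
  have aux: False if ab: "a < b" "b < q" "conv_pow \<mu> a \<star> \<eta> = conv_pow \<mu> b \<star> \<eta>" for a b
  proof -
    have "conv_pow \<mu> (q - b + a) \<star> \<eta> = conv_pow \<mu> (q - b + b) \<star> \<eta>"
      using ab(3) by (simp only: conv_pow_add conv_assoc)
    then have "conv_pow \<mu> (q - b + a) \<star> \<eta> = \<eta>" using ab q by simp
    then show False using least[of "q - b + a"] ab by auto
  qed
  then have "inj_on (\<lambda>r. conv_pow \<mu> r \<star> \<eta>) {..<q}"
    by (intro linorder_inj_onI') (metis lessThan_iff)
  moreover have "range (\<lambda>r. conv_pow \<mu> r \<star> \<eta>) = (\<lambda>r. conv_pow \<mu> r \<star> \<eta>) ` {..<q}"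
  proof (intro equalityI subsetI)
    fix x assume "x \<in> range (\<lambda>r. conv_pow \<mu> r \<star> \<eta>)"
    then obtain r where "x = conv_pow \<mu> (r mod q + q * (r div q)) \<star> \<eta>" by auto
    then have "x = conv_pow \<mu> (r mod q) \<star> \<eta>" by (simp only: pow_mult_period[OF q(2)])
    then show "x \<in> (\<lambda>r. conv_pow \<mu> r \<star> \<eta>) ` {..<q}" using q(1) by auto
  qed auto
  ultimately have "p_of \<mu> = q" unfolding p_of_def subseq_limits_eq by (simp add: card_image)
  with q show "p_of \<mu> > 0" "conv_pow \<mu> (p_of \<mu>) \<star> \<eta> = \<eta>" by auto
qed

end

lemma eta_of_facts:
  fixes \<mu> :: "('v :: finite \<Rightarrow> 'v) pmf"
  obtains N where "periodic_limit \<mu> (eta_of \<mu>) N"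
proof -
  obtain N \<pi> where "N > 0" "\<pi> \<star> \<pi> = \<pi>" "\<mu> \<star> \<pi> = \<pi> \<star> \<mu>" "conv_pow \<mu> N \<star> \<pi> = \<pi>"
    "set_pmf \<pi> \<subseteq> S_of \<mu>" "\<And>f. (\<lambda>n. pmf (conv_pow \<mu> (N * n)) f) \<longlonglongrightarrow> pmf \<pi> f"
    using exists_periodic_limit[of \<mu>] by metis
  then have *: "periodic_limit \<mu> \<pi> N" by unfold_locales auto
  then have "eta_of \<mu> = \<pi>" by (rule periodic_limit.eta_of_eq)
  with * show thesis using that by simp
qed

section \<open>The kernel of the generated semigroup\<close>

lemma card_range_comp_le:
  fixes f g :: "'v :: finite \<Rightarrow> 'v"
  shows "card (range (f \<circ> g)) \<le> card (range f)" "card (range (f \<circ> g)) \<le> card (range g)"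
proof -
  show "card (range (f \<circ> g)) \<le> card (range f)" by (intro card_mono) auto
  have "range (f \<circ> g) = f ` range g" by auto
  then show "card (range (f \<circ> g)) \<le> card (range g)" by (metis card_image_le finite)
qed

lemma exists_idempotent_funpow:
  fixes f :: "'v :: finite \<Rightarrow> 'v"
  shows "\<exists>n>0. (f ^^ n) \<circ> (f ^^ n) = f ^^ n"
proof -
  have pow: "set_pow {f} n = {f ^^ n}" for n
    by (induction n) (auto simp: set_comp_def)
  show ?thesis using exists_idempotent_power[of "{f}"] by (simp add: pow set_comp_def)
qed

lemma comp_eq_of_range_subset:
  assumes "f \<circ> f = f" "range g \<subseteq> range f"
  shows "f \<circ> g = g"
proof
  fix x
  from assms(2) obtain y where "g x = f y" by auto
  then show "(f \<circ> g) x = g x" using assms(1) by (metis comp_apply)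
qed

text \<open>For an idempotent law, \<open>P(rank > r) \<le> P(rank > r)\<^sup>2\<close>, so its support has constant rank.\<close>

lemma idempotent_law_rank:
  fixes \<eta> :: "('v :: finite \<Rightarrow> 'v) pmf"
  assumes idem: "\<eta> \<star> \<eta> = \<eta>" and x: "x \<in> set_pmf \<eta>" and y: "y \<in> set_pmf \<eta>"
  shows "card (range x) = card (range y)"
proof -
  define r where "r = Min ((\<lambda>f. card (range f)) ` set_pmf \<eta>)"
  define Q where "Q = {f :: 'v \<Rightarrow> 'v. card (range f) > r}"
  have le: "r \<le> card (range f)" if "f \<in> set_pmf \<eta>" for f
    unfolding r_def using that by (intro Min_le) auto
  have "r \<in> (\<lambda>f. card (range f)) ` set_pmf \<eta>"
    unfolding r_def by (rule Min_in) (auto simp: set_pmf_not_empty)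
  then obtain f0 where f0: "f0 \<in> set_pmf \<eta>" "f0 \<notin> Q" by (auto simp: Q_def)
  have "measure (measure_pmf \<eta>) Q = measure (measure_pmf (pair_pmf \<eta> \<eta>)) ((\<lambda>(f, g). f \<circ> g) -` Q)"
    by (subst idem[symmetric]) (simp add: conv_def)
  also have "\<dots> \<le> measure (measure_pmf (pair_pmf \<eta> \<eta>)) (Q \<times> Q)"
  proof (intro measure_pmf.finite_measure_mono subsetI)
    fix z :: "('v \<Rightarrow> 'v) \<times> ('v \<Rightarrow> 'v)" assume "z \<in> (\<lambda>(f, g). f \<circ> g) -` Q"
    then have "card (range (fst z \<circ> snd z)) > r" unfolding Q_def by (simp only: vimage_eq mem_Collect_eq case_prod_beta)
    then have "card (range (fst z)) > r" "card (range (snd z)) > r"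
      using card_range_comp_le[of "fst z" "snd z"] by linarith+
    then show "z \<in> Q \<times> Q" by (simp add: Q_def mem_Times_iff)
  qed simp
  also have "\<dots> = measure (measure_pmf \<eta>) Q * measure (measure_pmf \<eta>) Q"
    by (rule measure_pmf_prob_product) auto
  finally have sq: "measure (measure_pmf \<eta>) Q \<le> measure (measure_pmf \<eta>) Q * measure (measure_pmf \<eta>) Q" .
  \<comment> \<open>A map of least rank is charged, so this probability is below 1; a number in [0,
    1) that is at most its own square is 0.\<close>
  have "measure (measure_pmf \<eta>) Q \<noteq> 1"
    using f0 by (subst measure_pmf.prob_eq_1) (auto simp: AE_measure_pmf_iff)
  then have lt: "measure (measure_pmf \<eta>) Q < 1"
    using measure_pmf.prob_le_1[of \<eta> Q] by linarith
  have "measure (measure_pmf \<eta>) Q = 0"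
  proof (rule ccontr)
    assume "measure (measure_pmf \<eta>) Q \<noteq> 0"
    then have "0 < measure (measure_pmf \<eta>) Q" by (simp add: zero_less_measure_iff)
    then have "measure (measure_pmf \<eta>) Q * measure (measure_pmf \<eta>) Q < 1 * measure (measure_pmf \<eta>) Q"
      using lt by (intro mult_strict_right_mono)
    with sq show False by simp
  qed
  then have "set_pmf \<eta> \<inter> Q = {}" by (simp add: measure_pmf_zero_iff)
  then have "card (range f) = r" if "f \<in> set_pmf \<eta>" for f
    using le[OF that] that by (force simp: Q_def)
  then show ?thesis using x y by simp
qed

section \<open>Grading of the kernel and maps of minimal rank\<close>

locale kernel =
  fixes \<mu> :: "('v :: finite \<Rightarrow> 'v) pmf" and e :: "'v \<Rightarrow> 'v"
  assumes e: "e \<in> idempotents (set_pmf (eta_of \<mu>))"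
begin

abbreviation \<eta> where "\<eta> \<equiv> eta_of \<mu>"
abbreviation m where "m \<equiv> m_of \<mu>"
abbreviation p where "p \<equiv> p_of \<mu>"
abbreviation S where "S \<equiv> S_of \<mu>"
abbreviation L where "L \<equiv> L_of \<mu> e"
abbreviation R where "R \<equiv> R_of \<mu> e"
abbreviation G where "G \<equiv> G_of \<mu> e"
abbreviation H where "H \<equiv> H_of \<mu> e"

text \<open>A grading of the kernel by residues modulo \<open>p\<close>: degrees add under
  composition (\<open>Kg_comp\<close>) and degree 0 is the support of \<eta>. Degrees are kept as
  natural numbers, with \<open>Kg_period\<close> for the reduction.\<close>

definition Kg :: "nat \<Rightarrow> ('v \<Rightarrow> 'v) set"
  where "Kg k = set_pmf (conv_pow \<mu> k \<star> \<eta>)"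

text \<open>The support of \<nu>, that is, the least ideal of the semigroup; see
  \<open>nu_eq\<close>.\<close>

definition K :: "('v \<Rightarrow> 'v) set"
  where "K = (\<Union>k. Kg k)"

lemma p_pos: "p > 0"
  by (meson eta_of_facts periodic_limit.p_of_period(1))

lemma Kg_0: "Kg 0 = set_pmf \<eta>"
  by (simp add: Kg_def)

lemma Kg_comp: "x \<in> Kg i \<Longrightarrow> y \<in> Kg j \<Longrightarrow> x \<circ> y \<in> Kg (i + j)"
proof -
  assume xy: "x \<in> Kg i" "y \<in> Kg j"
  obtain N where "periodic_limit \<mu> \<eta> N" by (rule eta_of_facts)
  then interpret periodic_limit \<mu> \<eta> N .
  show ?thesis
    using xy unfolding Kg_def pow_eta_conv[symmetric] set_pmf_conv[of "conv_pow \<mu> i \<star> \<eta>"] by (rule set_compI)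
qed

lemma Kg_period: "Kg (i + p * t) = Kg i"
proof -
  obtain N where "periodic_limit \<mu> \<eta> N" by (rule eta_of_facts)
  then interpret periodic_limit \<mu> \<eta> N .
  show ?thesis unfolding Kg_def by (simp add: pow_mult_period p_of_period)
qed

lemma Kg_mult_p: "Kg (p * t) = set_pmf \<eta>"
  using Kg_period[of 0 t] by (simp add: Kg_0)

lemma Kg_mod: "Kg k = Kg (k mod p)"
  using Kg_period[of "k mod p" "k div p"] by simp

lemma pow_Kg:
  assumes "f \<in> set_pow (set_pmf \<mu>) n" "x \<in> Kg k"
  shows "f \<circ> x \<in> Kg (n + k)" "x \<circ> f \<in> Kg (k + n)"
proof -
  obtain N where "periodic_limit \<mu> \<eta> N" by (rule eta_of_facts)
  then interpret periodic_limit \<mu> \<eta> N .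
  have "f \<circ> x \<in> set_pmf (conv_pow \<mu> n \<star> (conv_pow \<mu> k \<star> \<eta>))"
    using assms unfolding set_pmf_conv[of "conv_pow \<mu> n"] Kg_def set_pmf_conv_pow by (intro set_compI)
  then show "f \<circ> x \<in> Kg (n + k)" by (simp add: Kg_def conv_pow_add conv_assoc)
  have "x \<circ> f \<in> set_pmf ((conv_pow \<mu> k \<star> \<eta>) \<star> conv_pow \<mu> n)"
    using assms unfolding set_pmf_conv[of "conv_pow \<mu> k \<star> \<eta>"] Kg_def set_pmf_conv_pow by (intro set_compI)
  then show "x \<circ> f \<in> Kg (k + n)" by (simp add: Kg_def conv_pow_add conv_assoc pow_commute[of n])
qed

lemma S_K:
  assumes "f \<in> S" "x \<in> K"
  shows "f \<circ> x \<in> K" "x \<circ> f \<in> K"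
proof -
  obtain n where "f \<in> set_pow (set_pmf \<mu>) n" using assms(1) unfolding S_of_def by (rule UN_E)
  moreover obtain k where "x \<in> Kg k" using assms(2) unfolding K_def by (rule UN_E)
  ultimately show "f \<circ> x \<in> K" "x \<circ> f \<in> K"
    unfolding K_def by (auto intro: pow_Kg)
qed

lemma K_comp: "x \<in> K \<Longrightarrow> y \<in> K \<Longrightarrow> x \<circ> y \<in> K"
  using Kg_comp unfolding K_def by blast

lemma eta_subset_K: "set_pmf \<eta> \<subseteq> K"
  using Kg_0 unfolding K_def by blast

lemma eta_subset_S: "set_pmf \<eta> \<subseteq> S"
  by (meson eta_of_facts periodic_limit.supp)

lemma K_subset_S: "K \<subseteq> S"
proof
  fix x assume "x \<in> K"
  then obtain k where "x \<in> Kg k" by (auto simp: K_def)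
  \<comment> \<open>The exponent k may be 0, and the zeroth power of the support is the identity
    map, which may lie outside \<open>S\<close>; adding \<open>p\<close> makes the exponent positive
    without changing the grade.\<close>
  then have "x \<in> Kg (k + p)" using Kg_period[of k 1] by simp
  then obtain a b where "x = a \<circ> b" "a \<in> set_pow (set_pmf \<mu>) (k + p)" "b \<in> set_pmf \<eta>"
    by (auto simp: Kg_def set_pmf_conv set_comp_def set_pmf_conv_pow)
  then show "x \<in> S" using set_pow_in_S[of "k + p" \<mu>] eta_subset_S p_pos S_of_comp[of a \<mu> b] by auto
qed

lemma e_eta: "e \<in> set_pmf \<eta>" and e_idem: "e \<circ> e = e"
  using e by (auto simp: idempotents_def)

lemma e_K: "e \<in> K"
  using e_eta eta_subset_K by auto

lemma e_S: "e \<in> S"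
  using e_K K_subset_S by auto

lemma e_left [simp]: "e \<circ> (e \<circ> x) = e \<circ> x"
  using e_idem by (metis comp_assoc)

lemma funpow_Kg: "x \<in> Kg k \<Longrightarrow> x ^^ Suc n \<in> Kg (k * Suc n)"
proof (induction n)
  case (Suc n)
  have "x \<circ> x ^^ Suc n \<in> Kg (k + k * Suc n)" by (rule Kg_comp[OF Suc.prems Suc.IH[OF Suc.prems]])
  moreover have "x ^^ Suc (Suc n) = x \<circ> x ^^ Suc n" by (rule funpow.simps)
  moreover have "k * Suc (Suc n) = k + k * Suc n" by simp
  ultimately show ?case by (simp only:)
qed simp

text \<open>The degree of x is multiplied by the exponent, hence becomes a multiple of
  \<open>p\<close>.\<close>

lemma funpow_p: "x \<in> K \<Longrightarrow> t > 0 \<Longrightarrow> x ^^ (p * t) \<in> set_pmf \<eta>"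
proof -
  assume "x \<in> K" "t > 0"
  then obtain k where "x \<in> Kg k" by (auto simp: K_def)
  moreover obtain n where "p * t = Suc n" using p_pos \<open>t > 0\<close> by (metis gr0_conv_Suc mult_pos_pos)
  ultimately show ?thesis using funpow_Kg[of x k n] Kg_mult_p[of "k * t"] by (simp add: ac_simps)
qed

text \<open>An idempotent equals its own \<open>p\<close>-th power, which has degree 0.\<close>

lemma idem_K_eta: "x \<in> K \<Longrightarrow> x \<circ> x = x \<Longrightarrow> x \<in> set_pmf \<eta>"
proof -
  assume x: "x \<in> K" "x \<circ> x = x"
  have "x ^^ Suc n = x" for n
  proof (induction n)
    case (Suc n)
    have "x ^^ Suc (Suc n) = x \<circ> x ^^ Suc n" by (rule funpow.simps)
    then show ?case using x by (simp only: Suc)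
  qed (rule ext, simp)
  then show ?thesis using funpow_p[OF x(1), of 1] p_pos by (metis gr0_conv_Suc mult.right_neutral zero_less_one)
qed

lemma rank_eta: "x \<in> set_pmf \<eta> \<Longrightarrow> card (range x) = card (range e)"
proof -
  assume x: "x \<in> set_pmf \<eta>"
  obtain N where "periodic_limit \<mu> \<eta> N" by (rule eta_of_facts)
  then show ?thesis by (intro idempotent_law_rank[OF _ x e_eta] periodic_limit.idem)
qed

text \<open>Upper bound: the right factor of x comes from the support of \<eta>. Lower bound: the
  \<open>p\<close>-th power of x lies in that support and has at most the rank of x.\<close>

lemma rank_K_e: "x \<in> K \<Longrightarrow> card (range x) = card (range e)"
proof -
  assume x: "x \<in> K"
  then obtain a b where "x = a \<circ> b" "b \<in> set_pmf \<eta>"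
    by (auto simp: K_def Kg_def set_pmf_conv set_comp_def)
  then have le: "card (range x) \<le> card (range e)"
    using card_range_comp_le(2)[of a b] rank_eta[of b] by simp
  obtain n where n: "p = Suc n" using p_pos by (metis gr0_conv_Suc)
  have "x ^^ p \<in> set_pmf \<eta>" using funpow_p[OF x, of 1] by simp
  then have "x \<circ> x ^^ n \<in> set_pmf \<eta>" unfolding n by (simp only: funpow.simps)
  then have "card (range e) = card (range (x \<circ> x ^^ n))" using rank_eta by metis
  also have "\<dots> \<le> card (range x)" by (rule card_range_comp_le)
  finally show ?thesis using le by simp
qed

text \<open>Composing any f of the semigroup with \<open>e\<close> lands in \<open>K\<close>, where
  the rank is that of \<open>e\<close>; so f cannot have smaller rank.\<close>

lemma m_eq: "m = card (range e)"
proof -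
  have "card (range e) \<le> card (range f)" if "f \<in> S" for f
    using rank_K_e[OF S_K(1)[OF that e_K]] card_range_comp_le(1)[of f e] by simp
  then show ?thesis
    unfolding m_of_def using e_S by (intro Min_eqI) auto
qed

lemma rank_K: "x \<in> K \<Longrightarrow> card (range x) = m"
  by (simp add: m_eq rank_K_e)

text \<open>The form in which constancy of the rank is used: \<open>f \<circ> x\<close> is again in
  \<open>K\<close>, so f cannot merge points of the range of x.\<close>

lemma inj_on_range: "f \<in> S \<Longrightarrow> x \<in> K \<Longrightarrow> inj_on f (range x)"
proof -
  assume "f \<in> S" "x \<in> K"
  then have "card (f ` range x) = card (range x)"
    using rank_K[OF S_K(1), of f x] rank_K[of x] by (simp add: image_comp)
  then show ?thesis by (intro eq_card_imp_inj_on) auto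
qed

text \<open>The counterpart on the right: the range can only shrink, but its size is
  constant.\<close>

lemma range_comp_eq: "x \<in> K \<Longrightarrow> f \<in> S \<Longrightarrow> range (x \<circ> f) = range x"
proof -
  assume "x \<in> K" "f \<in> S"
  then have "card (range (x \<circ> f)) = card (range x)" using rank_K S_K by metis
  then show ?thesis by (intro card_subset_eq) auto
qed

text \<open>\<open>f\<close> takes the same value at \<open>e x\<close> and at
  \<open>f (e x)\<close>; both points lie in the range of \<open>e\<close>, where \<open>f\<close>
  is injective. This is the cancellation rule behind all product decompositions.\<close>

lemma idem_comp_e: "f \<in> K \<Longrightarrow> f \<circ> f = f \<Longrightarrow> e \<circ> f = f \<Longrightarrow> f \<circ> e = e"
proof
  fix x assume f: "f \<in> K" "f \<circ> f = f" "e \<circ> f = f"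
  have inj: "inj_on f (range e)" using f(1) K_subset_S e_K by (intro inj_on_range) auto
  have "f (f (e x)) = f (e x)" using f(2) by (metis comp_apply)
  moreover have "f (e x) \<in> range e" using f(3) by (metis comp_apply rangeI)
  ultimately show "(f \<circ> e) x = e x" using inj by (auto dest: inj_onD)
qed

subsection \<open>The group\<close>

lemma nu_eq: "set_pmf (nu_of \<mu>) = K"
proof -
  have "set_pmf (nu_of \<mu>) = (\<Union>k<p. Kg k)"
    using p_pos by (auto simp: nu_of_def Kg_def set_pmf_of_set lessThan_empty_iff)
  also have "\<dots> = K"
  proof
    show "K \<subseteq> (\<Union>k<p. Kg k)"
      unfolding K_def
    proof (rule UN_least)
      fix k
      show "Kg k \<subseteq> (\<Union>k<p. Kg k)"
        using p_pos by (subst Kg_mod) (rule UN_upper, simp)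
    qed
  qed (auto simp: K_def)
  finally show ?thesis .
qed

lemma mult_G [simp]: "x \<otimes>\<^bsub>G\<^esub> y = x \<circ> y"
  by (simp add: G_of_def)

lemma one_G [simp]: "\<one>\<^bsub>G\<^esub> = e"
  by (simp add: G_of_def)

lemma carrier_G: "x \<in> carrier G \<longleftrightarrow> x \<in> K \<and> e \<circ> x = x \<and> x \<circ> e = x"
proof
  assume "x \<in> carrier G"
  then show "x \<in> K \<and> e \<circ> x = x \<and> x \<circ> e = x"
    using e_K K_comp e_idem by (auto simp: G_of_def nu_eq set_comp_def comp_assoc)
next
  assume x: "x \<in> K \<and> e \<circ> x = x \<and> x \<circ> e = x"
  then have "(e \<circ> x) \<circ> e \<in> carrier G"
    unfolding G_of_def partial_object.simps nu_eq by (intro set_compI) auto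
  with x show "x \<in> carrier G" by simp
qed

lemma H_iff: "x \<in> H \<longleftrightarrow> x \<in> set_pmf \<eta> \<and> e \<circ> x = x \<and> x \<circ> e = x"
proof
  have *: "a \<circ> b \<in> set_pmf \<eta>" if "a \<in> set_pmf \<eta>" "b \<in> set_pmf \<eta>" for a b
    using Kg_comp[of a 0 b 0] that by (simp add: Kg_0)
  assume "x \<in> H"
  then show "x \<in> set_pmf \<eta> \<and> e \<circ> x = x \<and> x \<circ> e = x"
    using e_eta * e_idem by (auto simp: H_of_def set_comp_def comp_assoc)
next
  assume x: "x \<in> set_pmf \<eta> \<and> e \<circ> x = x \<and> x \<circ> e = x"
  then have "(e \<circ> x) \<circ> e \<in> H"
    unfolding H_of_def by (intro set_compI) auto
  with x show "x \<in> H" by simp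
qed

lemma carrier_G_I: "x \<in> K \<Longrightarrow> e \<circ> x \<circ> e \<in> carrier G"
  unfolding carrier_G by (intro conjI K_comp e_K) (simp_all add: comp_assoc e_idem)

lemma funpow_G: "g \<in> carrier G \<Longrightarrow> g ^^ Suc n \<in> carrier G"
proof (induction n)
  case (Suc n)
  have *: "g ^^ Suc (Suc n) = g \<circ> g ^^ Suc n" "g ^^ Suc (Suc n) = g ^^ Suc n \<circ> g"
    by (rule funpow.simps funpow_Suc_right)+
  have "g ^^ Suc (Suc n) \<in> K" using Suc unfolding *(1) carrier_G by (intro K_comp) auto
  moreover have "e \<circ> g ^^ Suc (Suc n) = g ^^ Suc (Suc n)"
    using Suc.prems unfolding *(1) carrier_G by (metis comp_assoc)
  moreover have "g ^^ Suc (Suc n) \<circ> e = g ^^ Suc (Suc n)"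
    using Suc.prems unfolding *(2) carrier_G by (metis comp_assoc)
  ultimately show ?case unfolding carrier_G by blast
qed (simp add: carrier_G)

text \<open>Some power of g is idempotent, and \<open>idem_comp_e\<close> leaves \<open>e\<close> as
  the only idempotent of the group. The exponent is enlarged to a multiple of \<open>p\<close> so
  that degrees can be controlled in \<open>inv_power\<close>.\<close>

lemma power_eq_e: "g \<in> carrier G \<Longrightarrow> \<exists>n>0. g ^^ (p * n) = e"
proof -
  assume g: "g \<in> carrier G"
  obtain n where n: "n > 0" "g ^^ n \<circ> g ^^ n = g ^^ n" using exists_idempotent_funpow by blast
  define f where "f = g ^^ n"
  obtain n' where n': "n = Suc n'" using n(1) by (metis gr0_conv_Suc)
  have f: "f \<in> carrier G" "f \<circ> f = f" unfolding f_def using funpow_G[OF g, of n'] n(2) by (simp_all only: n')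
  then have gn: "g ^^ n = e" using idem_comp_e[of f] unfolding carrier_G f_def by metis
  have *: "g ^^ (n * Suc k) = e" for k
  proof (induction k)
    case (Suc k)
    have "g ^^ (n * Suc (Suc k)) = g ^^ n \<circ> g ^^ (n * Suc k)" by (simp only: mult_Suc_right[of n "Suc k"] funpow_add)
    then show ?case by (simp only: Suc gn e_idem)
  qed (simp add: gn)
  obtain k where "p = Suc k" using p_pos by (metis gr0_conv_Suc)
  then have "g ^^ (p * n) = e" using *[of k] by (simp only: mult.commute)
  with n(1) show ?thesis by blast
qed

lemma G_group: "group G"
proof (rule groupI)
  fix x assume x: "x \<in> carrier G"
  then obtain n where n: "n > 0" "x ^^ (p * n) = e" using power_eq_e by blast
  obtain q where q: "p * n = Suc q" using n p_pos by (metis gr0_conv_Suc mult_pos_pos)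
  show "\<exists>y\<in>carrier G. y \<otimes>\<^bsub>G\<^esub> x = \<one>\<^bsub>G\<^esub>"
  \<comment> \<open>For q = 0 the candidate \<open>x ^^ q\<close> is the identity map rather than
    \<open>e\<close>, so this case takes x itself as its inverse.\<close>
  proof (cases q)
    case 0
    then show ?thesis using x n q by (intro bexI[of _ x]) (auto simp: carrier_G e_idem)
  next
    case (Suc t)
    have "x ^^ q \<otimes>\<^bsub>G\<^esub> x = \<one>\<^bsub>G\<^esub>" using n(2) unfolding q mult_G one_G funpow_Suc_right .
    then show ?thesis using funpow_G[OF x, of t] Suc by blast
  qed
next
  fix x y assume "x \<in> carrier G" "y \<in> carrier G"
  then show "x \<otimes>\<^bsub>G\<^esub> y \<in> carrier G"
    unfolding carrier_G mult_G using K_comp by (metis comp_assoc)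
qed (simp_all add: carrier_G comp_assoc e_K e_idem)

sublocale G: group G
  by (rule G_group)

text \<open>The inverse is written as a positive power whose exponent is -1 modulo \<open>p\<close>;
  the divisibility serves the degree count in \<open>H_normal\<close>.\<close>

lemma inv_power: "g \<in> carrier G \<Longrightarrow> \<exists>n. inv\<^bsub>G\<^esub> g = g ^^ Suc n \<and> p dvd Suc (Suc n)"
proof -
  assume g: "g \<in> carrier G"
  then obtain n where n: "n > 0" "g ^^ (p * n) = e" using power_eq_e by blast
  \<comment> \<open>Doubling makes the exponent at least 2, so the exponent of the inverse, one
    less, is still positive.\<close>
  have "g ^^ (p * (2 * n)) = e" using n by (simp only: mult_2 distrib_left funpow_add e_idem)
  moreover obtain q where q: "p * (2 * n) = Suc (Suc q)" 
  proof -
    obtain a where "p * n = Suc a" using n p_pos by (metis gr0_conv_Suc mult_pos_pos)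
    then show ?thesis using that[of "2 * a"] by simp
  qed
  ultimately have "(g ^^ Suc q) \<circ> g = e" by (metis funpow_Suc_right)
  then have "inv\<^bsub>G\<^esub> g = g ^^ Suc q"
    using G.inv_equality[of "g ^^ Suc q" g] g funpow_G[OF g] by simp
  moreover have "p dvd Suc (Suc q)" using q by (metis dvd_triv_left)
  ultimately show ?thesis by blast
qed

text \<open>By degrees: \<open>H\<close> is the part of degree 0 of the group, and conjugating by an
  element of degree k adds k and a multiple of k that together are divisible by
  \<open>p\<close>.\<close>

lemma H_normal: "H \<lhd> G"
proof -
  have HG: "H \<subseteq> carrier G" using eta_subset_K by (auto simp: H_iff carrier_G)
  have comp: "x \<circ> y \<in> H" if "x \<in> H" "y \<in> H" for x y
    using that Kg_comp[of x 0 y 0] unfolding H_iff Kg_0[symmetric] by (metis add_0 comp_assoc)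
  have pow: "x ^^ Suc n \<in> H" if "x \<in> H" for x n
  proof (induction n)
    case (Suc n)
    have "x ^^ Suc (Suc n) = x \<circ> x ^^ Suc n" by (rule funpow.simps)
    then show ?case using comp[OF that Suc] by (simp only:)
  qed (use that in simp)
  have "subgroup H G"
  proof (rule G.subgroupI)
    show "H \<noteq> {}" using e_eta e_idem by (auto simp: H_iff)
    show "inv\<^bsub>G\<^esub> a \<in> H" if "a \<in> H" for a
      using inv_power[of a] pow[OF that] that HG by (metis subsetD)
  qed (use HG comp in \<open>simp_all del: comp_apply\<close>)
  moreover have "x \<otimes>\<^bsub>G\<^esub> h \<otimes>\<^bsub>G\<^esub> inv\<^bsub>G\<^esub> x \<in> H" if x: "x \<in> carrier G" and h: "h \<in> H" for x h
  proof -
    obtain n where n: "inv\<^bsub>G\<^esub> x = x ^^ Suc n" "p dvd Suc (Suc n)" using inv_power[OF x] by blast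
    obtain k where k: "x \<in> Kg k" using x by (auto simp: carrier_G K_def)
    have mem: "x \<circ> h \<circ> x ^^ Suc n \<in> Kg (k + 0 + k * Suc n)"
      using h k by (intro Kg_comp funpow_Kg) (auto simp: Kg_0 H_iff)
    obtain t where t: "Suc (Suc n) = p * t" using n(2) by (rule dvdE)
    have "k + 0 + k * Suc n = k * Suc (Suc n)" by simp
    then have "k + 0 + k * Suc n = p * (k * t)" unfolding t by (simp only: mult.left_commute)
    from mem[unfolded this Kg_mult_p] have "x \<circ> h \<circ> x ^^ Suc n \<in> set_pmf \<eta>" .
    moreover have "x \<circ> h \<circ> inv\<^bsub>G\<^esub> x \<in> carrier G"
      using G.m_closed[OF G.m_closed[OF x subsetD[OF HG h]] G.inv_closed[OF x]] by (simp only: mult_G)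
    ultimately show ?thesis using n(1) unfolding H_iff carrier_G mult_G by (simp only:)
  qed
  ultimately show ?thesis by (simp add: G.normal_inv_iff)
qed

sublocale H: normal H G
  by (rule H_normal)

lemma H_subset: "H \<subseteq> carrier G"
  by (rule H.subset)

subsection \<open>The product decomposition\<close>

text \<open>Idempotency is traded for absorption rules with \<open>e\<close>, which is what
  computations with products use. For the less obvious rule, \<open>e \<circ> l\<close> is an
  idempotent, and \<open>idem_comp_e\<close> collapses it.\<close>

lemma L_iff: "l \<in> L \<longleftrightarrow> l \<in> set_pmf \<eta> \<and> l \<circ> e = l \<and> e \<circ> l = e"
proof
  assume "l \<in> L"
  then obtain b where b: "b \<in> set_pmf \<eta>" "l = b \<circ> e" and ll: "l \<circ> l = l"
    by (auto simp: L_of_def idempotents_def set_comp_def)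
  have l: "l \<in> set_pmf \<eta>" using Kg_comp[of b 0 e 0] b e_eta by (simp add: Kg_0)
  have le: "l \<circ> e = l" using b e_idem by (simp add: comp_assoc)
  have "(e \<circ> l) \<circ> e = e"
  proof (rule idem_comp_e)
    show "e \<circ> l \<in> K" using l e_K eta_subset_K K_comp by auto
    show "(e \<circ> l) \<circ> (e \<circ> l) = e \<circ> l" using le ll by (metis comp_assoc)
  qed simp
  then show "l \<in> set_pmf \<eta> \<and> l \<circ> e = l \<and> e \<circ> l = e" using l le by (simp add: comp_assoc)
next
  assume *: "l \<in> set_pmf \<eta> \<and> l \<circ> e = l \<and> e \<circ> l = e"
  then have "l \<circ> l = l" by (metis comp_assoc)
  moreover have "l \<circ> e \<in> set_comp (set_pmf \<eta>) {e}" using * by (intro set_compI) auto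
  ultimately show "l \<in> L" using * by (simp add: L_of_def idempotents_def)
qed

lemma R_iff: "r \<in> R \<longleftrightarrow> r \<in> set_pmf \<eta> \<and> e \<circ> r = r \<and> r \<circ> e = e"
proof
  assume "r \<in> R"
  then obtain b where b: "b \<in> set_pmf \<eta>" "r = e \<circ> b" and rr: "r \<circ> r = r"
    by (auto simp: R_of_def idempotents_def set_comp_def)
  have r: "r \<in> set_pmf \<eta>" using Kg_comp[of e 0 b 0] b e_eta by (simp add: Kg_0)
  have er: "e \<circ> r = r" using b by simp
  show "r \<in> set_pmf \<eta> \<and> e \<circ> r = r \<and> r \<circ> e = e"
    using r er rr idem_comp_e[of r] eta_subset_K by auto
next
  assume *: "r \<in> set_pmf \<eta> \<and> e \<circ> r = r \<and> r \<circ> e = e"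
  then have "r \<circ> r = r" by (metis comp_assoc)
  moreover have "e \<circ> r \<in> set_comp {e} (set_pmf \<eta>)" using * by (intro set_compI) auto
  ultimately show "r \<in> R" using * by (simp add: R_of_def idempotents_def)
qed

lemma L_K: "l \<in> L \<Longrightarrow> l \<in> K" and R_K: "r \<in> R \<Longrightarrow> r \<in> K"
  using eta_subset_K by (auto simp: L_iff R_iff)

text \<open>Multiplying by \<open>e\<close> on the right absorbs r and on the left absorbs l; both
  together isolate g, and cancelling g in the one-sided products gives l and r.\<close>

lemma LGR_inj: "inj_on (\<lambda>(l, g, r). l \<circ> g \<circ> r) (L \<times> carrier G \<times> R)"
proof -
  have "l = l' \<and> g = g' \<and> r = r'"
    if *: "l \<in> L" "l' \<in> L" "g \<in> carrier G" "g' \<in> carrier G" "r \<in> R" "r' \<in> R"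
      and eq: "l \<circ> g \<circ> r = l' \<circ> g' \<circ> r'" for l g r l' g' r'
  proof -
  have zl: "(l \<circ> g \<circ> r) \<circ> e = l \<circ> g" "(l' \<circ> g' \<circ> r') \<circ> e = l' \<circ> g'"
    using * by (auto simp: R_iff carrier_G comp_assoc)
  have "e \<circ> (l \<circ> g) = g" "e \<circ> (l' \<circ> g') = g'"
    using * by (auto simp: L_iff carrier_G simp flip: comp_assoc)
  then have g: "g = g'" using zl eq by metis
  have "e \<circ> (l \<circ> g \<circ> r) = g \<circ> r" "e \<circ> (l' \<circ> g' \<circ> r') = g' \<circ> r'"
    using * by (auto simp: L_iff carrier_G simp flip: comp_assoc)
  then have gr: "g \<circ> r = g \<circ> r'" using eq g by metis
  have lg: "l \<circ> g = l' \<circ> g" using zl eq g by metis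
  have inv: "inv\<^bsub>G\<^esub> g \<circ> g = e" "g \<circ> inv\<^bsub>G\<^esub> g = e" using * G.l_inv[of g] G.r_inv[of g] by auto
  have "l = l \<circ> g \<circ> inv\<^bsub>G\<^esub> g" using * inv by (simp add: comp_assoc L_iff)
  also have "\<dots> = l'" using * inv lg by (simp add: comp_assoc L_iff)
  finally have l: "l = l'" .
  have "r = inv\<^bsub>G\<^esub> g \<circ> (g \<circ> r)" using * inv by (simp add: R_iff flip: comp_assoc)
  also have "\<dots> = r'" using * inv gr by (simp add: R_iff flip: comp_assoc)
  finally have r: "r = r'" .
  show "l = l' \<and> g = g' \<and> r = r'" using l g r by simp
  qed
  then show ?thesis by (intro inj_onI) (clarify, blast)
qed

text \<open>The Rees coordinates of z: with g the compression of z by \<open>e\<close> and h the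
  inverse of g in the group, the outer factors are z h and h z.\<close>

lemma LGR_surj:
  assumes z: "z \<in> K"
  obtains l g r where "l \<in> L" "g \<in> carrier G" "r \<in> R" "z = l \<circ> g \<circ> r"
proof -
  define g where "g = e \<circ> z \<circ> e"
  define h where "h = inv\<^bsub>G\<^esub> g"
  have g: "g \<in> carrier G" unfolding g_def using z by (rule carrier_G_I)
  have h: "h \<in> carrier G" unfolding h_def using g by simp
  have hg: "h \<circ> g = e" "g \<circ> h = e" using G.l_inv[OF g] G.r_inv[OF g] by (auto simp: h_def)
  define l where "l = z \<circ> h"
  define r where "r = h \<circ> z"
  have heh: "e \<circ> h = h" "h \<circ> e = h" using h by (auto simp: carrier_G)
  have ezh: "e \<circ> (z \<circ> h) = e"
  proof -
    have "e \<circ> (z \<circ> h) = e \<circ> z \<circ> (e \<circ> h)" by (simp add: heh comp_assoc)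
    then show ?thesis using hg by (simp add: g_def comp_assoc)
  qed
  have hze: "h \<circ> z \<circ> e = e"
  proof -
    have "h \<circ> z \<circ> e = (h \<circ> e) \<circ> z \<circ> e" by (simp add: heh)
    then show ?thesis using hg by (simp add: g_def comp_assoc)
  qed
  have hK: "h \<in> K" using h by (simp add: carrier_G)
  have le: "l \<circ> e = l" "e \<circ> l = e" using heh ezh by (simp_all add: l_def comp_assoc)
  have re: "e \<circ> r = r" "r \<circ> e = e" using heh hze by (simp_all add: r_def flip: comp_assoc)
  have "l \<circ> l = l" using le by (metis comp_assoc)
  then have l: "l \<in> L" using le idem_K_eta[of l] K_comp[OF z hK] by (simp add: L_iff l_def)
  have "r \<circ> r = r" using re by (metis comp_assoc)
  then have r: "r \<in> R" using re idem_K_eta[of r] K_comp[OF hK z] by (simp add: R_iff r_def)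
  have "l \<circ> g \<circ> r = z \<circ> (h \<circ> g) \<circ> r" by (simp add: l_def comp_assoc)
  also have "\<dots> = l \<circ> z" using hg re by (simp add: comp_assoc) (simp add: l_def r_def comp_assoc)
  \<comment> \<open>Right composition keeps the range of a map of \<open>K\<close>, so l has the
    range of z, and an idempotent fixes its range pointwise.\<close>
  also have "l \<circ> z = z"
  proof (rule comp_eq_of_range_subset)
    show "l \<circ> l = l" by fact
    show "range z \<subseteq> range l" unfolding l_def using range_comp_eq[OF z, of h] hK K_subset_S by auto
  qed
  finally show thesis using that[OF l g r] by simp
qed

lemma LGR_inv_eq: "l \<in> L \<Longrightarrow> g \<in> carrier G \<Longrightarrow> r \<in> R \<Longrightarrow> LGR_inv \<mu> e (l \<circ> g \<circ> r) = (l, g, r)"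
  unfolding LGR_inv_def using the_inv_into_f_f[OF LGR_inj, of "(l, g, r)"] by simp

lemma set_etaL: "set_pmf (etaL_of \<mu> e) \<subseteq> L"
proof
  fix l assume "l \<in> set_pmf (etaL_of \<mu> e)"
  then obtain z where z: "z \<in> set_pmf \<eta>" "l = fst (LGR_inv \<mu> e z)" by (auto simp: etaL_of_def)
  then obtain l' g r where "l' \<in> L" "g \<in> carrier G" "r \<in> R" "z = l' \<circ> g \<circ> r"
    using LGR_surj[of z] eta_subset_K by blast
  then show "l \<in> L" using z LGR_inv_eq by simp
qed

lemma set_etaR: "set_pmf (etaR_of \<mu> e) \<subseteq> R"
proof
  fix r assume "r \<in> set_pmf (etaR_of \<mu> e)"
  then obtain z where z: "z \<in> set_pmf \<eta>" "r = snd (snd (LGR_inv \<mu> e z))" by (auto simp: etaR_of_def)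
  then obtain l g r' where "l \<in> L" "g \<in> carrier G" "r' \<in> R" "z = l \<circ> g \<circ> r'"
    using LGR_surj[of z] eta_subset_K by blast
  then show "r \<in> R" using z LGR_inv_eq by simp
qed

end

section \<open>F-cliques and the decomposition of \<open>W_mu\<close>\<close>

context kernel
begin

text \<open>If a range of size \<open>m\<close> is a clique, its map already has minimal rank, so
  composing with \<open>e\<close> keeps the range and moves the map into \<open>K\<close>.
  Conversely, ranges of maps of \<open>K\<close> are deadlocked by
  \<open>inj_on_range\<close>.\<close>

lemma W_mu_iff: "xs \<in> W_mu \<mu> \<longleftrightarrow> length xs = m \<and> distinct xs \<and> (\<exists>z\<in>K. set xs = range z)"
proof
  assume "xs \<in> W_mu \<mu>"
  then have xs: "length xs = m" "distinct xs" "F_clique \<mu> (set xs)"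
    by (auto simp: W_mu_def distinct_tuples_def)
  then obtain g where g: "g \<in> S" "set xs = range g" by (auto simp: F_clique_def)
  have "card (range g) = m" using xs g by (metis distinct_card)
  moreover have "card (range (g \<circ> e)) = m" by (rule rank_K[OF S_K(1)[OF g(1) e_K]])
  ultimately have "range (g \<circ> e) = range g" by (intro card_subset_eq) auto
  then show "length xs = m \<and> distinct xs \<and> (\<exists>z\<in>K. set xs = range z)"
    using xs g S_K(1)[OF g(1) e_K] by metis
next
  assume *: "length xs = m \<and> distinct xs \<and> (\<exists>z\<in>K. set xs = range z)"
  then obtain z where z: "z \<in> K" "set xs = range z" by blast
  have "deadlock \<mu> x y" if "x \<in> set xs" "y \<in> set xs" "x \<noteq> y" for x y
    unfolding deadlock_def using inj_on_range[OF _ z(1)] that z(2) by (metis inj_onD)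
  then show "xs \<in> W_mu \<mu>"
    using * z K_subset_S unfolding W_mu_def distinct_tuples_def F_clique_def by blast
qed

lemma finite_W_mu: "finite (W_mu \<mu>)"
  by (rule finite_subset[OF _ finite_lists_length_eq[of UNIV m]]) (auto simp: W_mu_iff)

lemma W_mu_inj: "xs \<in> W_mu \<mu> \<Longrightarrow> f \<in> S \<Longrightarrow> inj_on f (set xs)"
  using inj_on_range by (metis W_mu_iff)

lemma W_mu_map: "xs \<in> W_mu \<mu> \<Longrightarrow> f \<in> S \<Longrightarrow> map f xs \<in> W_mu \<mu>"
proof -
  assume xs: "xs \<in> W_mu \<mu>" and f: "f \<in> S"
  then obtain z where z: "z \<in> K" "set xs = range z" by (auto simp: W_mu_iff)
  have "set (map f xs) = range (f \<circ> z)" by (simp only: set_map z image_comp)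
  then show ?thesis
    using xs W_mu_inj[OF xs f] S_K(1)[OF f z(1)] unfolding W_mu_iff distinct_map length_map by blast
qed

text \<open>The set e W_mu of the minimality condition in explicit form (\<open>set_act_e\<close>):
  the enumerations of the range of \<open>e\<close>.\<close>

definition E :: "'v list set"
  where "E = {xs. length xs = m \<and> distinct xs \<and> set xs = range e}"

lemma E_subset_W_mu: "E \<subseteq> W_mu \<mu>"
  unfolding E_def by (rule subsetI) (use e_K in \<open>auto simp only: W_mu_iff mem_Collect_eq\<close>)

lemma map_e_E: "xs \<in> E \<Longrightarrow> map e xs = xs"
proof -
  assume xs: "xs \<in> E"
  have "e x = x" if "x \<in> set xs" for x
  proof -
    have "x \<in> range e" using that xs by (simp add: E_def)
    then obtain y where "x = e y" by blast
    then show ?thesis using fun_cong[OF e_idem, of y] by simp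
  qed
  then show ?thesis by (simp add: map_idI)
qed

lemma map_E:
  assumes xs: "xs \<in> W_mu \<mu>" and g: "g \<in> K" "e \<circ> g = g"
  shows "map g xs \<in> E"
proof -
  have m: "map g xs \<in> W_mu \<mu>" using W_mu_map[OF xs] g K_subset_S by blast
  have "g y \<in> range e" for y using fun_cong[OF g(2), of y] by (metis comp_apply rangeI)
  then have "set (map g xs) \<subseteq> range e" unfolding set_map by blast
  moreover have "card (set (map g xs)) = card (range e)"
    using m distinct_card[of "map g xs"] unfolding W_mu_iff m_eq[symmetric] by (simp only:)
  ultimately have "set (map g xs) = range e" by (intro card_subset_eq) auto
  then show ?thesis using m unfolding E_def W_mu_iff by blast
qed

lemma set_act_e: "set_act {e} (W_mu \<mu>) = E"
proof (intro equalityI subsetI)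
  fix x assume "x \<in> set_act {e} (W_mu \<mu>)"
  then show "x \<in> E" using map_E[OF _ e_K e_idem] by (auto simp: set_act_def)
next
  fix x assume "x \<in> E"
  then show "x \<in> set_act {e} (W_mu \<mu>)"
    using map_e_E[of x] E_subset_W_mu unfolding set_act_def by force
qed

lemma carrier_map_E: "g \<in> carrier G \<Longrightarrow> xs \<in> E \<Longrightarrow> map g xs \<in> E"
  using map_E E_subset_W_mu by (auto simp: carrier_G)

lemma map_comp_eq: "map f (map g xs) = map (f \<circ> g) xs"
  by simp

lemma map_inv_E: "g \<in> carrier G \<Longrightarrow> xs \<in> E \<Longrightarrow> map (inv\<^bsub>G\<^esub> g) (map g xs) = xs"
proof -
  assume g: "g \<in> carrier G" and xs: "xs \<in> E"
  have "inv\<^bsub>G\<^esub> g \<circ> g = e" using G.l_inv[OF g] by simp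
  then show ?thesis unfolding map_comp_eq by (simp only: map_e_E[OF xs])
qed

text \<open>The entries of xs exhaust the range of \<open>e\<close>, so agreement on the tuple is
  agreement on that range.\<close>

lemma E_map_eqD: "xs \<in> E \<Longrightarrow> map f xs = map g xs \<Longrightarrow> f \<circ> e = g \<circ> e"
  by (auto simp: E_def fun_eq_iff map_eq_conv)

end

section \<open>Coordinates of F-clique tuples in \<open>L\<close>, \<open>G\<close> and
  \<open>W\<close>\<close>

locale clique_basis = kernel \<mu> e for \<mu> :: "('v :: finite \<Rightarrow> 'v) pmf" and e +
  fixes W :: "'v list set"
  assumes minimal: "minimal_W \<mu> e W"
begin

lemma W_subset_E: "W \<subseteq> E" and GW: "set_act (carrier G) W = E"
  and W_minimal: "W' \<subset> W \<Longrightarrow> E \<noteq> set_act (carrier G) W'"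
proof -
  have *: "W \<subseteq> E \<and> E = set_act (carrier G) W \<and> \<not> (\<exists>W'. W' \<subset> W \<and> E = set_act (carrier G) W')"
    using minimal unfolding minimal_W_def Let_def set_act_e .
  show "W \<subseteq> E" using * by (rule conjunct1)
  show "set_act (carrier G) W = E" using *[THEN conjunct2, THEN conjunct1] by (rule sym)
  show "E \<noteq> set_act (carrier G) W'" if "W' \<subset> W"
  proof
    assume "E = set_act (carrier G) W'"
    with that have "\<exists>W'. W' \<subset> W \<and> E = set_act (carrier G) W'" by (intro exI conjI)
    then show False using *[THEN conjunct2, THEN conjunct2] by (rule notE[rotated])
  qed
qed

text \<open>Minimality leaves one representative per orbit: if two elements of \<open>W\<close>
  shared an orbit, w' could be removed. The action is free by \<open>E_map_eqD\<close>.\<close>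

lemma W_unique:
  assumes g: "g \<in> carrier G" "g' \<in> carrier G" and w: "w \<in> W" "w' \<in> W" and eq: "map g w = map g' w'"
  shows "g = g'" "w = w'"
proof -
  show ww: "w = w'"
  proof (rule ccontr)
    assume "w \<noteq> w'"
    define h where "h = inv\<^bsub>G\<^esub> g' \<circ> g"
    have h: "h \<in> carrier G" unfolding h_def using G.m_closed[OF G.inv_closed[OF g(2)] g(1)] by (simp only: mult_G)
    have "w' = map (inv\<^bsub>G\<^esub> g') (map g' w')" using map_inv_E[OF g(2)] w W_subset_E by auto
    then have w': "w' = map h w" by (simp add: eq[symmetric] h_def)
    have "E \<subseteq> set_act (carrier G) (W - {w'})"
    proof
      fix x assume "x \<in> E"
      then obtain a v where av: "a \<in> carrier G" "v \<in> W" "x = map a v"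
        unfolding GW[symmetric] set_act_def by blast
      show "x \<in> set_act (carrier G) (W - {w'})"
      proof (cases "v = w'")
        case True
        then have "x = map (a \<circ> h) w" using av w' by simp
        moreover have "a \<circ> h \<in> carrier G" using G.m_closed[OF av(1) h] by (simp only: mult_G)
        ultimately show ?thesis using w \<open>w \<noteq> w'\<close> unfolding set_act_def by blast
      qed (use av in \<open>auto simp: set_act_def\<close>)
    qed
    moreover have "set_act (carrier G) (W - {w'}) \<subseteq> E"
      using carrier_map_E W_subset_E by (auto simp: set_act_def)
    ultimately show False using W_minimal[of "W - {w'}"] w by blast
  qed
  have "g \<circ> e = g' \<circ> e" using E_map_eqD[of w g g'] eq w W_subset_E unfolding ww by blast
  then show "g = g'" using g unfolding carrier_G by metis
qed

lemma LGW_mem: "l \<in> L \<Longrightarrow> g \<in> carrier G \<Longrightarrow> w \<in> W \<Longrightarrow> map (l \<circ> g) w \<in> W_mu \<mu>"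
proof -
  assume *: "l \<in> L" "g \<in> carrier G" "w \<in> W"
  have "l \<circ> g \<in> K" using K_comp[OF L_K[OF *(1)]] *(2) unfolding carrier_G by blast
  then show ?thesis using W_mu_map K_subset_S W_subset_E E_subset_W_mu * by blast
qed

lemma map_e_LGW: "l \<in> L \<Longrightarrow> g \<in> carrier G \<Longrightarrow> map e (map (l \<circ> g) w) = map g w"
proof -
  assume "l \<in> L" "g \<in> carrier G"
  then have "e \<circ> (l \<circ> g) = g" unfolding L_iff carrier_G by (metis comp_assoc)
  then show ?thesis unfolding map_comp_eq by (simp only:)
qed

lemma LGW_unique:
  assumes "l \<in> L" "l' \<in> L" "g \<in> carrier G" "g' \<in> carrier G" "w \<in> W" "w' \<in> W"
    and eq: "map (l \<circ> g) w = map (l' \<circ> g') w'"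
  shows "l = l'" "g = g'" "w = w'"
proof -
  have eq': "map g w = map g' w'"
    using map_e_LGW[of l g w] map_e_LGW[of l' g' w'] assms by metis
  show g: "g = g'" and w: "w = w'" using W_unique[OF assms(3-6) eq'] by blast+
  have "(l \<circ> g) \<circ> e = (l' \<circ> g) \<circ> e"
    using eq assms(5) W_subset_E unfolding g w by (intro E_map_eqD[of w']) auto
  then have lg: "l \<circ> g = l' \<circ> g" using assms(3) unfolding carrier_G by (metis comp_assoc)
  have "g \<circ> inv\<^bsub>G\<^esub> g = e" using G.r_inv[OF assms(3)] by simp
  then have "l \<circ> e = l' \<circ> e" using lg by (metis comp_assoc)
  then show "l = l'" using assms(1,2) unfolding L_iff by metis
qed

lemma LGW_inj: "inj_on (\<lambda>(f, g, w). map (f \<circ> g) w) (L \<times> carrier G \<times> W)"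
proof (rule inj_onI)
  fix x y assume xy: "x \<in> L \<times> carrier G \<times> W" "y \<in> L \<times> carrier G \<times> W"
    "(\<lambda>(f, g, w). map (f \<circ> g) w) x = (\<lambda>(f, g, w). map (f \<circ> g) w) y"
  obtain l g w l' g' w' where "x = (l, g, w)" "y = (l', g', w')" by (metis prod.collapse)
  then show "x = y" using LGW_unique[of l l' g g' w w'] xy by (simp del: map_map)
qed

text \<open>The entries of x form the range of some z in \<open>K\<close>. The L-factor of z has the
  same range, by equality of ranks, and fixes it pointwise, so x is this factor applied to e x, an
  element of G W.\<close>

lemma LGW_surj:
  assumes x: "x \<in> W_mu \<mu>"
  obtains l g w where "l \<in> L" "g \<in> carrier G" "w \<in> W" "x = map (l \<circ> g) w"
proof -
  obtain z where z: "z \<in> K" "set x = range z" using x by (auto simp: W_mu_iff)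
  obtain l g' r where lgr: "l \<in> L" "g' \<in> carrier G" "r \<in> R" "z = l \<circ> g' \<circ> r"
    using LGR_surj[OF z(1)] .
  have "range z \<subseteq> range l" using lgr(4) by auto
  moreover have "card (range z) = card (range l)" using rank_K z(1) L_K[OF lgr(1)] by metis
  ultimately have range_l: "range z = range l" by (intro card_subset_eq) auto
  have le: "l \<circ> e = l" "e \<circ> l = e" using lgr(1) unfolding L_iff by blast+
  then have ll: "l \<circ> l = l" by (metis comp_assoc)
  have "l y = y" if "y \<in> set x" for y
    using that ll unfolding z(2) range_l by (metis comp_apply imageE)
  then have lx: "map l x = x" by (simp add: map_idI)
  have "map e x \<in> E" by (rule map_E[OF x e_K e_idem])
  then obtain g w where gw: "g \<in> carrier G" "w \<in> W" "map e x = map g w"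
    unfolding GW[symmetric] set_act_def by blast
  have "x = map (l \<circ> e) x" using lx le by metis
  also have "\<dots> = map l (map e x)" by simp
  also have "\<dots> = map (l \<circ> g) w" by (simp only: gw map_comp_eq)
  finally show thesis using that[OF lgr(1) gw(1,2)] by simp
qed

abbreviation xL where "xL \<equiv> L_comp \<mu> e W"
abbreviation xG where "xG \<equiv> G_comp \<mu> e W"
abbreviation xW where "xW \<equiv> W_comp \<mu> e W"

lemma LGW_comps:
  assumes "l \<in> L" "g \<in> carrier G" "w \<in> W"
  shows "xL (map (l \<circ> g) w) = l" "xG (map (l \<circ> g) w) = g" "xW (map (l \<circ> g) w) = w"
proof -
  have "LGW_inv \<mu> e W (map (l \<circ> g) w) = (l, g, w)"
    unfolding LGW_inv_def using the_inv_into_f_f[OF LGW_inj, of "(l, g, w)"] assms by (simp del: map_map)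
  then show "xL (map (l \<circ> g) w) = l" "xG (map (l \<circ> g) w) = g" "xW (map (l \<circ> g) w) = w"
    unfolding L_comp_def G_comp_def W_comp_def by simp_all
qed

lemma comps_mem:
  assumes "x \<in> W_mu \<mu>"
  shows "xL x \<in> L" "xG x \<in> carrier G" "xW x \<in> W" "map (xL x \<circ> xG x) (xW x) = x"
proof -
  obtain l g w where "l \<in> L" "g \<in> carrier G" "w \<in> W" "x = map (l \<circ> g) w"
    using LGW_surj[OF assms] .
  then show "xL x \<in> L" "xG x \<in> carrier G" "xW x \<in> W" "map (xL x \<circ> xG x) (xW x) = x"
    using LGW_comps by (simp_all del: map_map)
qed

lemma W_mu_eq_LGW: "W_mu \<mu> = set_act L (set_act (carrier G) W)"
proof (intro equalityI subsetI)
  fix x assume "x \<in> W_mu \<mu>"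
  then obtain l g w where "l \<in> L" "g \<in> carrier G" "w \<in> W" "x = map l (map g w)"
    using LGW_surj by (metis map_map)
  then show "x \<in> set_act L (set_act (carrier G) W)" unfolding set_act_def by blast
next
  fix x assume "x \<in> set_act L (set_act (carrier G) W)"
  then show "x \<in> W_mu \<mu>" using LGW_mem unfolding set_act_def by auto
qed

text \<open>Applying \<open>e\<close> to both decompositions of \<open>map f x\<close> removes the
  L-components, and \<open>W_unique\<close> compares the rest. The left factor that moves the
  \<open>G\<close>-component depends only on f and on the L-component of x.\<close>

lemma comps_map:
  assumes f: "f \<in> S" and x: "x \<in> W_mu \<mu>"
  shows "e \<circ> f \<circ> xL x \<in> carrier G" "xG (map f x) = (e \<circ> f \<circ> xL x) \<circ> xG x" "xW (map f x) = xW x"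
proof -
  have l: "xL x \<in> K" "xL x \<circ> e = xL x" using comps_mem(1)[OF x] L_K L_iff by blast+
  then have "e \<circ> (f \<circ> xL x) \<circ> e \<in> carrier G" using S_K(1)[OF f] by (intro carrier_G_I)
  then show q: "e \<circ> f \<circ> xL x \<in> carrier G" using l by (simp only: comp_assoc)
  have fx: "map f x \<in> W_mu \<mu>" by (rule W_mu_map[OF x f])
  have "map (xG (map f x)) (xW (map f x)) = map e (map (xL (map f x) \<circ> xG (map f x)) (xW (map f x)))"
    using map_e_LGW comps_mem[OF fx] by metis
  also have "\<dots> = map e (map f x)" using comps_mem(4)[OF fx] by (simp only:)
  also have "\<dots> = map e (map f (map (xL x \<circ> xG x) (xW x)))" using comps_mem(4)[OF x] by (simp only:)
  also have "\<dots> = map ((e \<circ> f \<circ> xL x) \<circ> xG x) (xW x)" by (simp add: comp_assoc)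
  finally have eq: "map (xG (map f x)) (xW (map f x)) = map ((e \<circ> f \<circ> xL x) \<circ> xG x) (xW x)" .
  have "(e \<circ> f \<circ> xL x) \<circ> xG x \<in> carrier G"
    using G.m_closed[OF q comps_mem(2)[OF x]] by (simp only: mult_G)
  then show "xG (map f x) = (e \<circ> f \<circ> xL x) \<circ> xG x" "xW (map f x) = xW x"
    using W_unique[OF comps_mem(2)[OF fx] _ comps_mem(3)[OF fx] comps_mem(3)[OF x] eq] by blast+
qed

text \<open>The factors of z other than its L-factor merge into the group element. Hence the
  L-component of an image under \<open>K\<close> is determined by the map alone, which later makes
  it a function of the noise.\<close>

lemma xL_map_K:
  assumes z: "z \<in> K" and x: "x \<in> W_mu \<mu>"
  shows "xL (map z x) = fst (LGR_inv \<mu> e z)"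
proof -
  obtain l g r where lgr: "l \<in> L" "g \<in> carrier G" "r \<in> R" "z = l \<circ> g \<circ> r"
    using LGR_surj[OF z] .
  define q where "q = e \<circ> r \<circ> xL x"
  have q: "q \<in> carrier G" using comps_map(1)[OF _ x, of r] R_K[OF lgr(3)] K_subset_S by (auto simp: q_def)
  have q': "q = r \<circ> xL x" using lgr(3) unfolding R_iff q_def by (simp only:)
  have "map z x = map z (map (xL x \<circ> xG x) (xW x))" using comps_mem(4)[OF x] by (simp only:)
  also have "\<dots> = map (l \<circ> (g \<circ> q \<circ> xG x)) (xW x)" unfolding lgr(4) q' by (simp add: comp_assoc)
  finally have "xL (map z x) = l"
    using LGW_comps(1)[OF lgr(1) _ comps_mem(3)[OF x]]
      G.m_closed[OF G.m_closed[OF lgr(2) q] comps_mem(2)[OF x]] by (simp only: mult_G)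
  then show ?thesis using LGR_inv_eq lgr by simp
qed

lemma finite_W: "finite W"
  by (rule finite_subset[OF W_subset_E finite_subset[OF E_subset_W_mu finite_W_mu]])

lemma W_nonempty: "W \<noteq> {}"
proof -
  obtain xs where "set xs = range e" "distinct xs" using finite_distinct_list[of "range e"] by auto
  moreover from this have "length xs = m" unfolding m_eq using distinct_card[of xs] by simp
  ultimately have "xs \<in> E" by (simp add: E_def)
  then show ?thesis using GW by (auto simp: set_act_def)
qed

end

section \<open>Cosets and phases\<close>

locale phased = clique_basis \<mu> e W for \<mu> :: "('v :: finite \<Rightarrow> 'v) pmf" and e W +
  fixes \<gamma> :: "'v \<Rightarrow> 'v"
  assumes admissible: "admissible_gamma \<mu> e \<gamma>"
begin

abbreviation C where "C \<equiv> C_of \<mu> e \<gamma>"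
abbreviation Cp where "Cp \<equiv> C_part \<mu> e \<gamma>"

lemma gamma_G: "\<gamma> \<in> carrier G" and gamma_p: "\<gamma> [^]\<^bsub>G\<^esub> p \<in> H"
  and gamma_bij: "bij_betw (\<lambda>r. (\<gamma> [^]\<^bsub>G\<^esub> r) <#\<^bsub>G\<^esub> H) {..<p} (lcosets\<^bsub>G\<^esub> H)"
  and gamma_law: "r < p \<Longrightarrow> conv_pow \<mu> r \<star> \<eta> =
        etaL_of \<mu> e \<star> return_pmf (\<gamma> [^]\<^bsub>G\<^esub> r) \<star> pmf_of_set H \<star> etaR_of \<mu> e"
  using admissible unfolding admissible_gamma_def Let_def by blast+

lemma l_coset_iff: "x \<in> g <#\<^bsub>G\<^esub> H \<longleftrightarrow> (\<exists>h\<in>H. x = g \<circ> h)"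
  by (auto simp: l_coset_def)

lemma G_comp: "x \<in> carrier G \<Longrightarrow> y \<in> carrier G \<Longrightarrow> x \<circ> y \<in> carrier G"
  using G.m_closed[of x y] by simp

lemma G_inv_comp:
  assumes "x \<in> carrier G"
  shows "inv\<^bsub>G\<^esub> x \<circ> x = e" "x \<circ> inv\<^bsub>G\<^esub> x = e"
  using G.l_inv[OF assms] G.r_inv[OF assms] by simp_all

lemma G_unit:
  assumes "x \<in> carrier G"
  shows "e \<circ> x = x" "x \<circ> e = x"
  using assms unfolding carrier_G by simp_all

lemma H_G: "h \<in> H \<Longrightarrow> h \<in> carrier G"
  using H_subset by blast

lemma H_comp: "x \<in> H \<Longrightarrow> y \<in> H \<Longrightarrow> x \<circ> y \<in> H"
  using H.m_closed[of x y] by simp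

lemma H_inv: "x \<in> H \<Longrightarrow> inv\<^bsub>G\<^esub> x \<in> H"
  by (rule H.m_inv_closed)

lemma e_H: "e \<in> H"
  using H.one_closed by simp

lemma set_H: "set_pmf (pmf_of_set H) = H"
  by (rule set_pmf_of_set) (use e_H in auto)

lemma C_subset: "C \<subseteq> carrier G"
  using G.nat_pow_closed[OF gamma_G] by (auto simp: C_of_def)

lemma C_iff: "c \<in> C \<longleftrightarrow> (\<exists>r<p. c = \<gamma> [^]\<^bsub>G\<^esub> r)"
  by (auto simp: C_of_def)

lemma coset_mem_eq: "x \<in> carrier G \<Longrightarrow> h \<in> H \<Longrightarrow> (x \<circ> h) <#\<^bsub>G\<^esub> H = x <#\<^bsub>G\<^esub> H"
proof -
  assume x: "x \<in> carrier G" and h: "h \<in> H"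
  show ?thesis
  proof (intro equalityI subsetI)
    fix y assume "y \<in> (x \<circ> h) <#\<^bsub>G\<^esub> H"
    then obtain k where "k \<in> H" "y = x \<circ> (h \<circ> k)" unfolding l_coset_iff by (metis comp_assoc)
    then show "y \<in> x <#\<^bsub>G\<^esub> H" unfolding l_coset_iff using H_comp h by blast
  next
    fix y assume "y \<in> x <#\<^bsub>G\<^esub> H"
    then obtain k where k: "k \<in> H" "y = x \<circ> k" unfolding l_coset_iff by blast
    have "y = (x \<circ> h) \<circ> (inv\<^bsub>G\<^esub> h \<circ> k)"
      using G_inv_comp[OF H_G[OF h]] G_unit[OF H_G[OF k(1)]] k(2) by (metis comp_assoc)
    then show "y \<in> (x \<circ> h) <#\<^bsub>G\<^esub> H" unfolding l_coset_iff using H_comp H_inv h k by blast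
  qed
qed

lemma coset_ex1:
  assumes g: "g \<in> carrier G"
  shows "\<exists>!c. c \<in> C \<and> (\<exists>h\<in>H. g = c \<circ> h)"
proof -
  have "g <#\<^bsub>G\<^esub> H \<in> lcosets\<^bsub>G\<^esub> H" using g by (auto simp: LCOSETS_def)
  then obtain r where r: "r < p" "g <#\<^bsub>G\<^esub> H = (\<gamma> [^]\<^bsub>G\<^esub> r) <#\<^bsub>G\<^esub> H"
    using gamma_bij unfolding bij_betw_def by blast
  have "g \<in> g <#\<^bsub>G\<^esub> H" unfolding l_coset_iff using e_H G_unit[OF g] by metis
  then obtain h where h: "h \<in> H" "g = \<gamma> [^]\<^bsub>G\<^esub> r \<circ> h" unfolding r(2) l_coset_iff by blast
  show ?thesis
  proof (rule ex1I[of _ "\<gamma> [^]\<^bsub>G\<^esub> r"])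
    show "\<gamma> [^]\<^bsub>G\<^esub> r \<in> C \<and> (\<exists>h\<in>H. g = \<gamma> [^]\<^bsub>G\<^esub> r \<circ> h)" using h r C_iff by blast
  next
    fix c assume "c \<in> C \<and> (\<exists>h\<in>H. g = c \<circ> h)"
    then obtain s k where s: "s < p" "c = \<gamma> [^]\<^bsub>G\<^esub> s" "k \<in> H" "g = c \<circ> k" unfolding C_iff by blast
    have "g <#\<^bsub>G\<^esub> H = (\<gamma> [^]\<^bsub>G\<^esub> s) <#\<^bsub>G\<^esub> H"
      unfolding s(4) s(2) by (rule coset_mem_eq[OF G.nat_pow_closed[OF gamma_G] s(3)])
    then have "s = r" using gamma_bij r s(1) unfolding bij_betw_def inj_on_def by auto
    then show "c = \<gamma> [^]\<^bsub>G\<^esub> r" using s by simp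
  qed
qed

lemma Cp_mem:
  assumes g: "g \<in> carrier G"
  shows "Cp g \<in> C" "\<exists>h\<in>H. g = Cp g \<circ> h"
  using theI'[OF coset_ex1[OF g]] unfolding C_part_def by blast+

lemma Cp_G: "g \<in> carrier G \<Longrightarrow> Cp g \<in> carrier G"
  using Cp_mem(1) C_subset by blast

lemma Cp_eqI: "c \<in> C \<Longrightarrow> h \<in> H \<Longrightarrow> Cp (c \<circ> h) = c"
  unfolding C_part_def
  by (rule the1_equality[OF coset_ex1]) (use C_subset H_G G_comp in blast)+

lemma Cp_comp_H: "g \<in> carrier G \<Longrightarrow> h \<in> H \<Longrightarrow> Cp (g \<circ> h) = Cp g"
proof -
  assume g: "g \<in> carrier G" and h: "h \<in> H"
  obtain k where k: "k \<in> H" "g = Cp g \<circ> k" using Cp_mem[OF g] by blast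
  have "g \<circ> h = Cp g \<circ> (k \<circ> h)" using k(2) by (metis comp_assoc)
  then show ?thesis using Cp_eqI[OF Cp_mem(1)[OF g] H_comp[OF k(1) h]] by simp
qed

lemma Cp_inv_H: "g \<in> carrier G \<Longrightarrow> inv\<^bsub>G\<^esub> (Cp g) \<circ> g \<in> H"
proof -
  assume g: "g \<in> carrier G"
  obtain k where k: "k \<in> H" "g = Cp g \<circ> k" using Cp_mem[OF g] by blast
  have "inv\<^bsub>G\<^esub> (Cp g) \<circ> g = k"
    using k(2) G_inv_comp[OF Cp_G[OF g]] G_unit[OF H_G[OF k(1)]] by (metis comp_assoc)
  with k show ?thesis by simp
qed

lemma H_conj: "g \<in> carrier G \<Longrightarrow> h \<in> H \<Longrightarrow> inv\<^bsub>G\<^esub> g \<circ> h \<circ> g \<in> H"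
  using H.inv_op_closed1[of g h] by simp

lemma H_conj': "g \<in> carrier G \<Longrightarrow> h \<in> H \<Longrightarrow> g \<circ> h \<circ> inv\<^bsub>G\<^esub> g \<in> H"
  using H.inv_op_closed2[of g h] by simp

lemma Cp_H_comp: "g \<in> carrier G \<Longrightarrow> h \<in> H \<Longrightarrow> Cp (h \<circ> g) = Cp g"
proof -
  assume g: "g \<in> carrier G" and h: "h \<in> H"
  have "h \<circ> g = g \<circ> (inv\<^bsub>G\<^esub> g \<circ> h \<circ> g)"
    using G_inv_comp[OF g] G_unit[OF H_G[OF h]] by (metis comp_assoc)
  then show ?thesis using Cp_comp_H[OF g H_conj[OF g h]] by simp
qed

lemma Cp_eq_iff:
  assumes g: "g \<in> carrier G" "g' \<in> carrier G"
  shows "Cp g = Cp g' \<longleftrightarrow> g \<circ> inv\<^bsub>G\<^esub> g' \<in> H"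
proof
  assume "g \<circ> inv\<^bsub>G\<^esub> g' \<in> H"
  then have "Cp (g \<circ> inv\<^bsub>G\<^esub> g' \<circ> g') = Cp g'" by (rule Cp_H_comp[OF g(2)])
  moreover have "g \<circ> inv\<^bsub>G\<^esub> g' \<circ> g' = g"
    using G_inv_comp[OF g(2)] G_unit[OF g(1)] by (metis comp_assoc)
  ultimately show "Cp g = Cp g'" by simp
next
  assume eq: "Cp g = Cp g'"
  define c where "c = Cp g"
  obtain h where h1: "h \<in> H" "g = c \<circ> h" using Cp_mem(2)[OF g(1)] unfolding c_def by (rule bexE)
  obtain h' where h2: "h' \<in> H" "g' = c \<circ> h'" using Cp_mem(2)[OF g(2)] unfolding c_def eq by (rule bexE)
  note h = h1 h2
  have c: "c \<in> carrier G" using Cp_G[OF g(1)] by (simp add: c_def)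
  have "inv\<^bsub>G\<^esub> g' = inv\<^bsub>G\<^esub> h' \<circ> inv\<^bsub>G\<^esub> c"
    using G.inv_mult_group[OF c H_G[OF h(3)]] h(4) by simp
  then have "g \<circ> inv\<^bsub>G\<^esub> g' = c \<circ> (h \<circ> inv\<^bsub>G\<^esub> h') \<circ> inv\<^bsub>G\<^esub> c"
    using h(2) by (simp add: comp_assoc)
  then show "g \<circ> inv\<^bsub>G\<^esub> g' \<in> H" using H_conj'[OF c H_comp[OF h(1) H_inv[OF h(3)]]] by simp
qed

text \<open>\<open>n \<circ> l\<close> lies in the support of \<open>\<mu> \<star> \<eta>\<close>,
  and the given factorisation of this law puts its group factor into \<gamma>H. Hence the coset of
  the \<open>G\<close>-component moves deterministically although the noise is random.\<close>

lemma step_coset: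
  assumes n: "n \<in> set_pmf \<mu>" and l: "l \<in> L"
  shows "\<exists>h\<in>H. e \<circ> n \<circ> l = \<gamma> \<circ> h"
proof (cases "p = 1")
  \<comment> \<open>For p = 1 the hypothesis on \<gamma> provides the law for r = 0 only; but then
    \<open>C\<close> consists of \<open>e\<close> alone, so all of the group is
    \<open>H\<close>.\<close>
  case True
  have le: "l \<circ> e = l" and lK: "l \<in> K" using l L_K L_iff by blast+
  have "n \<in> S" using n by (force simp: S_of_def intro!: bexI[of _ 1])
  then have "e \<circ> (n \<circ> l) \<circ> e \<in> carrier G" using S_K(1) lK by (intro carrier_G_I)
  then have q: "e \<circ> n \<circ> l \<in> carrier G" using le by (simp only: comp_assoc)
  have C: "C = {e}" using True by (auto simp: C_of_def)
  have all: "g \<in> H" if "g \<in> carrier G" for g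
    using Cp_mem[OF that] G_unit H_G unfolding C by force
  have "e \<circ> n \<circ> l = \<gamma> \<circ> (inv\<^bsub>G\<^esub> \<gamma> \<circ> (e \<circ> n \<circ> l))"
    using G_inv_comp[OF gamma_G] G_unit[OF q] by (metis comp_assoc)
  then show ?thesis using all[OF G_comp[OF G.inv_closed[OF gamma_G] q]] by blast
next
  case False
  then have "1 < p" using p_pos by simp
  have "l \<in> set_pmf \<eta>" and le: "l \<circ> e = l" using l unfolding L_iff by blast+
  then have "n \<circ> l \<in> set_pmf (conv_pow \<mu> 1 \<star> \<eta>)"
    using n by (simp add: set_pmf_conv set_compI)
  then obtain a g h r where "a \<in> set_pmf (etaL_of \<mu> e)" "g = \<gamma> [^]\<^bsub>G\<^esub> (1::nat)" "h \<in> H"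
      "r \<in> set_pmf (etaR_of \<mu> e)" "n \<circ> l = a \<circ> g \<circ> h \<circ> r"
    unfolding gamma_law[OF \<open>1 < p\<close>] set_pmf_conv set_H set_return_pmf
    by (elim set_compE) (simp only: singleton_iff)
  then have ahr: "a \<in> L" "h \<in> H" "r \<in> R" "n \<circ> l = a \<circ> \<gamma> [^]\<^bsub>G\<^esub> (1::nat) \<circ> h \<circ> r"
    using set_etaL set_etaR by auto
  have "e \<circ> n \<circ> l = e \<circ> (n \<circ> l) \<circ> e" using le by (simp only: comp_assoc)
  also have "\<dots> = (e \<circ> a) \<circ> \<gamma> \<circ> (h \<circ> (r \<circ> e))"
    unfolding ahr(4) using G_unit[OF gamma_G] by (simp add: comp_assoc)
  also have "\<dots> = \<gamma> \<circ> h"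
    using ahr(1,3) G_unit[OF gamma_G] G_unit[OF H_G[OF ahr(2)]] unfolding L_iff R_iff by simp
  finally show ?thesis using ahr(2) by blast
qed

text \<open>The phase of \<open>g\<close> at time \<open>k\<close>: its coset with the deterministic
  rotation by the \<open>k\<close>-th power of \<gamma> undone, represented in \<open>C\<close>. By
  \<open>ph_step\<close> it is preserved in time.\<close>

definition ph :: "int \<Rightarrow> ('v \<Rightarrow> 'v) \<Rightarrow> ('v \<Rightarrow> 'v)"
  where "ph k g = Cp (inv\<^bsub>G\<^esub> (\<gamma> [^]\<^bsub>G\<^esub> k) \<circ> g)"

lemma gamma_pow_G [simp]: "\<gamma> [^]\<^bsub>G\<^esub> (k :: int) \<in> carrier G"
  by (rule G.int_pow_closed[OF gamma_G])

lemma ph_C: "g \<in> carrier G \<Longrightarrow> ph k g \<in> C"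
  unfolding ph_def by (intro Cp_mem(1) G_comp G.inv_closed gamma_pow_G)

text \<open>The new factor \<gamma> cancels against the advance of the clock, and normality moves h
  to the front of the remaining product without leaving \<open>H\<close>.\<close>

lemma ph_step:
  assumes g: "g \<in> carrier G" and h: "h \<in> H"
  shows "ph (k + 1) (\<gamma> \<circ> h \<circ> g) = ph k g"
proof -
  let ?c = "\<gamma> [^]\<^bsub>G\<^esub> k"
  have "\<gamma> [^]\<^bsub>G\<^esub> (k + 1) = \<gamma> \<circ> ?c"
    using G.int_pow_mult[OF gamma_G, of 1 k] gamma_G by (simp add: add.commute)
  then have "inv\<^bsub>G\<^esub> (\<gamma> [^]\<^bsub>G\<^esub> (k + 1)) = inv\<^bsub>G\<^esub> ?c \<circ> inv\<^bsub>G\<^esub> \<gamma>"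
    using G.inv_mult_group[OF gamma_G gamma_pow_G[of k]] by simp
  then have "inv\<^bsub>G\<^esub> (\<gamma> [^]\<^bsub>G\<^esub> (k + 1)) \<circ> (\<gamma> \<circ> h \<circ> g) = inv\<^bsub>G\<^esub> ?c \<circ> (inv\<^bsub>G\<^esub> \<gamma> \<circ> \<gamma>) \<circ> h \<circ> g"
    by (simp only: comp_assoc)
  also have "\<dots> = inv\<^bsub>G\<^esub> ?c \<circ> h \<circ> g"
    by (simp only: G_inv_comp(1)[OF gamma_G] G_unit(2)[OF G.inv_closed[OF gamma_pow_G]])
  also have "\<dots> = inv\<^bsub>G\<^esub> ?c \<circ> h \<circ> ((?c \<circ> inv\<^bsub>G\<^esub> ?c) \<circ> g)"
    by (simp only: G_inv_comp(2)[OF gamma_pow_G] G_unit(1)[OF g])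
  also have "\<dots> = (inv\<^bsub>G\<^esub> ?c \<circ> h \<circ> ?c) \<circ> (inv\<^bsub>G\<^esub> ?c \<circ> g)"
    by (simp only: comp_assoc)
  finally show ?thesis
    unfolding ph_def using Cp_H_comp[OF G_comp[OF G.inv_closed[OF gamma_pow_G[of k]] g] H_conj[OF gamma_pow_G[of k] h]]
    by (simp only:)
qed

lemma Cp_gamma_ph: "g \<in> carrier G \<Longrightarrow> Cp (\<gamma> [^]\<^bsub>G\<^esub> k \<circ> ph k g) = Cp g"
proof -
  let ?c = "\<gamma> [^]\<^bsub>G\<^esub> k"
  assume g: "g \<in> carrier G"
  have g': "inv\<^bsub>G\<^esub> ?c \<circ> g \<in> carrier G" using g by (intro G_comp G.inv_closed gamma_pow_G)
  obtain h where h: "h \<in> H" "inv\<^bsub>G\<^esub> ?c \<circ> g = ph k g \<circ> h"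
    using Cp_mem(2)[OF g'] unfolding ph_def by blast
  have "?c \<circ> ph k g \<circ> h = ?c \<circ> inv\<^bsub>G\<^esub> ?c \<circ> g" using h(2) by (metis comp_assoc)
  also have "\<dots> = g" using G_inv_comp[OF gamma_pow_G[of k]] G_unit[OF g] by simp
  finally have "?c \<circ> ph k g \<circ> h = g" .
  then show ?thesis
    using Cp_comp_H[OF G_comp[OF gamma_pow_G[of k]] h(1), of "ph k g"] ph_C[OF g] C_subset by force
qed

lemma ph_eq_iff:
  assumes "g \<in> carrier G" "g' \<in> carrier G"
  shows "ph k g = ph k g' \<longleftrightarrow> Cp g = Cp g'"
proof
  assume "ph k g = ph k g'"
  then show "Cp g = Cp g'" using Cp_gamma_ph assms by metis
next
  let ?c = "\<gamma> [^]\<^bsub>G\<^esub> k"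
  assume eq: "Cp g = Cp g'"
  obtain h where h1: "h \<in> H" "g = Cp g \<circ> h" using Cp_mem(2)[OF assms(1)] by (rule bexE)
  obtain h' where h2: "h' \<in> H" "g' = Cp g' \<circ> h'" using Cp_mem(2)[OF assms(2)] by (rule bexE)
  note h = h1 h2
  have "inv\<^bsub>G\<^esub> ?c \<circ> g = inv\<^bsub>G\<^esub> ?c \<circ> Cp g \<circ> h" "inv\<^bsub>G\<^esub> ?c \<circ> g' = inv\<^bsub>G\<^esub> ?c \<circ> Cp g \<circ> h'"
    using h eq by (metis comp_assoc)+
  then show "ph k g = ph k g'"
    unfolding ph_def using Cp_comp_H[OF G_comp[OF G.inv_closed[OF gamma_pow_G[of k]] Cp_G[OF assms(1)]]] h(1,3)
    by simp
qed

lemma ph_0: "g \<in> carrier G \<Longrightarrow> ph 0 g = Cp g"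
proof -
  assume g: "g \<in> carrier G"
  have "inv\<^bsub>G\<^esub> e = e" using G.inv_one by simp
  then show ?thesis using G_unit[OF g] by (simp add: ph_def)
qed

subsection \<open>Random images of a tuple\<close>

lemma card_H_pos: "card H > 0"
  using e_H by (auto simp: card_gt_0_iff)

lemma pmf_act_return_law:
  "pmf (etaL_of \<mu> e \<star> return_pmf a \<star> pmf_of_set H \<triangleright> return_pmf y) x =
    (\<Sum>l\<in>UNIV. pmf (etaL_of \<mu> e) l * (real (card {h \<in> H. map (l \<circ> a \<circ> h) y = x}) / card H))"
proof -
  have "etaL_of \<mu> e \<star> return_pmf a \<star> pmf_of_set H \<triangleright> return_pmf y =
      bind_pmf (etaL_of \<mu> e) (\<lambda>l. map_pmf (\<lambda>h. map (l \<circ> a \<circ> h) y) (pmf_of_set H))"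
    by (simp add: act_eq_bind conv_eq_bind map_pmf_def bind_assoc_pmf bind_return_pmf comp_def)
  then have "pmf (etaL_of \<mu> e \<star> return_pmf a \<star> pmf_of_set H \<triangleright> return_pmf y) x =
      (\<integral>l. pmf (map_pmf (\<lambda>h. map (l \<circ> a \<circ> h) y) (pmf_of_set H)) x \<partial>measure_pmf (etaL_of \<mu> e))"
    by (simp only: pmf_bind)
  also have "\<dots> = (\<Sum>l\<in>UNIV. pmf (etaL_of \<mu> e) l * pmf (map_pmf (\<lambda>h. map (l \<circ> a \<circ> h) y) (pmf_of_set H)) x)"
    by (subst integral_measure_pmf_real[where A=UNIV]) (auto simp: mult.commute)
  also have "\<dots> = (\<Sum>l\<in>UNIV. pmf (etaL_of \<mu> e) l * (real (card {h \<in> H. map (l \<circ> a \<circ> h) y = x}) / card H))"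
  proof (intro sum.cong refl arg_cong2[where f="(*)"])
    fix l
    have "pmf (map_pmf (\<lambda>h. map (l \<circ> a \<circ> h) y) (pmf_of_set H)) x =
        measure (measure_pmf (pmf_of_set H)) {h. map (l \<circ> a \<circ> h) y = x}"
      by (simp only: pmf_map vimage_def mem_Collect_eq singleton_iff)
    also have "\<dots> = real (card (H \<inter> {h. map (l \<circ> a \<circ> h) y = x})) / card H"
      by (rule measure_pmf_of_set) (use e_H in auto)
    finally show "pmf (map_pmf (\<lambda>h. map (l \<circ> a \<circ> h) y) (pmf_of_set H)) x =
        real (card {h \<in> H. map (l \<circ> a \<circ> h) y = x}) / card H"
      by (simp only: Int_def mem_Collect_eq)
  qed
  finally show ?thesis .
qed

text \<open>By uniqueness of coordinates at most one pair (l, h) leads to x: l is its L-component,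
  and h is obtained by solving for the group component. So x receives the mass of l divided by the
  order of \<open>H\<close>, provided that this h is in \<open>H\<close>.\<close>

lemma pmf_law_GW:
  assumes a: "a \<in> carrier G" and g: "g \<in> carrier G" and w: "w \<in> W"
  shows "pmf (etaL_of \<mu> e \<star> return_pmf a \<star> pmf_of_set H \<triangleright> return_pmf (map g w)) x =
    (if x \<in> W_mu \<mu> \<and> xW x = w \<and> inv\<^bsub>G\<^esub> a \<circ> xG x \<circ> inv\<^bsub>G\<^esub> g \<in> H
     then pmf (etaL_of \<mu> e) (xL x) / card H else 0)"
proof -
  let ?c = "inv\<^bsub>G\<^esub> a \<circ> xG x \<circ> inv\<^bsub>G\<^esub> g"
  define A where "A l = {h \<in> H. map (l \<circ> a \<circ> h) (map g w) = x}" for l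
  have ahg: "a \<circ> h \<circ> g \<in> carrier G" if "h \<in> H" for h
    using G_comp G_comp[OF a H_G[OF that]] g by blast
  have map_eq: "map (l \<circ> a \<circ> h) (map g w) = map (l \<circ> (a \<circ> h \<circ> g)) w" for l h
    by (simp add: comp_assoc)
  have A: "A l = (if x \<in> W_mu \<mu> \<and> xW x = w \<and> l = xL x \<and> ?c \<in> H then {?c} else {})" if l: "l \<in> L" for l
  proof (cases "x \<in> W_mu \<mu>")
    case False
    have "map (l \<circ> a \<circ> h) (map g w) \<noteq> x" if "h \<in> H" for h
      using LGW_mem[OF l ahg[OF that] w] False unfolding map_eq by metis
    then have "A l = {}" unfolding A_def by blast
    then show ?thesis using False by (simp only: simp_thms if_False)
  next
    case True
    note x = comps_mem[OF True]
    have iff: "map (l \<circ> a \<circ> h) (map g w) = x \<longleftrightarrow> l = xL x \<and> w = xW x \<and> h = ?c" if h: "h \<in> H" for h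
    proof
      assume "map (l \<circ> a \<circ> h) (map g w) = x"
      then have "xL x = l" "xG x = a \<circ> h \<circ> g" "xW x = w"
        using LGW_comps[OF l ahg[OF h] w] unfolding map_eq by simp_all
      moreover have "inv\<^bsub>G\<^esub> a \<circ> (a \<circ> h \<circ> g) \<circ> inv\<^bsub>G\<^esub> g = h"
        using G_inv_comp[OF a] G_inv_comp[OF g] G_unit[OF H_G[OF h]] by (metis comp_assoc)
      ultimately show "l = xL x \<and> w = xW x \<and> h = ?c" by (simp only:)
    next
      assume *: "l = xL x \<and> w = xW x \<and> h = ?c"
      have "a \<circ> ?c \<circ> g = (a \<circ> inv\<^bsub>G\<^esub> a) \<circ> xG x \<circ> (inv\<^bsub>G\<^esub> g \<circ> g)" by (simp only: comp_assoc)
      also have "\<dots> = xG x" using G_inv_comp[OF a] G_inv_comp[OF g] G_unit[OF x(2)] by simp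
      finally show "map (l \<circ> a \<circ> h) (map g w) = x" unfolding map_eq using x(4) * by (simp only:)
    qed
    show ?thesis
    proof (cases "xW x = w \<and> l = xL x \<and> ?c \<in> H")
      case c: True
      have "A l = {?c}" unfolding A_def using iff c by blast
      then show ?thesis using c True by (simp only: simp_thms if_True)
    next
      case c: False
      have "h \<notin> A l" for h
      proof
        assume "h \<in> A l"
        then have h: "h \<in> H" "map (l \<circ> a \<circ> h) (map g w) = x" unfolding A_def by blast+
        then have "l = xL x" "w = xW x" "h = ?c" using iff[OF h(1)] by blast+
        then show False using c h(1) by (simp only: simp_thms)
      qed
      then have "A l = {}" by blast
      then show ?thesis using c True by (simp only: simp_thms if_False) 
    qed
  qed
  have "pmf (etaL_of \<mu> e \<star> return_pmf a \<star> pmf_of_set H \<triangleright> return_pmf (map g w)) x =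
      (\<Sum>l\<in>UNIV. pmf (etaL_of \<mu> e) l * (real (card (A l)) / card H))"
    unfolding pmf_act_return_law A_def ..
  also have "\<dots> = (\<Sum>l\<in>UNIV. if l = xL x then
      (if x \<in> W_mu \<mu> \<and> xW x = w \<and> ?c \<in> H then pmf (etaL_of \<mu> e) (xL x) / card H else 0) else 0)"
  proof (rule sum.cong[OF refl])
    fix l
    show "pmf (etaL_of \<mu> e) l * (real (card (A l)) / card H) = (if l = xL x then
      (if x \<in> W_mu \<mu> \<and> xW x = w \<and> ?c \<in> H then pmf (etaL_of \<mu> e) (xL x) / card H else 0) else 0)"
    proof (cases "l \<in> L")
      case True
      show ?thesis unfolding A[OF True] by (simp del: comp_apply)
    next
      case False
      then have "pmf (etaL_of \<mu> e) l = 0" using set_etaL by (auto simp: pmf_eq_0_set_pmf)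
      moreover have "x \<notin> W_mu \<mu>" if "l = xL x" using False comps_mem(1) that by blast
      ultimately show ?thesis by simp
    qed
  qed
  also have "\<dots> = (if x \<in> W_mu \<mu> \<and> xW x = w \<and> ?c \<in> H then pmf (etaL_of \<mu> e) (xL x) / card H else 0)"
    by (subst sum.delta) (simp_all only: finite UNIV_I if_True)
  finally show ?thesis .
qed

lemma act_eq_bind_right: "\<rho> \<triangleright> \<Lambda> = bind_pmf \<Lambda> (\<lambda>x. \<rho> \<triangleright> return_pmf x)"
  unfolding act_eq_bind map_pmf_def bind_return_pmf by (rule bind_commute_pmf)

lemma pmf_law_W:
  assumes a: "a \<in> carrier G" and \<Lambda>: "set_pmf \<Lambda> \<subseteq> W"
  shows "pmf (etaL_of \<mu> e \<star> return_pmf a \<star> pmf_of_set H \<triangleright> \<Lambda>) x =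
    (if x \<in> W_mu \<mu> \<and> inv\<^bsub>G\<^esub> a \<circ> xG x \<in> H
     then pmf (etaL_of \<mu> e) (xL x) / card H * pmf \<Lambda> (xW x) else 0)"
proof -
  let ?P = "x \<in> W_mu \<mu> \<and> inv\<^bsub>G\<^esub> a \<circ> xG x \<in> H"
  let ?q = "pmf (etaL_of \<mu> e) (xL x) / card H"
  have e_G: "e \<in> carrier G" "inv\<^bsub>G\<^esub> e = e" using G.one_closed G.inv_one by simp_all
  have eq: "pmf (etaL_of \<mu> e \<star> return_pmf a \<star> pmf_of_set H \<triangleright> return_pmf w) x =
      (if ?P then ?q else 0) * indicator {xW x} w" if w: "w \<in> set_pmf \<Lambda>" for w
  proof -
    have w': "w \<in> W" "map e w = w" using w \<Lambda> W_subset_E map_e_E by blast+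
    have "inv\<^bsub>G\<^esub> a \<circ> xG x \<circ> e = inv\<^bsub>G\<^esub> a \<circ> xG x" if "x \<in> W_mu \<mu>"
      using G_unit(2)[OF comps_mem(2)[OF that]] by (simp only: comp_assoc)
    then show ?thesis
      using pmf_law_GW[OF a e_G(1) w'(1), of x] unfolding w' e_G(2) by (auto simp: indicator_def)
  qed
  have "pmf (etaL_of \<mu> e \<star> return_pmf a \<star> pmf_of_set H \<triangleright> \<Lambda>) x =
      (\<integral>w. pmf (etaL_of \<mu> e \<star> return_pmf a \<star> pmf_of_set H \<triangleright> return_pmf w) x \<partial>measure_pmf \<Lambda>)"
    by (subst act_eq_bind_right) (rule pmf_bind)
  also have "\<dots> = (\<integral>w. (if ?P then ?q else 0) * indicator {xW x} w \<partial>measure_pmf \<Lambda>)"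
    by (intro integral_cong_AE) (auto simp: AE_measure_pmf_iff eq)
  also have "\<dots> = (if ?P then ?q else 0) * pmf \<Lambda> (xW x)"
    by (simp add: pmf.rep_eq)
  finally show ?thesis by simp
qed

text \<open>In the factorisation of \<eta> the factor r from \<open>R\<close> acts first. Meeting
  the L-component of y it becomes an element of \<open>H\<close>, which the uniform law on
  \<open>H\<close> absorbs; the integrand therefore does not depend on r.\<close>

lemma pmf_eta_act:
  assumes y: "y \<in> W_mu \<mu>"
  shows "pmf (\<eta> \<triangleright> return_pmf y) x =
    (if x \<in> W_mu \<mu> \<and> xW x = xW y \<and> Cp (xG x) = Cp (xG y) then pmf (etaL_of \<mu> e) (xL x) / card H else 0)"
proof -
  let ?v = "if x \<in> W_mu \<mu> \<and> xW x = xW y \<and> Cp (xG x) = Cp (xG y) then pmf (etaL_of \<mu> e) (xL x) / card H else 0"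
  let ?\<rho> = "etaL_of \<mu> e \<star> return_pmf e \<star> pmf_of_set H"
  note y' = comps_mem[OF y]
  have e_G: "e \<in> carrier G" "inv\<^bsub>G\<^esub> e = e" using G.one_closed G.inv_one by simp_all
  have "\<eta> = ?\<rho> \<star> etaR_of \<mu> e"
    using gamma_law[OF p_pos] by simp
  then have "\<eta> \<triangleright> return_pmf y = ?\<rho> \<triangleright> map_pmf (\<lambda>r. map r y) (etaR_of \<mu> e)"
    by (simp add: conv_act act_eq_bind[of "etaR_of \<mu> e"] map_pmf_def bind_return_pmf)
  also have "\<dots> = bind_pmf (etaR_of \<mu> e) (\<lambda>r. ?\<rho> \<triangleright> return_pmf (map r y))"
    by (subst act_eq_bind_right) (simp add: map_pmf_def bind_assoc_pmf bind_return_pmf)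
  finally have "pmf (\<eta> \<triangleright> return_pmf y) x =
      (\<integral>r. pmf (?\<rho> \<triangleright> return_pmf (map r y)) x \<partial>measure_pmf (etaR_of \<mu> e))"
    by (simp only: pmf_bind)
  also have "\<dots> = (\<integral>r. ?v \<partial>measure_pmf (etaR_of \<mu> e))"
  proof (intro integral_cong_AE)
    have "pmf (?\<rho> \<triangleright> return_pmf (map r y)) x = ?v" if "r \<in> set_pmf (etaR_of \<mu> e)" for r
    proof -
      have r: "r \<in> R" using that set_etaR by blast
      define h where "h = r \<circ> xL y"
      have "r \<circ> xL y \<in> set_pmf \<eta>"
        using Kg_comp[of r 0 "xL y" 0] r y'(1) unfolding R_iff L_iff Kg_0[symmetric] by simp
      moreover have "e \<circ> r = r" "xL y \<circ> e = xL y" using r y'(1) unfolding R_iff L_iff by blast+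
      ultimately have h: "h \<in> H" unfolding H_iff h_def by (metis comp_assoc)
      have hg: "h \<circ> xG y \<in> carrier G" by (rule G_comp[OF H_G[OF h] y'(2)])
      have "map r y = map r (map (xL y \<circ> xG y) (xW y))" using y'(4) by (simp only:)
      also have "\<dots> = map (h \<circ> xG y) (xW y)" by (simp add: h_def comp_assoc)
      finally have ry: "map r y = map (h \<circ> xG y) (xW y)" .
      have "e \<circ> xG x \<circ> inv\<^bsub>G\<^esub> (h \<circ> xG y) \<in> H \<longleftrightarrow> Cp (xG x) = Cp (xG y)" if "x \<in> W_mu \<mu>"
        using Cp_eq_iff[OF comps_mem(2)[OF that] hg] Cp_H_comp[OF y'(2) h] G_unit[OF comps_mem(2)[OF that]]
        by simp
      then show ?thesis unfolding ry pmf_law_GW[OF e_G(1) hg y'(3)] e_G(2) by (simp only: cong: conj_cong)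
    qed
    then show "AE r in measure_pmf (etaR_of \<mu> e). pmf (?\<rho> \<triangleright> return_pmf (map r y)) x = ?v"
      by (simp only: AE_measure_pmf_iff) blast
  qed simp_all
  also have "\<dots> = ?v" by simp
  finally show ?thesis .
qed

end

section \<open>Sub-sigma-fields generated by discrete random variables\<close>

lemma sigma_rv_eq: "sigma_rv M Z = {Z -` A \<inter> space M | A. True}"
  unfolding sigma_rv_def by (subst sets_vimage_algebra2) auto

text \<open>The generated field packaged as a measure, so that measurability with respect to it is
  expressible by \<open>measurable\<close>.\<close>

definition family_measure :: "'a measure \<Rightarrow> 'i set \<Rightarrow> ('i \<Rightarrow> 'a \<Rightarrow> 'b) \<Rightarrow> 'a measure"
  where "family_measure M J Z = sigma (space M) (\<Union>j\<in>J. sigma_rv M (Z j))"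

lemma family_gen_Pow: "(\<Union>j\<in>J. sigma_rv M (Z j)) \<subseteq> Pow (space M)"
  by (auto simp: sigma_rv_eq)

lemma space_family_measure [simp]: "space (family_measure M J Z) = space M"
  by (simp add: family_measure_def space_measure_of_conv)

lemma sets_family_measure [simp]: "sets (family_measure M J Z) = sigma_family M J Z"
  unfolding family_measure_def sigma_family_def by (rule sets_measure_of[OF family_gen_Pow])

lemma sigma_rv_subset_family: "j \<in> J \<Longrightarrow> sigma_rv M (Z j) \<subseteq> sigma_family M J Z"
  by (auto simp: sigma_family_def)

lemma measurable_family [measurable (raw)]:
  "j \<in> J \<Longrightarrow> Z j \<in> measurable (family_measure M J Z) (count_space UNIV)"
proof (rule measurableI)
  fix A assume "j \<in> J"
  then show "Z j -` A \<inter> space (family_measure M J Z) \<in> sets (family_measure M J Z)"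
    using sigma_rv_subset_family[of j J M Z] by (auto simp: sigma_rv_eq)
qed simp

lemma measurable_family_comp:
  assumes "\<And>j. j \<in> J' \<Longrightarrow> Z' j \<in> measurable (family_measure M J Z) (count_space UNIV)"
  shows "sigma_family M J' Z' \<subseteq> sigma_family M J Z"
proof -
  have "(\<Union>j\<in>J'. sigma_rv M (Z' j)) \<subseteq> sets (family_measure M J Z)"
    using measurable_sets[OF assms] by (auto simp: sigma_rv_eq)
  from sets.sigma_sets_subset[OF this] show ?thesis by (simp add: sigma_family_def)
qed

lemma sigma_family_mono: "J \<subseteq> J' \<Longrightarrow> sigma_family M J Z \<subseteq> sigma_family M J' Z"
  by (intro measurable_family_comp measurable_family) auto

lemma sigma_family_events:
  assumes "\<And>j. j \<in> J \<Longrightarrow> Z j \<in> measurable M (count_space UNIV)"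
  shows "sigma_family M J Z \<subseteq> sets M"
proof -
  have "(\<Union>j\<in>J. sigma_rv M (Z j)) \<subseteq> sets M"
    using measurable_sets[OF assms] by (auto simp: sigma_rv_eq)
  from sets.sigma_sets_subset[OF this] show ?thesis by (simp add: sigma_family_def)
qed

lemma measurable_discrete2:
  fixes F :: "'b :: countable \<Rightarrow> 'c :: countable \<Rightarrow> 'd"
  assumes "Y \<in> measurable M (count_space UNIV)" "Z \<in> measurable M (count_space UNIV)"
  shows "(\<lambda>\<omega>. F (Y \<omega>) (Z \<omega>)) \<in> measurable M (count_space UNIV)"
proof -
  have "(\<lambda>\<omega>. (Y \<omega>, Z \<omega>)) \<in> measurable M (count_space UNIV \<Otimes>\<^sub>M count_space UNIV)"
    using assms by (rule measurable_Pair)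
  then have "(\<lambda>\<omega>. (Y \<omega>, Z \<omega>)) \<in> measurable M (count_space UNIV)"
    by (subst (asm) pair_measure_countable) auto
  from measurable_compose[OF this, of "\<lambda>(y, z). F y z" "count_space UNIV"] show ?thesis by simp
qed

lemma measurable_discrete1: "Y \<in> measurable M (count_space UNIV) \<Longrightarrow> (\<lambda>\<omega>. F (Y \<omega>)) \<in> measurable M (count_space UNIV)"
  by (erule measurable_compose) simp

text \<open>Entire paths over an infinite index set need not take countably many values, so
  coordinatewise measurability would not reach all preimages. Restricted to a finite
  \<open>I\<close>, the path has countably many values and each preimage is a countable union of
  cylinders.\<close>

lemma measurable_window:
  fixes Z :: "'i \<Rightarrow> 'a \<Rightarrow> 'b :: countable"
  assumes I: "finite I" and Z: "\<And>i. i \<in> I \<Longrightarrow> Z i \<in> measurable M (count_space UNIV)"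
  shows "(\<lambda>\<omega>. restrict (\<lambda>i. Z i \<omega>) I) \<in> measurable M (count_space UNIV)"
proof (rule measurableI)
  fix A :: "('i \<Rightarrow> 'b) set"
  let ?f = "\<lambda>\<omega>. restrict (\<lambda>i. Z i \<omega>) I"
  have point: "?f -` {\<phi>} \<inter> space M \<in> sets M" if \<phi>: "\<phi> \<in> PiE I (\<lambda>_. UNIV)" for \<phi>
  proof -
    have "?f -` {\<phi>} \<inter> space M = {\<omega> \<in> space M. \<forall>i\<in>I. Z i \<omega> \<in> {\<phi> i}}"
    proof (rule Set.set_eqI, rule iffI)
      fix \<omega> assume *: "\<omega> \<in> {\<omega> \<in> space M. \<forall>i\<in>I. Z i \<omega> \<in> {\<phi> i}}"
      then have "?f \<omega> = \<phi>" using \<phi> by (intro extensionalityI[of _ I]) (auto simp: PiE_def)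
      with * show "\<omega> \<in> ?f -` {\<phi>} \<inter> space M" by simp
    qed auto
    also have "\<dots> \<in> sets M"
      using I Z by (intro sets.sets_Collect_finite_All) (auto intro!: measurable_sets_Collect)
    finally show ?thesis .
  qed
  have "countable (A \<inter> PiE I (\<lambda>_. UNIV :: 'b set))" using I by (intro countable_Int2 countable_PiE) auto
  then have "(\<Union>\<phi>\<in>A \<inter> PiE I (\<lambda>_. UNIV). ?f -` {\<phi>} \<inter> space M) \<in> sets M"
    using point by (intro sets.countable_UN') auto
  also have "(\<Union>\<phi>\<in>A \<inter> PiE I (\<lambda>_. UNIV). ?f -` {\<phi>} \<inter> space M) = ?f -` A \<inter> space M" by auto
  finally show "?f -` A \<inter> space M \<in> sets M" .
qed simp

lemma (in prob_space) prob_partition: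
  assumes T: "finite T" "AE \<omega> in M. Z \<omega> \<in> T"
    and Z: "Z \<in> measurable M (count_space UNIV)" and A: "A \<in> events"
  shows "prob A = (\<Sum>z\<in>T. prob (A \<inter> {\<omega> \<in> space M. Z \<omega> = z}))"
proof -
  have ev: "{\<omega> \<in> space M. Z \<omega> = z} \<in> events" for z
    using measurable_sets[OF Z, of "{z}"] by (simp add: vimage_def Int_def conj_commute)
  have "prob A = prob (\<Union>z\<in>T. A \<inter> {\<omega> \<in> space M. Z \<omega> = z})"
    using T A ev sets.sets_into_space[OF A] by (intro finite_measure_eq_AE) (auto intro!: sets.finite_UN)
  also have "\<dots> = (\<Sum>z\<in>T. prob (A \<inter> {\<omega> \<in> space M. Z \<omega> = z}))"
    using T A ev by (intro finite_measure_finite_Union) (auto simp: disjoint_family_on_def)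
  finally show ?thesis .
qed

section \<open>Sigma-fields up to null events\<close>

lemma sigma_join_null_mono: "A \<subseteq> sigma_join M A B" "B \<subseteq> sigma_join M A B"
  by (auto simp: sigma_join_def)

lemma join_null_Pow:
  assumes "B \<subseteq> sets M"
  shows "B \<union> null_sets M \<subseteq> Pow (space M)"
proof -
  have "null_sets M \<subseteq> sets M" by (auto dest: null_setsD2)
  with assms show ?thesis using sets.space_closed[of M] by blast
qed

text \<open>The two differences of a and b are null sets and belong to the join, and a is assembled
  from b and these.\<close>

lemma AE_eq_in_join_null:
  assumes b: "b \<in> sigma_join M B (null_sets M)" and a: "a \<in> sets M" and B: "B \<subseteq> sets M"
    and ae: "AE \<omega> in M. \<omega> \<in> a \<longleftrightarrow> \<omega> \<in> b"
  shows "a \<in> sigma_join M B (null_sets M)"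
proof -
  note pow = join_null_Pow[OF B]
  interpret sigma_algebra "space M" "sigma_join M B (null_sets M)"
    unfolding sigma_join_def using pow by (rule sigma_algebra_sigma_sets)
  have "sigma_join M B (null_sets M) \<subseteq> sets M"
    unfolding sigma_join_def using B by (intro sets.sigma_sets_subset) auto
  then have b': "b \<in> sets M" using b by blast
  have "AE \<omega> in M. \<omega> \<notin> a - b" "AE \<omega> in M. \<omega> \<notin> b - a"
    using ae by (eventually_elim, blast)+
  then have "a - b \<in> null_sets M" "b - a \<in> null_sets M"
    using AE_iff_null_sets[OF sets.Diff[OF a b']] AE_iff_null_sets[OF sets.Diff[OF b' a]] by simp_all
  then have "a - b \<in> sigma_join M B (null_sets M)" "b - a \<in> sigma_join M B (null_sets M)"
    using sigma_join_null_mono(2) by blast+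
  moreover have "a = (b - (b - a)) \<union> (a - b)" by auto
  ultimately show ?thesis using b by (metis Diff Un)
qed

lemma as_equalI:
  assumes "A \<subseteq> sets M" "B \<subseteq> sets M" "as_subset M A B" "as_subset M B A"
  shows "as_equal M A B"
proof -
  have *: "sigma_join M A (null_sets M) \<subseteq> sigma_join M B (null_sets M)"
    if "B \<subseteq> sets M" "as_subset M A B" for A B
  proof -
    interpret sigma_algebra "space M" "sigma_join M B (null_sets M)"
      unfolding sigma_join_def using join_null_Pow[OF that(1)] by (rule sigma_algebra_sigma_sets)
    have "A \<union> null_sets M \<subseteq> sigma_join M B (null_sets M)"
      using that(2) sigma_join_null_mono(2) unfolding as_subset_def by blast
    then show ?thesis unfolding sigma_join_def[of M A] by (rule sigma_sets_subset)
  qed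
  show ?thesis unfolding as_equal_def using *[of B A] *[of A B] assms by blast
qed

definition join_null_measure :: "'a measure \<Rightarrow> 'a set set \<Rightarrow> 'a measure"
  where "join_null_measure M B = sigma (space M) (B \<union> null_sets M)"

lemma join_null_measure:
  assumes "B \<subseteq> sets M"
  shows "space (join_null_measure M B) = space M" "sets (join_null_measure M B) = sigma_join M B (null_sets M)"
proof -
  have "B \<union> null_sets M \<subseteq> Pow (space M)" by (rule join_null_Pow[OF assms])
  then show "space (join_null_measure M B) = space M" "sets (join_null_measure M B) = sigma_join M B (null_sets M)"
    by (simp_all add: join_null_measure_def sigma_join_def)
qed

lemma as_subset_familyI:
  assumes Z: "\<And>j. j \<in> J \<Longrightarrow> Z j \<in> measurable M (count_space UNIV)" and B: "B \<subseteq> sets M"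
    and Y: "\<And>j. j \<in> J \<Longrightarrow> \<exists>Y \<in> measurable (join_null_measure M B) (count_space UNIV). AE \<omega> in M. Z j \<omega> = Y \<omega>"
  shows "as_subset M (sigma_family M J Z) B"
proof -
  have "(\<Union>j\<in>J. sigma_rv M (Z j)) \<subseteq> sets (join_null_measure M B)"
  proof (intro UN_least subsetI)
    fix j a assume j: "j \<in> J" and "a \<in> sigma_rv M (Z j)"
    then obtain A where a: "a = Z j -` A \<inter> space M" by (auto simp: sigma_rv_eq)
    obtain Y where Y: "Y \<in> measurable (join_null_measure M B) (count_space UNIV)" "AE \<omega> in M. Z j \<omega> = Y \<omega>"
      using Y[OF j] by blast
    have "Y -` A \<inter> space M \<in> sigma_join M B (null_sets M)"
      using measurable_sets[OF Y(1), of A] by (simp add: join_null_measure[OF B])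
    then have "a \<in> sigma_join M B (null_sets M)"
    proof (rule AE_eq_in_join_null[OF _ _ B])
      show "a \<in> sets M" unfolding a using measurable_sets[OF Z[OF j], of A] by simp
      show "AE \<omega> in M. (\<omega> \<in> a) = (\<omega> \<in> Y -` A \<inter> space M)" using Y(2) by (auto simp: a)
    qed
    then show "a \<in> sets (join_null_measure M B)" by (simp add: join_null_measure[OF B])
  qed
  from sets.sigma_sets_subset[OF this] show ?thesis
    unfolding as_subset_def sigma_family_def by (simp only: join_null_measure[OF B])
qed

lemma measurable_join_null:
  assumes B: "B \<subseteq> sets M" and Z: "\<And>A. Z -` A \<inter> space M \<in> sigma_join M B (null_sets M)"
  shows "Z \<in> measurable (join_null_measure M B) (count_space UNIV)"
  by (rule measurableI) (simp_all add: join_null_measure[OF B] Z)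

section \<open>Evolutions\<close>

text \<open>\<open>trajectory j n \<phi>\<close> is \<open>\<phi>\<^bsub>j+n\<^esub> \<circ> \<dots> \<circ> \<phi>\<^bsub>j+1\<^esub>\<close>.\<close>

primrec trajectory :: "int \<Rightarrow> nat \<Rightarrow> (int \<Rightarrow> 'v \<Rightarrow> 'v) \<Rightarrow> 'v \<Rightarrow> 'v"
  where
    "trajectory j 0 \<phi> = id"
  | "trajectory j (Suc n) \<phi> = \<phi> (j + int n + 1) \<circ> trajectory j n \<phi>"

lemma trajectory_cong: "(\<And>i. i \<in> {j<..j + int n} \<Longrightarrow> \<phi> i = \<psi> i) \<Longrightarrow> trajectory j n \<phi> = trajectory j n \<psi>"
  by (induction n) auto

lemma trajectory_set_pow:
  assumes "\<And>i. \<phi> i \<in> A"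
  shows "trajectory j n \<phi> \<in> set_pow A n"
  by (induction n) (simp_all only: trajectory.simps set_pow.simps singleton_iff set_compI assms)

section \<open>Blocks of noise and their independence of the past\<close>

locale evol = prob_space M for M :: "'a measure" +
  fixes \<mu> :: "('v :: finite \<Rightarrow> 'v) pmf" and m :: nat
    and X :: "int \<Rightarrow> 'a \<Rightarrow> 'v list" and N :: "int \<Rightarrow> 'a \<Rightarrow> 'v \<Rightarrow> 'v"
  assumes evolution: "evolution \<mu> m M X N"
begin

lemma X_tuples: "X k \<in> measurable M (count_space (tuples m))"
  and N_measurable [measurable]: "N k \<in> measurable M (count_space UNIV)"
  and step: "AE \<omega> in M. X k \<omega> = map (N k \<omega>) (X (k - 1) \<omega>)"
  and N_indep: "indep_set (sigma_rv M (N k)) (sigma_family M {..k - 1} (\<lambda>j \<omega>. (X j \<omega>, N j \<omega>)))"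
  and N_law: "distr M (count_space UNIV) (N k) = measure_pmf \<mu>"
  using evolution unfolding evolution_def by blast+

lemma X_measurable [measurable]: "X k \<in> measurable M (count_space UNIV)"
  using measurable_compose[OF X_tuples, of "\<lambda>x. x" "count_space UNIV"] by simp

lemma X_length: "\<omega> \<in> space M \<Longrightarrow> length (X k \<omega>) = m"
  using measurable_space[OF X_tuples] by (simp add: tuples_def)

lemma finite_tuples: "finite {xs :: 'v list. length xs = m}"
  using finite_lists_length_eq[of "UNIV :: 'v set" m] by simp

lemma prob_N: "prob {\<omega> \<in> space M. N k \<omega> = f} = pmf \<mu> f"
proof -
  have "pmf \<mu> f = measure (distr M (count_space UNIV) (N k)) {f}" by (simp add: N_law pmf.rep_eq)
  also have "\<dots> = prob (N k -` {f} \<inter> space M)" by (rule measure_distr) auto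
  finally show ?thesis by (simp add: vimage_def Int_def conj_commute)
qed

lemma AE_N: "AE \<omega> in M. N k \<omega> \<in> set_pmf \<mu>"
proof -
  have "AE f in distr M (count_space UNIV) (N k). f \<in> set_pmf \<mu>"
    unfolding N_law by (simp add: AE_measure_pmf_iff)
  then show ?thesis by (subst (asm) AE_distr_iff) auto
qed

definition F :: "int \<Rightarrow> 'a measure"
  where "F k = family_measure M {..k} (\<lambda>j \<omega>. (X j \<omega>, N j \<omega>))"

lemma space_F [simp]: "space (F k) = space M"
  by (simp add: F_def)

lemma measurable_F:
  assumes "j \<le> k"
  shows "X j \<in> measurable (F k) (count_space UNIV)" "N j \<in> measurable (F k) (count_space UNIV)"
proof -
  have *: "(\<lambda>\<omega>. (X j \<omega>, N j \<omega>)) \<in> measurable (F k) (count_space UNIV)"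
    unfolding F_def using assms by (intro measurable_family) simp
  show "X j \<in> measurable (F k) (count_space UNIV)" "N j \<in> measurable (F k) (count_space UNIV)"
    using measurable_compose[OF *, of fst "count_space UNIV"] measurable_compose[OF *, of snd "count_space UNIV"] by simp_all
qed

lemma F_events: "sets (F k) \<subseteq> events"
proof -
  have "(\<lambda>\<omega>. (X j \<omega>, N j \<omega>)) \<in> measurable M (count_space UNIV)" for j
    by (rule measurable_discrete2[OF X_measurable N_measurable])
  then show ?thesis unfolding F_def by (simp add: sigma_family_events)
qed

lemma F_mono: "j \<le> k \<Longrightarrow> sets (F j) \<subseteq> sets (F k)"
  unfolding F_def sets_family_measure by (rule sigma_family_mono) simp

lemma past_X_F: "past M X k \<subseteq> sets (F k)"
  unfolding past_def F_def sets_family_measure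
  by (rule measurable_family_comp) (use measurable_F in \<open>simp add: F_def\<close>)

lemma prob_N_F: "A \<in> sets (F k) \<Longrightarrow> prob (A \<inter> {\<omega> \<in> space M. N (k + 1) \<omega> = f}) = prob A * pmf \<mu> f"
proof -
  assume A: "A \<in> sets (F k)"
  have "{\<omega> \<in> space M. N (k + 1) \<omega> = f} \<in> sigma_rv M (N (k + 1))"
    by (auto simp: sigma_rv_eq)
  then have "prob ({\<omega> \<in> space M. N (k + 1) \<omega> = f} \<inter> A) = prob {\<omega> \<in> space M. N (k + 1) \<omega> = f} * prob A"
    using N_indep[of "k + 1"] A by (intro indep_setD) (auto simp: F_def)
  then show ?thesis by (simp add: prob_N Int_commute mult.commute)
qed

text \<open>Outside the window \<open>restrict\<close> freezes the path, so a window of noise has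
  finitely many values and probabilities become finite sums.\<close>

definition NW :: "int \<Rightarrow> int \<Rightarrow> 'a \<Rightarrow> int \<Rightarrow> 'v \<Rightarrow> 'v"
  where "NW j k \<omega> = restrict (\<lambda>i. N i \<omega>) {j<..k}"

abbreviation NT :: "int \<Rightarrow> nat \<Rightarrow> 'a \<Rightarrow> 'v \<Rightarrow> 'v"
  where "NT j n \<omega> \<equiv> trajectory j n (\<lambda>i. N i \<omega>)"

lemma NT_NW: "j + int n \<le> k \<Longrightarrow> trajectory j n (NW j k \<omega>) = NT j n \<omega>"
  unfolding NW_def by (rule trajectory_cong) simp

lemma NW_measurable:
  assumes "\<And>i. i \<in> {j<..k} \<Longrightarrow> N i \<in> measurable M' (count_space UNIV)"
  shows "NW j k \<in> measurable M' (count_space UNIV)"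
  unfolding NW_def using assms by (intro measurable_window) auto

lemma NW_F: "NW j k \<in> measurable (F k) (count_space UNIV)"
  by (rule NW_measurable) (simp add: measurable_F)

lemma NW_M [measurable]: "NW j k \<in> measurable M (count_space UNIV)"
  by (rule NW_measurable) simp

lemma NT_measurable:
  assumes "\<And>i. i \<in> {j<..j + int n} \<Longrightarrow> N i \<in> measurable M' (count_space UNIV)"
  shows "NT j n \<in> measurable M' (count_space UNIV)"
proof -
  have "(\<lambda>\<omega>. trajectory j n (NW j (j + int n) \<omega>)) \<in> measurable M' (count_space UNIV)"
    using measurable_discrete1[OF NW_measurable[OF assms], where F="trajectory j n"] .
  then show ?thesis by (simp add: NT_NW)
qed

lemma NT_M [measurable]: "NT j n \<in> measurable M (count_space UNIV)"
  by (rule NT_measurable) simp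

lemma NW_PiE: "NW j k \<omega> \<in> PiE {j<..k} (\<lambda>_. UNIV)"
  by (simp add: NW_def)

lemma finite_NW: "finite (PiE {j<..k :: int} (\<lambda>_. UNIV :: ('v \<Rightarrow> 'v) set))"
  by (intro finite_PiE) auto

lemma sets_Collect_eq: "Z \<in> measurable M' (count_space UNIV) \<Longrightarrow> {\<omega> \<in> space M'. P (Z \<omega>)} \<in> sets M'"
  using measurable_sets[of Z M' "count_space UNIV" "Collect P"] by (simp add: vimage_def Int_def conj_commute)

lemma sets_Collect_M: "Z \<in> measurable M (count_space UNIV) \<Longrightarrow> {\<omega> \<in> space M. P (Z \<omega>)} \<in> events"
  by (rule sets_Collect_eq)

lemma sets_Collect_F: "Z \<in> measurable (F k) (count_space UNIV) \<Longrightarrow> {\<omega> \<in> space M. P (Z \<omega>)} \<in> sets (F k)"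
  using sets_Collect_eq[of Z "F k" P] by simp

lemma prob_NW_point:
  assumes A: "A \<in> sets (F j)"
  shows "prob (A \<inter> {\<omega> \<in> space M. \<forall>i\<in>{j<..j + int n}. N i \<omega> = \<phi> i}) = prob A * (\<Prod>i\<in>{j<..j + int n}. pmf \<mu> (\<phi> i))"
proof (induction n)
  case 0
  have "A \<inter> space M = A" using A F_events sets.sets_into_space by blast
  then show ?case by simp
next
  case (Suc n)
  let ?k = "j + int n"
  have split: "{j<..j + int (Suc n)} = insert (?k + 1) {j<..?k}" by auto
  have A': "A \<inter> {\<omega> \<in> space M. \<forall>i\<in>{j<..?k}. N i \<omega> = \<phi> i} \<in> sets (F ?k)"
  proof (intro sets.Int)
    show "A \<in> sets (F ?k)" using A F_mono[of j ?k] by auto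
    have "{\<omega> \<in> space M. (\<lambda>\<psi>. \<forall>i\<in>{j<..?k}. \<psi> i = \<phi> i) (NW j ?k \<omega>)} \<in> sets (F ?k)"
      by (rule sets_Collect_F[OF NW_F])
    then show "{\<omega> \<in> space M. \<forall>i\<in>{j<..?k}. N i \<omega> = \<phi> i} \<in> sets (F ?k)" by (simp add: NW_def)
  qed
  have "A \<inter> {\<omega> \<in> space M. \<forall>i\<in>{j<..j + int (Suc n)}. N i \<omega> = \<phi> i} =
      (A \<inter> {\<omega> \<in> space M. \<forall>i\<in>{j<..?k}. N i \<omega> = \<phi> i}) \<inter> {\<omega> \<in> space M. N (?k + 1) \<omega> = \<phi> (?k + 1)}"
    unfolding split by auto
  then have "prob (A \<inter> {\<omega> \<in> space M. \<forall>i\<in>{j<..j + int (Suc n)}. N i \<omega> = \<phi> i}) =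
      prob A * (\<Prod>i\<in>{j<..?k}. pmf \<mu> (\<phi> i)) * pmf \<mu> (\<phi> (?k + 1))"
    using prob_N_F[OF A'] Suc.IH by simp
  also have "\<dots> = prob A * (\<Prod>i\<in>{j<..j + int (Suc n)}. pmf \<mu> (\<phi> i))"
    unfolding split by (subst prod.insert) auto
  finally show ?case .
qed

text \<open>Summing the point formula over the windows that satisfy P gives a factor free of
  \<open>A\<close>; the whole space in place of \<open>A\<close> identifies this factor.\<close>

lemma prob_NW:
  assumes A: "A \<in> sets (F j)"
  shows "prob (A \<inter> {\<omega> \<in> space M. P (NW j k \<omega>)}) = prob A * prob {\<omega> \<in> space M. P (NW j k \<omega>)}"
proof -
  define n where "n = nat (k - j)"
  have NWn: "NW j k = NW j (j + int n)"
  proof -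
    have "{j<..k} = {j<..j + int n}" by (auto simp: n_def)
    then show ?thesis by (simp add: NW_def[abs_def])
  qed
  let ?T = "PiE {j<..j + int n} (\<lambda>_. UNIV :: ('v \<Rightarrow> 'v) set)"
  let ?pr = "\<lambda>\<phi>. \<Prod>i\<in>{j<..j + int n}. pmf \<mu> (\<phi> i)"
  have point: "prob (B \<inter> {\<omega> \<in> space M. P (NW j k \<omega>)}) = prob B * (\<Sum>\<phi>\<in>?T. if P \<phi> then ?pr \<phi> else 0)"
    if B: "B \<in> sets (F j)" for B
  proof -
    have B': "B \<in> events" using B F_events by blast
    have "prob (B \<inter> {\<omega> \<in> space M. P (NW j k \<omega>)}) =
        (\<Sum>\<phi>\<in>?T. prob (B \<inter> {\<omega> \<in> space M. P (NW j k \<omega>)} \<inter> {\<omega> \<in> space M. NW j k \<omega> = \<phi>}))"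
      using NW_PiE[of j "j + int n"] sets_Collect_M[OF NW_M, of P j k] B'
      by (intro prob_partition finite_NW NW_M) (auto simp: NWn)
    also have "\<dots> = (\<Sum>\<phi>\<in>?T. prob B * (if P \<phi> then ?pr \<phi> else 0))"
    proof (rule sum.cong[OF refl])
      fix \<phi> assume \<phi>: "\<phi> \<in> ?T"
      have eq: "NW j k \<omega> = \<phi> \<longleftrightarrow> (\<forall>i\<in>{j<..j + int n}. N i \<omega> = \<phi> i)" for \<omega>
      proof
        assume "\<forall>i\<in>{j<..j + int n}. N i \<omega> = \<phi> i"
        then show "NW j k \<omega> = \<phi>" unfolding NWn NW_def using \<phi>
          by (intro extensionalityI[of _ "{j<..j + int n}"]) (auto simp: PiE_def)
      qed (auto simp: NWn NW_def)
      have set_eq: "B \<inter> {\<omega> \<in> space M. P (NW j k \<omega>)} \<inter> {\<omega> \<in> space M. NW j k \<omega> = \<phi>} =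
          (if P \<phi> then B \<inter> {\<omega> \<in> space M. \<forall>i\<in>{j<..j + int n}. N i \<omega> = \<phi> i} else {})"
        unfolding eq[symmetric] by auto
      show "prob (B \<inter> {\<omega> \<in> space M. P (NW j k \<omega>)} \<inter> {\<omega> \<in> space M. NW j k \<omega> = \<phi>}) =
          prob B * (if P \<phi> then ?pr \<phi> else 0)"
        unfolding set_eq using prob_NW_point[OF B, of n \<phi>] by simp
    qed
    finally show ?thesis by (simp only: sum_distrib_left)
  qed
  have "space M \<in> sets (F j)" using sets.top[of "F j"] by simp
  from point[OF this] have "prob {\<omega> \<in> space M. P (NW j k \<omega>)} = (\<Sum>\<phi>\<in>?T. if P \<phi> then ?pr \<phi> else 0)"
    by (simp add: prob_space Int_def)
  with point[OF A] show ?thesis by simp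
qed

text \<open>Induction on the length of the block: split by the previous product and the newest map,
  which is independent of all that precedes it.\<close>

lemma prob_NT_F:
  assumes A: "A \<in> sets (F j)"
  shows "prob (A \<inter> {\<omega> \<in> space M. NT j n \<omega> = z}) = prob A * pmf (conv_pow \<mu> n) z"
proof (induction n arbitrary: z)
  case 0
  have "A \<inter> space M = A" using A F_events sets.sets_into_space by blast
  then have "A \<inter> {\<omega> \<in> space M. NT j 0 \<omega> = z} = (if z = id then A else {})"
    unfolding trajectory.simps by auto
  then show ?case unfolding conv_pow.simps by (cases "z = id") (simp_all only: pmf_return if_True if_False refl, simp_all)
next
  case (Suc n)
  let ?k = "j + int n"
  have A': "A \<inter> {\<omega> \<in> space M. NT j n \<omega> = y} \<in> sets (F ?k)" for y
    using A F_mono[of j ?k] sets_Collect_F[OF NT_measurable[OF measurable_F(2)], of j n ?k "\<lambda>x. x = y"] by auto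
  have Aev: "A \<in> events" using A F_events by blast
  have ev: "A \<inter> {\<omega> \<in> space M. NT j (Suc n) \<omega> = z} \<in> events"
    using Aev sets_Collect_M[OF NT_M, of "\<lambda>x. x = z" j "Suc n"] by (intro sets.Int)
  have meas: "(\<lambda>\<omega>. (NT j n \<omega>, N (?k + 1) \<omega>)) \<in> measurable M (count_space UNIV)"
    by (rule measurable_discrete2[OF NT_M N_measurable])
  have "prob (A \<inter> {\<omega> \<in> space M. NT j (Suc n) \<omega> = z}) =
      (\<Sum>(y, f)\<in>UNIV. prob (A \<inter> {\<omega> \<in> space M. NT j (Suc n) \<omega> = z} \<inter> {\<omega> \<in> space M. (NT j n \<omega>, N (?k + 1) \<omega>) = (y, f)}))"
    unfolding case_prod_beta' prod.collapse by (rule prob_partition[OF _ _ meas ev]) auto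
  also have "\<dots> = (\<Sum>(y, f)\<in>UNIV. prob A * (pmf \<mu> f * pmf (conv_pow \<mu> n) y * of_bool (f \<circ> y = z)))"
  proof (rule sum.cong[OF refl], clarify)
    fix y f :: "'v \<Rightarrow> 'v"
    have "A \<inter> {\<omega> \<in> space M. NT j (Suc n) \<omega> = z} \<inter> {\<omega> \<in> space M. (NT j n \<omega>, N (?k + 1) \<omega>) = (y, f)} =
        (if f \<circ> y = z then (A \<inter> {\<omega> \<in> space M. NT j n \<omega> = y}) \<inter> {\<omega> \<in> space M. N (?k + 1) \<omega> = f} else {})"
      by (auto simp: add.assoc)
    then show "prob (A \<inter> {\<omega> \<in> space M. NT j (Suc n) \<omega> = z} \<inter> {\<omega> \<in> space M. (NT j n \<omega>, N (?k + 1) \<omega>) = (y, f)}) =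
        prob A * (pmf \<mu> f * pmf (conv_pow \<mu> n) y * of_bool (f \<circ> y = z))"
      using prob_N_F[OF A'[of y], of f] Suc.IH[of y] by simp
  qed
  also have "\<dots> = prob A * pmf (conv_pow \<mu> (Suc n)) z"
    unfolding conv_pow.simps pmf_conv UNIV_Times_UNIV[symmetric]
    by (subst sum.cartesian_product[symmetric], subst sum.swap) (simp only: sum_distrib_left)
  finally show ?case .
qed

lemma prob_NT_F_Collect:
  assumes A: "A \<in> sets (F j)"
  shows "prob (A \<inter> {\<omega> \<in> space M. P (NT j n \<omega>)}) = prob A * measure (measure_pmf (conv_pow \<mu> n)) (Collect P)"
proof -
  have Aev: "A \<in> events" using A F_events by blast
  have ev: "A \<inter> {\<omega> \<in> space M. P (NT j n \<omega>)} \<in> events"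
    using Aev sets_Collect_M[OF NT_M, of P] by (intro sets.Int)
  have "prob (A \<inter> {\<omega> \<in> space M. P (NT j n \<omega>)}) =
     (\<Sum>z\<in>UNIV. prob (A \<inter> {\<omega> \<in> space M. P (NT j n \<omega>)} \<inter> {\<omega> \<in> space M. NT j n \<omega> = z}))"
    by (rule prob_partition[OF _ _ NT_M ev]) auto
  also have "\<dots> = (\<Sum>z\<in>UNIV. if P z then prob A * pmf (conv_pow \<mu> n) z else 0)"
  proof (rule sum.cong[OF refl])
    fix z
    have "A \<inter> {\<omega> \<in> space M. P (NT j n \<omega>)} \<inter> {\<omega> \<in> space M. NT j n \<omega> = z} =
      (if P z then A \<inter> {\<omega> \<in> space M. NT j n \<omega> = z} else {})" by auto
    then show "prob (A \<inter> {\<omega> \<in> space M. P (NT j n \<omega>)} \<inter> {\<omega> \<in> space M. NT j n \<omega> = z}) =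
        (if P z then prob A * pmf (conv_pow \<mu> n) z else 0)"
      using prob_NT_F[OF A] by simp
  qed
  also have "\<dots> = prob A * (\<Sum>z\<in>Collect P. pmf (conv_pow \<mu> n) z)"
    by (simp add: sum.If_cases sum_distrib_left)
  also have "(\<Sum>z\<in>Collect P. pmf (conv_pow \<mu> n) z) = measure (measure_pmf (conv_pow \<mu> n)) (Collect P)"
    by (simp add: measure_measure_pmf_finite)
  finally show ?thesis .
qed

text \<open>Collects the almost sure relations of all times in one condition, so that later
  arguments run path by path.\<close>

definition regular :: "'a \<Rightarrow> bool"
  where "regular \<omega> \<longleftrightarrow> (\<forall>k. X k \<omega> = map (N k \<omega>) (X (k - 1) \<omega>) \<and> N k \<omega> \<in> set_pmf \<mu> \<and> length (X k \<omega>) = m)"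

lemma AE_regular: "AE \<omega> in M. regular \<omega>"
proof -
  have "AE \<omega> in M. X k \<omega> = map (N k \<omega>) (X (k - 1) \<omega>) \<and> N k \<omega> \<in> set_pmf \<mu> \<and> length (X k \<omega>) = m" for k
    using step AE_N AE_space by eventually_elim (simp add: X_length)
  then show ?thesis unfolding regular_def by (simp add: AE_all_countable)
qed

lemma regular_NT: "regular \<omega> \<Longrightarrow> X (j + int n) \<omega> = map (NT j n \<omega>) (X j \<omega>)"
proof (induction n)
  case (Suc n)
  have "X (j + int n + 1) \<omega> = map (N (j + int n + 1) \<omega>) (X (j + int n) \<omega>)"
    using Suc.prems unfolding regular_def by (metis add_diff_cancel_right')
  moreover have "j + int (Suc n) = j + int n + 1" by simp
  ultimately show ?case using Suc.IH[OF Suc.prems] by (simp only: trajectory.simps list.map_comp)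
qed simp

lemma regular_NT_pow: "regular \<omega> \<Longrightarrow> NT j n \<omega> \<in> set_pow (set_pmf \<mu>) n"
  by (rule trajectory_set_pow) (simp add: regular_def)

end

section \<open>Evolutions of maximal deadlocked tuples\<close>

lemma tendsto_measure_pmf:
  fixes \<rho> :: "('b :: finite) pmf"
  assumes "\<And>f. (\<lambda>n. pmf (\<rho>n n) f) \<longlonglongrightarrow> pmf \<rho> f"
  shows "(\<lambda>n. measure (measure_pmf (\<rho>n n)) A) \<longlonglongrightarrow> measure (measure_pmf \<rho>) A"
proof -
  have "measure (measure_pmf \<rho>) A = (\<Sum>f\<in>A. pmf \<rho> f)" for \<rho> :: "'b pmf"
    by (rule measure_measure_pmf_finite) simp
  then show ?thesis by (simp add: tendsto_sum assms)
qed

context kernel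
begin

text \<open>Along multiples of \<open>Q\<close> both \<open>\<mu>\<^sup>n \<rightarrow> \<eta>\<close> and \<open>\<gamma>\<^sup>n \<in> H\<close>.\<close>

definition Q :: nat
  where "Q = (SOME N. periodic_limit \<mu> \<eta> N) * p"

lemma Q_lim: "(\<lambda>n. pmf (conv_pow \<mu> (Q * n)) f) \<longlonglongrightarrow> pmf \<eta> f"
proof -
  define N where "N = (SOME N. periodic_limit \<mu> \<eta> N)"
  have "periodic_limit \<mu> \<eta> N" unfolding N_def using eta_of_facts by (metis someI_ex)
  then interpret periodic_limit \<mu> \<eta> N .
  have "strict_mono (\<lambda>n. p * n)" using p_pos by (intro strict_monoI) simp
  from LIMSEQ_subseq_LIMSEQ[OF lim this] show ?thesis
    by (simp add: comp_def Q_def N_def mult.assoc)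
qed

lemma Q_K_lim: "(\<lambda>n. measure (measure_pmf (conv_pow \<mu> (Q * n))) K) \<longlonglongrightarrow> 1"
proof -
  have "measure (measure_pmf \<eta>) K = 1"
    by (subst measure_pmf.prob_eq_1) (use eta_subset_K in \<open>auto simp: AE_measure_pmf_iff\<close>)
  then show ?thesis using tendsto_measure_pmf[OF Q_lim, of K] by simp
qed

end

context phased
begin

text \<open>By \<open>prob_X\<close> below, the conditional probability of \<open>X k = x\<close>
  given that the invariant has the value belonging to x.\<close>

definition kap where "kap x = pmf (etaL_of \<mu> e) (xL x) / card H"

lemma gamma_pow_Q: "\<gamma> [^]\<^bsub>G\<^esub> (int (Q * n)) \<in> H"
proof -
  obtain c where c: "Q * n = p * c" unfolding Q_def by (metis mult.assoc mult.commute)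
  have "(\<gamma> [^]\<^bsub>G\<^esub> p) [^]\<^bsub>G\<^esub> c \<in> H"
  proof (induction c)
    case (Suc c)
    have "(\<gamma> [^]\<^bsub>G\<^esub> p) [^]\<^bsub>G\<^esub> Suc c = (\<gamma> [^]\<^bsub>G\<^esub> p) [^]\<^bsub>G\<^esub> c \<circ> \<gamma> [^]\<^bsub>G\<^esub> p"
      by (simp only: G.nat_pow_Suc mult_G)
    then show ?case using H_comp[OF Suc gamma_p] by (simp only:)
  qed (simp add: e_H)
  then show ?thesis using G.nat_pow_pow[OF gamma_G, of p c] by (simp only: c int_pow_int)
qed

lemma ph_period:
  assumes g: "g \<in> carrier G"
  shows "ph (k - int (Q * n)) g = ph k g"
proof -
  let ?c = "\<gamma> [^]\<^bsub>G\<^esub> k"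
  define h where "h = \<gamma> [^]\<^bsub>G\<^esub> (int (Q * n))"
  have h: "h \<in> H" unfolding h_def by (rule gamma_pow_Q)
  have "?c = \<gamma> [^]\<^bsub>G\<^esub> (k - int (Q * n)) \<circ> h"
    using G.int_pow_mult[OF gamma_G, of "k - int (Q * n)" "int (Q * n)"] by (simp add: h_def del: of_nat_mult)
  then have "inv\<^bsub>G\<^esub> ?c = inv\<^bsub>G\<^esub> h \<circ> inv\<^bsub>G\<^esub> (\<gamma> [^]\<^bsub>G\<^esub> (k - int (Q * n)))"
    using G.inv_mult_group[OF gamma_pow_G[of "k - int (Q * n)"] H_G[OF h]] by simp
  then have "inv\<^bsub>G\<^esub> ?c \<circ> g = inv\<^bsub>G\<^esub> h \<circ> (inv\<^bsub>G\<^esub> (\<gamma> [^]\<^bsub>G\<^esub> (k - int (Q * n))) \<circ> g)"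
    by (simp only: comp_assoc)
  then show ?thesis
    unfolding ph_def using Cp_H_comp[OF G_comp[OF G.inv_closed[OF gamma_pow_G[of "k - int (Q * n)"]] g] H_inv[OF h]]
    by (simp only:)
qed

end

section \<open>The states are F-cliques almost surely\<close>

locale clique_evolution = phased \<mu> e W \<gamma> + evol M \<mu> "m_of \<mu>" X N
  for \<mu> :: "('v :: finite \<Rightarrow> 'v) pmf" and e W \<gamma> and M :: "'a measure"
    and X :: "int \<Rightarrow> 'a \<Rightarrow> 'v list" and N :: "int \<Rightarrow> 'a \<Rightarrow> 'v \<Rightarrow> 'v" +
  assumes distinct_sequences:
    "AE \<omega> in M. \<forall>i<m_of \<mu>. \<forall>j<m_of \<mu>. i \<noteq> j \<longrightarrow> (\<lambda>k. X k \<omega> ! i) \<noteq> (\<lambda>k. X k \<omega> ! j)"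
begin

lemma regular_between: "regular \<omega> \<Longrightarrow> j \<le> k \<Longrightarrow> X k \<omega> = map (NT j (nat (k - j)) \<omega>) (X j \<omega>)"
  using regular_NT[of \<omega> j "nat (k - j)"] by simp

text \<open>Two coordinates that differ at some time differ at all earlier times, as the present is
  a function of the past; for finitely many pairs one early time serves all of them.\<close>

lemma AE_eventually_distinct: "AE \<omega> in M. \<exists>n. distinct (X (- int n) \<omega>)"
  using AE_regular distinct_sequences
proof eventually_elim
  case (elim \<omega>)
  define P where "P = {(i, j). i < m_of \<mu> \<and> j < m_of \<mu> \<and> i \<noteq> j}"
  have "finite P" by (rule finite_subset[of _ "{..<m_of \<mu>} \<times> {..<m_of \<mu>}"]) (auto simp: P_def)
  have "\<forall>q\<in>P. \<exists>k. X k \<omega> ! fst q \<noteq> X k \<omega> ! snd q"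
    using elim(2) by (fastforce simp: P_def fun_eq_iff)
  then obtain \<kappa> where \<kappa>: "\<And>q. q \<in> P \<Longrightarrow> X (\<kappa> q) \<omega> ! fst q \<noteq> X (\<kappa> q) \<omega> ! snd q" by metis
  \<comment> \<open>A sum in place of a maximum: it dominates every summand and is also defined when
    there are no pairs.\<close>
  define n where "n = (\<Sum>q\<in>P. nat \<bar>\<kappa> q\<bar>)"
  have n: "- int n \<le> \<kappa> q" if "q \<in> P" for q
  proof -
    have "nat \<bar>\<kappa> q\<bar> \<le> n"
      using member_le_sum[OF that, of "\<lambda>q. nat \<bar>\<kappa> q\<bar>"] \<open>finite P\<close> unfolding n_def by simp
    then show ?thesis by linarith
  qed
  have len: "length (X k \<omega>) = m_of \<mu>" for k using elim(1) unfolding regular_def by blast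
  have "X (- int n) \<omega> ! i \<noteq> X (- int n) \<omega> ! j" if "i < m_of \<mu>" "j < m_of \<mu>" "i \<noteq> j" for i j
  proof
    assume eq: "X (- int n) \<omega> ! i = X (- int n) \<omega> ! j"
    have q: "(i, j) \<in> P" using that by (simp add: P_def)
    show False using \<kappa>[OF q] regular_between[OF elim(1) n[OF q]] eq that by (simp add: len)
  qed
  then show ?case by (auto simp: distinct_conv_nth len)
qed

text \<open>Distinctness spreads backwards in time, so the events increase up to null sets; the
  unions \<open>D\<close> make this monotonicity exact.\<close>

lemma prob_distinct_lim: "(\<lambda>n. prob {\<omega> \<in> space M. distinct (X (- int n) \<omega>)}) \<longlonglongrightarrow> 1"
proof -
  define D where "D n = (\<Union>i\<le>n. {\<omega> \<in> space M. distinct (X (- int i) \<omega>)})" for n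
  have ev: "{\<omega> \<in> space M. distinct (X k \<omega>)} \<in> events" for k by (rule sets_Collect_M[OF X_measurable])
  have D: "range D \<subseteq> events" unfolding D_def using ev by (auto intro!: sets.finite_UN)
  have "incseq D" unfolding D_def incseq_def by (auto intro: order.trans)
  have "prob (\<Union>n. D n) = 1"
  proof (subst prob_eq_1)
    show "(\<Union>n. D n) \<in> events" using D by auto
    show "AE \<omega> in M. \<omega> \<in> (\<Union>n. D n)"
      using AE_eventually_distinct AE_space by eventually_elim (auto simp: D_def)
  qed
  then have "(\<lambda>n. prob (D n)) \<longlonglongrightarrow> 1" using finite_Lim_measure_incseq[OF D \<open>incseq D\<close>] by simp
  moreover have "prob (D n) = prob {\<omega> \<in> space M. distinct (X (- int n) \<omega>)}" for n
  proof (rule finite_measure_eq_AE)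
    show "AE \<omega> in M. (\<omega> \<in> D n) = (\<omega> \<in> {\<omega> \<in> space M. distinct (X (- int n) \<omega>)})"
      using AE_regular
    proof eventually_elim
      case (elim \<omega>)
      have "distinct (X (- int n) \<omega>)" if "i \<le> n" "distinct (X (- int i) \<omega>)" for i
        using that regular_between[OF elim, of "- int n" "- int i"] by (simp add: distinct_map)
      then show ?case by (auto simp: D_def)
    qed
  qed (use D ev in auto)
  ultimately show ?thesis by simp
qed

definition deadlocked :: "'v list \<Rightarrow> bool"
  where "deadlocked x \<longleftrightarrow> distinct x \<and> (\<forall>g\<in>S. distinct (map g x))"

lemma deadlocked_map: "deadlocked x \<Longrightarrow> f \<in> S \<Longrightarrow> deadlocked (map f x)"
  unfolding deadlocked_def map_comp_eq using S_of_comp by blast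

lemma NT_S: "regular \<omega> \<Longrightarrow> 0 < n \<Longrightarrow> NT j n \<omega> \<in> S"
  using regular_NT_pow[of \<omega> j n] set_pow_in_S[of n \<mu>] by blast

text \<open>Each \<open>g\<close> in the semigroup occurs as a product of \<open>n\<close> consecutive maps with a fixed positive probability,
  so far in the past it can merge the states with negligible probability only.\<close>

lemma prob_merge_lim:
  assumes g: "g \<in> S"
  shows "(\<lambda>i. prob {\<omega> \<in> space M. distinct (X (- int i) \<omega>) \<and> \<not> distinct (map g (X (- int i) \<omega>))}) \<longlonglongrightarrow> 0"
proof -
  obtain n where n: "g \<in> set_pow (set_pmf \<mu>) n" using g unfolding S_of_def by blast
  define q where "q = pmf (conv_pow \<mu> n) g"
  have q: "q > 0" unfolding q_def using n by (simp add: pmf_positive set_pmf_conv_pow)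
  define d where "d k = prob {\<omega> \<in> space M. distinct (X k \<omega>)}" for k
  define B where "B k = {\<omega> \<in> space M. distinct (X k \<omega>) \<and> \<not> distinct (map g (X k \<omega>))}" for k
  have BF: "B k \<in> sets (F k)" for k
    unfolding B_def by (rule sets_Collect_F[OF measurable_F(1)]) simp
  \<comment> \<open>If g would merge the states at time k and the next block is g, the states at
    time \<open>k + int n\<close> are not distinct; the block is independent of the state at k and
    equals g with probability q.\<close>
  have "d (k + int n) \<le> 1 - q * prob (B k)" for k
  proof -
    let ?A = "B k \<inter> {\<omega> \<in> space M. NT k n \<omega> = g}"
    have A: "?A \<in> events" using BF F_events sets_Collect_M[OF NT_M, of "\<lambda>z. z = g"] by blast
    have "d (k + int n) \<le> prob (space M - ?A)"
      unfolding d_def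
    proof (rule finite_measure_mono_AE)
      show "AE \<omega> in M. \<omega> \<in> {\<omega> \<in> space M. distinct (X (k + int n) \<omega>)} \<longrightarrow> \<omega> \<in> space M - ?A"
        using AE_regular by eventually_elim (auto simp: B_def regular_NT)
    qed (use A in auto)
    also have "\<dots> = 1 - prob (B k) * q" using prob_compl[OF A] prob_NT_F[OF BF] by (simp add: q_def)
    finally show ?thesis by (simp add: mult.commute)
  qed
  \<comment> \<open>Applied at the time that makes the block end at \<open>- int i\<close>.\<close>
  then have le: "prob (B (- int (i + n))) \<le> (1 - d (- int i)) / q" for i
    using q by (simp add: field_simps) (metis add.commute add_diff_cancel_left' diff_conv_add_uminus minus_diff_eq)
  have "(\<lambda>i. (1 - d (- int i)) / q) \<longlonglongrightarrow> 0"
    using q unfolding d_def by (auto intro!: tendsto_eq_intros prob_distinct_lim)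
  then have "(\<lambda>i. prob (B (- int (i + n)))) \<longlonglongrightarrow> 0"
    by (rule tendsto_sandwich[OF _ _ tendsto_const, rotated 2]) (use le in auto)
  then show ?thesis unfolding B_def[symmetric] by (rule LIMSEQ_offset)
qed

text \<open>Far in the past the states are distinct with probability near 1, and each of the
  finitely many g in \<open>S\<close> merges them with vanishing probability. Deadlocks persist in
  time, so the resulting bound passes to the fixed time \<open>k\<close>.\<close>

lemma AE_deadlocked: "AE \<omega> in M. deadlocked (X k \<omega>)"
proof -
  define T where "T k = {\<omega> \<in> space M. deadlocked (X k \<omega>)}" for k
  define D where "D k = {\<omega> \<in> space M. distinct (X k \<omega>)}" for k
  define B where "B g k = {\<omega> \<in> space M. distinct (X k \<omega>) \<and> \<not> distinct (map g (X k \<omega>))}"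
    for g :: "'v \<Rightarrow> 'v" and k
  have ev: "T k \<in> events" "D k \<in> events" "B g k \<in> events" for g :: "'v \<Rightarrow> 'v" and k
    unfolding T_def D_def B_def by (rule sets_Collect_M[OF X_measurable])+
  have "prob (D k) \<le> prob (T k) + (\<Sum>g\<in>S. prob (B g k))" for k
  proof -
    have "prob (D k) \<le> prob (T k \<union> (\<Union>g\<in>S. B g k))"
      using ev by (intro finite_measure_mono) (auto simp: T_def D_def B_def deadlocked_def intro!: sets.finite_UN)
    also have "\<dots> \<le> prob (T k) + prob (\<Union>g\<in>S. B g k)"
      using ev by (intro measure_Un_le) (auto intro!: sets.finite_UN)
    also have "prob (\<Union>g\<in>S. B g k) \<le> (\<Sum>g\<in>S. prob (B g k))"
      using ev by (intro measure_UNION_le) auto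
    finally show ?thesis by simp
  qed
  then have le: "prob (D k) - (\<Sum>g\<in>S. prob (B g k)) \<le> prob (T k)" for k by (simp add: algebra_simps)
  have lim: "(\<lambda>i. prob (D (- int i)) - (\<Sum>g\<in>S. prob (B g (- int i)))) \<longlonglongrightarrow> 1 - (\<Sum>g\<in>S. 0)"
    unfolding D_def B_def by (intro tendsto_diff tendsto_sum prob_distinct_lim prob_merge_lim)
  have mono: "prob (T j) \<le> prob (T k)" if "j \<le> k" for j
  proof (rule finite_measure_mono_AE)
    show "AE \<omega> in M. \<omega> \<in> T j \<longrightarrow> \<omega> \<in> T k"
      using AE_regular
    proof eventually_elim
      case (elim \<omega>)
      show ?case
      proof (cases "j = k")
        case False
        then have "NT j (nat (k - j)) \<omega> \<in> S" using that by (intro NT_S[OF elim]) simp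
        then show ?thesis using deadlocked_map regular_between[OF elim that] by (auto simp: T_def)
      qed simp
    qed
  qed (rule ev)
  have "1 - (\<Sum>g\<in>S. 0) \<le> prob (T k)"
  proof (rule LIMSEQ_le_const2[OF lim])
    show "\<exists>i0. \<forall>i\<ge>i0. prob (D (- int i)) - (\<Sum>g\<in>S. prob (B g (- int i))) \<le> prob (T k)"
    proof (intro exI[of _ "nat (- k)"] allI impI)
      fix i assume "nat (- k) \<le> i"
      then have "- int i \<le> k" by simp
      from order.trans[OF le mono[OF this]]
      show "prob (D (- int i)) - (\<Sum>g\<in>S. prob (B g (- int i))) \<le> prob (T k)" .
    qed
  qed
  then have "prob (T k) = 1" using prob_le_1[of "T k"] by simp
  then show ?thesis using ev(1)[of k] by (subst (asm) prob_eq_1) (auto simp: T_def elim: AE_mp)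
qed

lemma prob_NT_K_lim: "(\<lambda>n. prob {\<omega> \<in> space M. NT (k - int (Q * n)) (Q * n) \<omega> \<in> K}) \<longlonglongrightarrow> 1"
proof -
  have "prob {\<omega> \<in> space M. NT j n \<omega> \<in> K} = measure (measure_pmf (conv_pow \<mu> n)) K" for j n
    using prob_NT_F_Collect[of "space M" j "\<lambda>z. z \<in> K" n] sets.top[of "F j"] by (simp add: prob_space Int_def)
  then show ?thesis using Q_K_lim by simp
qed

text \<open>The law of the blocks of length \<open>Q * n\<close> ending at \<open>k\<close> tends to
  \<eta>, which is carried by \<open>K\<close>, so almost surely at least one block lies in
  \<open>K\<close>.\<close>

lemma AE_NT_K: "AE \<omega> in M. \<exists>n. NT (k - int n) n \<omega> \<in> K"
proof -
  let ?A = "{\<omega> \<in> space M. \<exists>n. NT (k - int n) n \<omega> \<in> K}"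
  have ev: "{\<omega> \<in> space M. NT (k - int n) n \<omega> \<in> K} \<in> events" for n
    by (rule sets_Collect_M[OF NT_M])
  have A: "?A \<in> events" using ev by (rule sets.sets_Collect_countable_Ex)
  have "1 \<le> prob ?A"
  proof (rule LIMSEQ_le_const2[OF prob_NT_K_lim], intro exI allI impI)
    fix n
    show "prob {\<omega> \<in> space M. NT (k - int (Q * n)) (Q * n) \<omega> \<in> K} \<le> prob ?A"
      using A by (intro finite_measure_mono) blast+
  qed
  then have "prob ?A = 1" using prob_le_1[of ?A] by simp
  then show ?thesis using A by (subst (asm) prob_eq_1) (auto elim: AE_mp)
qed

text \<open>As many distinct points as the rank of z, all inside its range, fill that range; this
  turns mere deadlocks into an F-clique.\<close>

lemma deadlocked_map_K:
  assumes x: "deadlocked x" "length x = m_of \<mu>" and z: "z \<in> K"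
  shows "map z x \<in> W_mu \<mu>"
proof -
  have d: "distinct (map z x)" using x z K_subset_S unfolding deadlocked_def by blast
  have "card (set (map z x)) = card (range z)"
    using distinct_card[OF d] x(2) rank_K[OF z] by (metis length_map)
  then have "set (map z x) = range z" by (intro card_subset_eq) auto
  then show ?thesis using d x(2) z unfolding W_mu_iff length_map by blast
qed

lemma AE_W_mu: "AE \<omega> in M. X k \<omega> \<in> W_mu \<mu>"
proof -
  have "AE \<omega> in M. deadlocked (X j \<omega>)" for j by (rule AE_deadlocked)
  then have "AE \<omega> in M. \<forall>j. deadlocked (X j \<omega>)" by (simp add: AE_all_countable)
  with AE_regular AE_NT_K[of k] show ?thesis
  proof eventually_elim
    case (elim \<omega>)
    obtain n where n: "NT (k - int n) n \<omega> \<in> K" using elim(2) ..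
    have "X k \<omega> = map (NT (k - int n) n \<omega>) (X (k - int n) \<omega>)"
      using regular_NT[OF elim(1), of "k - int n" n] by simp
    moreover have "length (X (k - int n) \<omega>) = m_of \<mu>" using elim(1) unfolding regular_def by blast
    ultimately show ?case using deadlocked_map_K[OF spec[OF elim(3)] _ n] by (simp only:)
  qed
qed

section \<open>The almost surely constant invariant\<close>

definition good :: "'a \<Rightarrow> bool"
  where "good \<omega> \<longleftrightarrow> regular \<omega> \<and> (\<forall>k. X k \<omega> \<in> W_mu \<mu>) \<and> (\<forall>k. \<exists>n. NT (k - int n) n \<omega> \<in> K)"

lemma AE_good: "AE \<omega> in M. good \<omega>"
proof -
  have "AE \<omega> in M. \<forall>k. X k \<omega> \<in> W_mu \<mu>" "AE \<omega> in M. \<forall>k. \<exists>n. NT (k - int n) n \<omega> \<in> K"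
    using AE_W_mu AE_NT_K by (simp_all add: AE_all_countable)
  with AE_regular show ?thesis by eventually_elim (simp add: good_def)
qed

lemma goodD:
  assumes "good \<omega>"
  shows "regular \<omega>" "X k \<omega> \<in> W_mu \<mu>" "\<exists>n. NT (k - int n) n \<omega> \<in> K" "N k \<omega> \<in> set_pmf \<mu>" "N k \<omega> \<in> S"
    "X (k + 1) \<omega> = map (N (k + 1) \<omega>) (X k \<omega>)"
proof -
  show r: "regular \<omega>" "X k \<omega> \<in> W_mu \<mu>" "\<exists>n. NT (k - int n) n \<omega> \<in> K" using assms by (auto simp: good_def)
  show N: "N k \<omega> \<in> set_pmf \<mu>" using r(1) by (simp add: regular_def)
  then show "N k \<omega> \<in> S" using set_pow_in_S[of 1 \<mu>] by auto
  show "X (k + 1) \<omega> = map (N (k + 1) \<omega>) (X k \<omega>)" using r(1) unfolding regular_def by (metis add_diff_cancel_right')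
qed

lemma good_G_step:
  assumes "good \<omega>"
  shows "xG (X (k + 1) \<omega>) = (e \<circ> N (k + 1) \<omega> \<circ> xL (X k \<omega>)) \<circ> xG (X k \<omega>)"
    "e \<circ> N (k + 1) \<omega> \<circ> xL (X k \<omega>) \<in> carrier G"
    "xW (X (k + 1) \<omega>) = xW (X k \<omega>)"
    "ph (k + 1) (xG (X (k + 1) \<omega>)) = ph k (xG (X k \<omega>))"
proof -
  note g = goodD[OF assms]
  note x = comps_map[OF g(5) g(2), of "k + 1" k, folded g(6)]
  show "xG (X (k + 1) \<omega>) = (e \<circ> N (k + 1) \<omega> \<circ> xL (X k \<omega>)) \<circ> xG (X k \<omega>)"
    "e \<circ> N (k + 1) \<omega> \<circ> xL (X k \<omega>) \<in> carrier G" "xW (X (k + 1) \<omega>) = xW (X k \<omega>)" using x by blast+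
  obtain h where h: "h \<in> H" "e \<circ> N (k + 1) \<omega> \<circ> xL (X k \<omega>) = \<gamma> \<circ> h"
    using step_coset[OF g(4) comps_mem(1)[OF g(2)]] by blast
  show "ph (k + 1) (xG (X (k + 1) \<omega>)) = ph k (xG (X k \<omega>))"
    unfolding x(2) h(2) by (rule ph_step[OF comps_mem(2)[OF g(2)] h(1)])
qed

lemma int_step_const:
  assumes "\<And>k :: int. f (k + 1) = f k"
  shows "f k = f 0"
proof (induction k rule: int_induct[where k=0])
  case (step2 i)
  then show ?case using assms[of "i - 1"] by simp
qed (use assms in auto)

lemma good_invariants:
  assumes "good \<omega>"
  shows "xW (X k \<omega>) = xW (X 0 \<omega>)" "ph k (xG (X k \<omega>)) = ph 0 (xG (X 0 \<omega>))"
  using int_step_const[of "\<lambda>k. xW (X k \<omega>)" k] int_step_const[of "\<lambda>k. ph k (xG (X k \<omega>))" k]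
    good_G_step(3,4)[OF assms] by blast+

text \<open>The components below are made total by dummy values outside \<open>W_mu\<close>.\<close>

definition w0 where "w0 = (SOME w. w \<in> W)"

definition fW where "fW x = (if x \<in> W_mu \<mu> then xW x else w0)"

definition fP where "fP k x = (if x \<in> W_mu \<mu> then ph k (xG x) else e)"

definition fU where "fU x = (if x \<in> W_mu \<mu> then inv\<^bsub>G\<^esub> (Cp (xG x)) \<circ> xG x else e)"

text \<open>The pair of Y_C and Z_W of the theorem, read at time 0; on good paths every other time
  yields the same value (\<open>good_Y\<close>).\<close>

definition Y where "Y \<omega> = (fP 0 (X 0 \<omega>), fW (X 0 \<omega>))"

lemma fW_mem: "fW x \<in> W"
  unfolding fW_def w0_def using comps_mem(3) W_nonempty by (simp add: some_in_eq)

lemma e_C: "e \<in> C"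
  unfolding C_iff using p_pos by (intro exI[of _ 0]) simp

lemma fP_mem: "fP k x \<in> C"
  unfolding fP_def using ph_C comps_mem(2) e_C by simp

lemma fU_mem: "fU x \<in> H"
  unfolding fU_def using Cp_inv_H comps_mem(2) e_H by simp

lemma good_Y: "good \<omega> \<Longrightarrow> (fP k (X k \<omega>), fW (X k \<omega>)) = Y \<omega>"
  unfolding Y_def fP_def fW_def using goodD(2)[of \<omega>] good_invariants[of \<omega> k] by (simp only: if_True)

lemma good_Y': "good \<omega> \<Longrightarrow> Y \<omega> = (ph k (xG (X k \<omega>)), xW (X k \<omega>))"
  using good_Y[of \<omega> k] goodD(2)[of \<omega> k] unfolding fP_def fW_def by (simp only: if_True)

lemma Y_measurable: "Y \<in> measurable M (count_space UNIV)"
  using measurable_compose[OF X_measurable[of 0], of "\<lambda>x. (fP 0 x, fW x)" "count_space UNIV"] by (simp add: Y_def[abs_def])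

lemma Y_mem: "Y \<omega> \<in> C \<times> W"
  unfolding Y_def using fP_mem fW_mem by simp

lemma finite_CW: "finite (C \<times> W)"
  using finite_W by simp

text \<open>The value of \<open>Y\<close> on the event \<open>X\<^bsub>k\<^esub> = x\<close>.\<close>

definition yv where "yv k x = (ph k (xG x), xW x)"

section \<open>The law of the state given the remote past\<close>

lemma pmf_act_return: "pmf (\<rho> \<triangleright> return_pmf y) x = measure (measure_pmf \<rho>) {f. map f y = x}"
proof -
  have "\<rho> \<triangleright> return_pmf y = map_pmf (\<lambda>f. map f y) \<rho>"
    by (simp add: act_eq_bind map_pmf_def bind_return_pmf)
  then show ?thesis by (simp add: pmf_map vimage_def)
qed

text \<open>A remote event precedes every block of noise, so even jointly with the state at the
  start of the block it is independent of the block. Replacing the law of the block by \<eta> costs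
  a vanishing error, since the weights \<open>t n y\<close> are bounded by 1.\<close>

lemma remote_past_law:
  assumes A: "A \<in> remote_past M X" and x: "x \<in> W_mu \<mu>"
  shows "prob (A \<inter> {\<omega> \<in> space M. X k \<omega> = x}) = kap x * prob (A \<inter> {\<omega> \<in> space M. Y \<omega> = yv k x})"
proof -
  \<comment> \<open>Going back by multiples of \<open>Q\<close>, the law of the block tends to
    \<eta> and the clock returns to the same phase (\<open>ph_period\<close>).\<close>
  define j where "j n = k - int (Q * n)" for n
  have AF: "A \<in> sets (F i)" for i using A past_X_F unfolding remote_past_def by blast
  have Aev: "A \<in> events" using AF F_events by blast
  have AX: "A \<inter> {\<omega> \<in> space M. X i \<omega> = y} \<in> sets (F i)" for i y
    using AF sets_Collect_F[OF measurable_F(1)[of i i], of "\<lambda>x. x = y"] by (intro sets.Int) auto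
  have AXe: "A \<inter> {\<omega> \<in> space M. X i \<omega> = y} \<in> events" for i y by (rule subsetD[OF F_events AX])
  have Xe: "{\<omega> \<in> space M. X i \<omega> = y} \<in> events" for i y by (rule sets_Collect_M[OF X_measurable])
  have AY: "A \<inter> {\<omega> \<in> space M. Y \<omega> = yv k x} \<in> events"
    using Aev sets_Collect_M[OF Y_measurable] by (intro sets.Int)
  define t where "t n y = prob (A \<inter> {\<omega> \<in> space M. X (j n) \<omega> = y})" for n y
  define \<phi> where "\<phi> n y = pmf (conv_pow \<mu> (Q * n) \<triangleright> return_pmf y) x" for n y
  define \<psi> where "\<psi> y = pmf (\<eta> \<triangleright> return_pmf y) x" for y
  have t: "0 \<le> t n y" "t n y \<le> 1" for n y by (simp_all add: t_def)
  have main: "prob (A \<inter> {\<omega> \<in> space M. X k \<omega> = x}) = (\<Sum>y\<in>W_mu \<mu>. t n y * \<phi> n y)" for n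
  proof -
    have "prob (A \<inter> {\<omega> \<in> space M. X k \<omega> = x}) =
        (\<Sum>y\<in>W_mu \<mu>. prob (A \<inter> {\<omega> \<in> space M. X k \<omega> = x} \<inter> {\<omega> \<in> space M. X (j n) \<omega> = y}))"
      by (intro prob_partition finite_W_mu AE_W_mu X_measurable AXe)
    also have "\<dots> = (\<Sum>y\<in>W_mu \<mu>. prob (A \<inter> {\<omega> \<in> space M. X (j n) \<omega> = y} \<inter> {\<omega> \<in> space M. map (NT (j n) (Q * n) \<omega>) y = x}))"
    proof (intro sum.cong refl finite_measure_eq_AE)
      fix y
      show "AE \<omega> in M. (\<omega> \<in> A \<inter> {\<omega> \<in> space M. X k \<omega> = x} \<inter> {\<omega> \<in> space M. X (j n) \<omega> = y}) =
          (\<omega> \<in> A \<inter> {\<omega> \<in> space M. X (j n) \<omega> = y} \<inter> {\<omega> \<in> space M. map (NT (j n) (Q * n) \<omega>) y = x})"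
        using AE_regular
      proof eventually_elim
        case (elim \<omega>)
        have "X k \<omega> = map (NT (j n) (Q * n) \<omega>) (X (j n) \<omega>)"
          using regular_NT[OF elim, of "j n" "Q * n"] by (simp add: j_def)
        then show ?case by auto
      qed
      show "A \<inter> {\<omega> \<in> space M. X k \<omega> = x} \<inter> {\<omega> \<in> space M. X (j n) \<omega> = y} \<in> events"
        by (intro sets.Int[OF AXe Xe])
      show "A \<inter> {\<omega> \<in> space M. X (j n) \<omega> = y} \<inter> {\<omega> \<in> space M. map (NT (j n) (Q * n) \<omega>) y = x} \<in> events"
        using sets.Int[OF AXe sets_Collect_M[OF NT_M, of "\<lambda>z. map z y = x"]] .
    qed
    also have "\<dots> = (\<Sum>y\<in>W_mu \<mu>. t n y * \<phi> n y)"
      unfolding t_def \<phi>_def pmf_act_return by (intro sum.cong refl prob_NT_F_Collect AX)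
    finally show ?thesis .
  qed
  \<comment> \<open>Against the limit kernel the state at \<open>j n\<close> counts only through its
    invariant, which is \<open>Y\<close>; so this sum is the same for all n, whether or not the laws
    of \<open>X (j n)\<close> converge.\<close>
  have limit: "(\<Sum>y\<in>W_mu \<mu>. t n y * \<psi> y) = kap x * prob (A \<inter> {\<omega> \<in> space M. Y \<omega> = yv k x})" for n
  proof -
    have "prob (A \<inter> {\<omega> \<in> space M. Y \<omega> = yv k x}) =
        (\<Sum>y\<in>W_mu \<mu>. prob (A \<inter> {\<omega> \<in> space M. Y \<omega> = yv k x} \<inter> {\<omega> \<in> space M. X (j n) \<omega> = y}))"
      by (intro prob_partition finite_W_mu AE_W_mu X_measurable AY)
    also have "\<dots> = (\<Sum>y\<in>W_mu \<mu>. of_bool (xW x = xW y \<and> Cp (xG x) = Cp (xG y)) * t n y)"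
    proof (rule sum.cong[OF refl])
      fix y assume y: "y \<in> W_mu \<mu>"
      have "prob (A \<inter> {\<omega> \<in> space M. Y \<omega> = yv k x} \<inter> {\<omega> \<in> space M. X (j n) \<omega> = y}) =
          prob (if yv k x = yv k y then A \<inter> {\<omega> \<in> space M. X (j n) \<omega> = y} else {})"
      proof (rule finite_measure_eq_AE)
        show "AE \<omega> in M. (\<omega> \<in> A \<inter> {\<omega> \<in> space M. Y \<omega> = yv k x} \<inter> {\<omega> \<in> space M. X (j n) \<omega> = y}) =
          (\<omega> \<in> (if yv k x = yv k y then A \<inter> {\<omega> \<in> space M. X (j n) \<omega> = y} else {}))"
          using AE_good
        proof eventually_elim
          case (elim \<omega>)
          have "Y \<omega> = yv k y" if "X (j n) \<omega> = y"
            using good_Y'[OF elim, of "j n"] ph_period[OF comps_mem(2)[OF y], of k n] that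
            by (simp add: yv_def j_def del: of_nat_mult)
          then show ?case by auto
        qed
        show "A \<inter> {\<omega> \<in> space M. Y \<omega> = yv k x} \<inter> {\<omega> \<in> space M. X (j n) \<omega> = y} \<in> events"
          by (intro sets.Int[OF AY Xe])
        show "(if yv k x = yv k y then A \<inter> {\<omega> \<in> space M. X (j n) \<omega> = y} else {}) \<in> events"
          using AXe by simp
      qed
      moreover have "yv k x = yv k y \<longleftrightarrow> xW x = xW y \<and> Cp (xG x) = Cp (xG y)"
        unfolding yv_def using ph_eq_iff[OF comps_mem(2)[OF x] comps_mem(2)[OF y]] by auto
      ultimately show "prob (A \<inter> {\<omega> \<in> space M. Y \<omega> = yv k x} \<inter> {\<omega> \<in> space M. X (j n) \<omega> = y}) =
          of_bool (xW x = xW y \<and> Cp (xG x) = Cp (xG y)) * t n y" by (simp add: t_def)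
    qed
    finally have "kap x * prob (A \<inter> {\<omega> \<in> space M. Y \<omega> = yv k x}) =
        (\<Sum>y\<in>W_mu \<mu>. kap x * (of_bool (xW x = xW y \<and> Cp (xG x) = Cp (xG y)) * t n y))"
      by (simp only: sum_distrib_left)
    also have "\<dots> = (\<Sum>y\<in>W_mu \<mu>. t n y * \<psi> y)"
      unfolding \<psi>_def using x by (intro sum.cong refl) (simp add: pmf_eta_act kap_def)
    finally show ?thesis by simp
  qed
  have diff: "(\<lambda>n. \<Sum>y\<in>W_mu \<mu>. t n y * \<phi> n y - t n y * \<psi> y) \<longlonglongrightarrow> (\<Sum>y\<in>W_mu \<mu>. 0)"
  proof (rule tendsto_sum)
    fix y
    have "(\<lambda>n. \<phi> n y) \<longlonglongrightarrow> \<psi> y"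
      unfolding \<phi>_def \<psi>_def pmf_act_return by (rule tendsto_measure_pmf[OF Q_lim])
    then have "(\<lambda>n. \<bar>\<phi> n y - \<psi> y\<bar>) \<longlonglongrightarrow> 0" by (simp add: LIM_zero tendsto_rabs_zero)
    then show "(\<lambda>n. t n y * \<phi> n y - t n y * \<psi> y) \<longlonglongrightarrow> 0"
    proof (rule Lim_null_comparison[rotated], intro always_eventually allI)
      fix n
      show "norm (t n y * \<phi> n y - t n y * \<psi> y) \<le> \<bar>\<phi> n y - \<psi> y\<bar>"
        using mult_right_mono[OF t(2)[of n y], of "\<bar>\<phi> n y - \<psi> y\<bar>"] t(1)[of n y]
        by (simp add: abs_mult flip: right_diff_distrib)
    qed
  qed
  \<comment> \<open>The difference is constant in n and tends to 0, hence it is 0.\<close>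
  have "(\<lambda>n. \<Sum>y\<in>W_mu \<mu>. t n y * \<phi> n y - t n y * \<psi> y) =
      (\<lambda>n. prob (A \<inter> {\<omega> \<in> space M. X k \<omega> = x}) - kap x * prob (A \<inter> {\<omega> \<in> space M. Y \<omega> = yv k x}))"
    by (rule ext) (simp only: sum_subtractf main[symmetric] limit)
  with diff show ?thesis by (simp add: LIMSEQ_const_iff)
qed

end

section \<open>Phases as powers of \<gamma> and evaluation of the phase sum\<close>

context phased
begin

lemma ph_eq_power_iff:
  assumes g: "g \<in> carrier G" and r: "r < p"
  shows "inv\<^bsub>G\<^esub> (\<gamma> [^]\<^bsub>G\<^esub> (k + int r)) \<circ> g \<in> H \<longleftrightarrow> ph k g = \<gamma> [^]\<^bsub>G\<^esub> r"
proof -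
  let ?c = "\<gamma> [^]\<^bsub>G\<^esub> r" and ?g = "inv\<^bsub>G\<^esub> (\<gamma> [^]\<^bsub>G\<^esub> k) \<circ> g"
  have c: "?c \<in> C" "?c \<in> carrier G" using r C_iff C_subset by blast+
  have g': "?g \<in> carrier G" using g by (intro G_comp G.inv_closed gamma_pow_G)
  have "\<gamma> [^]\<^bsub>G\<^esub> (k + int r) = \<gamma> [^]\<^bsub>G\<^esub> k \<circ> ?c"
    using G.int_pow_mult[OF gamma_G, of k "int r"] by (simp add: int_pow_int)
  then have "inv\<^bsub>G\<^esub> (\<gamma> [^]\<^bsub>G\<^esub> (k + int r)) = inv\<^bsub>G\<^esub> ?c \<circ> inv\<^bsub>G\<^esub> (\<gamma> [^]\<^bsub>G\<^esub> k)"
    using G.inv_mult_group[OF gamma_pow_G[of k] c(2)] by simp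
  then have eq: "inv\<^bsub>G\<^esub> (\<gamma> [^]\<^bsub>G\<^esub> (k + int r)) \<circ> g = inv\<^bsub>G\<^esub> ?c \<circ> ?g" by (simp only: comp_assoc)
  show ?thesis unfolding eq ph_def
  proof
    assume h: "inv\<^bsub>G\<^esub> ?c \<circ> ?g \<in> H"
    have "?c \<circ> (inv\<^bsub>G\<^esub> ?c \<circ> ?g) = (?c \<circ> inv\<^bsub>G\<^esub> ?c) \<circ> ?g" by (simp only: comp_assoc)
    then have "?c \<circ> (inv\<^bsub>G\<^esub> ?c \<circ> ?g) = ?g"
      by (simp only: G_inv_comp(2)[OF c(2)] G_unit(1)[OF g'])
    then show "Cp ?g = ?c" using Cp_eqI[OF c(1) h] by (simp only:)
  next
    assume "Cp ?g = ?c"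
    then show "inv\<^bsub>G\<^esub> ?c \<circ> ?g \<in> H" using Cp_inv_H[OF g'] by (simp only:)
  qed
qed

lemma gamma_pow_inj: "inj_on (\<lambda>r :: nat. \<gamma> [^]\<^bsub>G\<^esub> r) {..<p}"
  using gamma_bij by (auto simp: bij_betw_def inj_on_def)

text \<open>Powers of \<gamma> below \<open>p\<close> represent distinct cosets, so only the summand
  with the phase of x can charge it.\<close>

lemma phase_sum:
  assumes \<Lambda>W: "\<And>r. r < p \<Longrightarrow> set_pmf (\<Lambda>W r) \<subseteq> W"
    and x: "x \<in> W_mu \<mu>" and r: "r < p" "ph k (xG x) = \<gamma> [^]\<^bsub>G\<^esub> r"
  shows "(\<Sum>s<p. \<alpha> s * pmf (etaL_of \<mu> e \<star> return_pmf (\<gamma> [^]\<^bsub>G\<^esub> (k + int s)) \<star> pmf_of_set H \<triangleright> \<Lambda>W s) x) =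
    kap x * (\<alpha> r * pmf (\<Lambda>W r) (xW x))"
proof -
  have "(\<Sum>s<p. \<alpha> s * pmf (etaL_of \<mu> e \<star> return_pmf (\<gamma> [^]\<^bsub>G\<^esub> (k + int s)) \<star> pmf_of_set H \<triangleright> \<Lambda>W s) x) =
      (\<Sum>s<p. if s = r then kap x * (\<alpha> r * pmf (\<Lambda>W r) (xW x)) else 0)"
  proof (rule sum.cong[OF refl])
    fix s assume "s \<in> {..<p}"
    then have s: "s < p" by simp
    have "inv\<^bsub>G\<^esub> (\<gamma> [^]\<^bsub>G\<^esub> (k + int s)) \<circ> xG x \<in> H \<longleftrightarrow> s = r"
      unfolding ph_eq_power_iff[OF comps_mem(2)[OF x] s] r(2) using gamma_pow_inj s r(1) by (auto simp: inj_on_def)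
    then show "\<alpha> s * pmf (etaL_of \<mu> e \<star> return_pmf (\<gamma> [^]\<^bsub>G\<^esub> (k + int s)) \<star> pmf_of_set H \<triangleright> \<Lambda>W s) x =
        (if s = r then kap x * (\<alpha> r * pmf (\<Lambda>W r) (xW x)) else 0)"
      unfolding pmf_law_W[OF gamma_pow_G \<Lambda>W[OF s]] using x by (simp add: kap_def del: comp_apply)
  qed
  then show ?thesis using r(1) by simp
qed

lemma ph_power:
  assumes "g \<in> carrier G"
  obtains r where "r < p" "ph k g = \<gamma> [^]\<^bsub>G\<^esub> r"
  using ph_C[OF assms] unfolding C_iff by blast

end

text \<open>Subfamilies reduce to triples by filling the missing indices with the whole space, which
  lies in each family and has probability 1.\<close>

lemma (in prob_space) indep_sets3I:
  assumes ev: "F0 \<subseteq> events" "F1 \<subseteq> events" "F2 \<subseteq> events"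
    and sp: "space M \<in> F0" "space M \<in> F1" "space M \<in> F2"
    and prod: "\<And>a b c. a \<in> F0 \<Longrightarrow> b \<in> F1 \<Longrightarrow> c \<in> F2 \<Longrightarrow> prob (a \<inter> b \<inter> c) = prob a * prob b * prob c"
  shows "indep_sets (\<lambda>i. [F0, F1, F2] ! i) {..<3 :: nat}"
proof (rule indep_setsI)
  have three: "{..<3 :: nat} = {0, 1, 2}" by auto
  show "[F0, F1, F2] ! i \<subseteq> events" if "i \<in> {..<3}" for i
    using that ev unfolding three by auto
  fix A and J :: "nat set"
  assume J: "J \<noteq> {}" "J \<subseteq> {..<3}" "finite J" and A: "\<forall>j\<in>J. A j \<in> [F0, F1, F2] ! j"
  define B where "B i = (if i \<in> J then A i else space M)" for i
  have B: "B 0 \<in> F0" "B 1 \<in> F1" "B 2 \<in> F2" using A sp by (auto simp: B_def)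
  have "A j \<subseteq> space M" if "j \<in> J" for j
  proof -
    have "j = 0 \<or> j = 1 \<or> j = 2" using that J(2) unfolding three by auto
    then have "[F0, F1, F2] ! j \<subseteq> events" using ev by auto
    then have "A j \<in> events" using A that by blast
    then show ?thesis by (rule sets.sets_into_space)
  qed
  then have "(\<Inter>j\<in>J. A j) \<subseteq> space M" using J(1) by blast
  then have "(\<Inter>j\<in>J. A j) \<subseteq> B i" for i by (cases "i \<in> J") (auto simp: B_def)
  moreover have "(\<Inter>i\<in>{..<3}. B i) \<subseteq> (\<Inter>j\<in>J. A j)"
  proof (rule INT_greatest)
    fix j assume "j \<in> J"
    then have "A j = B j" "j \<in> {..<3}" using J(2) by (auto simp: B_def)
    then show "(\<Inter>i\<in>{..<3}. B i) \<subseteq> A j" by blast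
  qed
  ultimately have "(\<Inter>j\<in>J. A j) = (\<Inter>i\<in>{..<3}. B i)" by blast
  also have "\<dots> = B 0 \<inter> B 1 \<inter> B 2" unfolding three by auto
  finally have "prob (\<Inter>j\<in>J. A j) = prob (B 0) * prob (B 1) * prob (B 2)" using prod[OF B] by simp
  also have "\<dots> = (\<Prod>i\<in>{..<3}. prob (B i))" unfolding three by (simp add: mult.assoc)
  also have "\<dots> = (\<Prod>i\<in>J. prob (A i))"
    using J(2) by (intro prod.mono_neutral_cong_right) (auto simp: B_def prob_space)
  finally show "prob (\<Inter>j\<in>J. A j) = (\<Prod>j\<in>J. prob (A j))" .
qed

context clique_evolution
begin

lemma past_X_events: "past M X k \<subseteq> events"
  unfolding past_def by (rule sigma_family_events) simp

lemma remote_past_events: "remote_past M X \<subseteq> events"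
  using past_X_events unfolding remote_past_def by blast

lemma remote_past_F: "A \<in> remote_past M X \<Longrightarrow> A \<in> sets (F k)"
  using past_X_F unfolding remote_past_def by blast

lemma past_eq_sets: "past M Z k = sets (family_measure M {..k} Z)"
  by (simp add: past_def)

lemma space_remote: "space M \<in> remote_past M X"
  unfolding remote_past_def past_eq_sets using sets.top[of "family_measure M {.._} X"] by simp

lemma prob_X: "x \<in> W_mu \<mu> \<Longrightarrow> prob {\<omega> \<in> space M. X k \<omega> = x} = kap x * prob {\<omega> \<in> space M. Y \<omega> = yv k x}"
  using remote_past_law[OF space_remote, of x k] by (simp add: Int_def)

subsection \<open>Uniformity and independence of the residual\<close>

text \<open>Right multiplication of the \<open>G\<close>-component by h; it commutes with the left
  multiplications by which the maps of the semigroup act, and it stays in the coset.\<close>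

definition shift :: "('v \<Rightarrow> 'v) \<Rightarrow> 'v list \<Rightarrow> 'v list"
  where "shift h x = map (xL x \<circ> (xG x \<circ> h)) (xW x)"

lemma shift_comps:
  assumes x: "x \<in> W_mu \<mu>" and h: "h \<in> H"
  shows "shift h x \<in> W_mu \<mu>" "xL (shift h x) = xL x" "xG (shift h x) = xG x \<circ> h" "xW (shift h x) = xW x"
    "kap (shift h x) = kap x" "yv k (shift h x) = yv k x"
proof -
  note c = comps_mem[OF x]
  have g: "xG x \<circ> h \<in> carrier G" by (rule G_comp[OF c(2) H_G[OF h]])
  show "shift h x \<in> W_mu \<mu>" and s: "xL (shift h x) = xL x" "xG (shift h x) = xG x \<circ> h" "xW (shift h x) = xW x"
    unfolding shift_def using LGW_mem[OF c(1) g c(3)] LGW_comps[OF c(1) g c(3)] by blast+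
  show "kap (shift h x) = kap x" unfolding kap_def s ..
  show "yv k (shift h x) = yv k x"
    unfolding yv_def s using ph_eq_iff[OF g c(2), of k] Cp_comp_H[OF c(2) h] by simp
qed

lemma shift_bij:
  assumes h: "h \<in> H"
  shows "bij_betw (shift h) (W_mu \<mu>) (W_mu \<mu>)"
proof -
  have inverse: "shift (inv\<^bsub>G\<^esub> k) (shift k x) = x" if x: "x \<in> W_mu \<mu>" and k: "k \<in> H" for x k
  proof -
    note s = shift_comps[OF x k] and c = comps_mem[OF x]
    have "xG x \<circ> k \<circ> inv\<^bsub>G\<^esub> k = xG x \<circ> (k \<circ> inv\<^bsub>G\<^esub> k)" by (simp only: comp_assoc)
    then have "xG x \<circ> k \<circ> inv\<^bsub>G\<^esub> k = xG x" by (simp only: G_inv_comp(2)[OF H_G[OF k]] G_unit(2)[OF c(2)])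
    then show ?thesis unfolding shift_def[of "inv\<^bsub>G\<^esub> k"] s by (simp only: c(4))
  qed
  show ?thesis
  proof (rule bij_betw_byWitness[where f'="shift (inv\<^bsub>G\<^esub> h)"])
    show "\<forall>x\<in>W_mu \<mu>. shift (inv\<^bsub>G\<^esub> h) (shift h x) = x" using inverse h by blast
    show "\<forall>x\<in>W_mu \<mu>. shift h (shift (inv\<^bsub>G\<^esub> h) x) = x"
      using inverse[OF _ H_inv[OF h]] G.inv_inv[OF H_G[OF h]] by simp
    show "shift h ` W_mu \<mu> \<subseteq> W_mu \<mu>" using shift_comps(1) h by blast
    show "shift (inv\<^bsub>G\<^esub> h) ` W_mu \<mu> \<subseteq> W_mu \<mu>" using shift_comps(1) H_inv[OF h] by blast
  qed
qed

text \<open>z contributes a left factor that depends on z and the L-component only, and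
  \<open>shift\<close> keeps the latter. The case \<open>z = id\<close> serves blocks of length
  0.\<close>

lemma fU_shift:
  assumes z: "z \<in> S \<or> z = id" and x: "x \<in> W_mu \<mu>" and h: "h \<in> H"
  shows "fU (map z (shift h x)) = fU (map z x) \<circ> h"
proof -
  note s = shift_comps[OF x h]
  have mem: "map z x \<in> W_mu \<mu>" "map z (shift h x) \<in> W_mu \<mu>"
    using z W_mu_map x s(1) by auto
  have "xG (map z (shift h x)) = xG (map z x) \<circ> h"
    using z
  proof
    assume z: "z \<in> S"
    show ?thesis unfolding comps_map(2)[OF z x] comps_map(2)[OF z s(1)] s by (simp only: comp_assoc)
  qed (simp add: s)
  then show ?thesis
    using mem Cp_comp_H[OF comps_mem(2)[OF mem(1)] h] unfolding fU_def by (simp only: if_True comp_assoc)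
qed

text \<open>The maps \<open>shift h\<close> preserve the law of \<open>X\<^bsub>j\<^esub>\<close> given the remote past and translate \<open>fU\<close> at all later times,
  so averaging over \<open>h \<in> H\<close> makes \<open>fU (X\<^bsub>k\<^esub>)\<close> uniform whatever the noise is.\<close>

lemma residual_uniform:
  assumes A: "A \<in> remote_past M X" and u: "u \<in> H" and k: "j \<le> k" "k \<le> k'"
  shows "prob (A \<inter> {\<omega> \<in> space M. P (NW j k' \<omega>)} \<inter> {\<omega> \<in> space M. fU (X k \<omega>) = u}) =
    prob A * prob {\<omega> \<in> space M. P (NW j k' \<omega>)} / card H"
proof -
  define n where "n = nat (k - j)"
  have n: "j + int n = k" using k by (simp add: n_def)
  define T where "T \<phi> = trajectory j n \<phi>" for \<phi> :: "int \<Rightarrow> 'v \<Rightarrow> 'v"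
  have T: "T (NW j k' \<omega>) = NT j n \<omega>" for \<omega> unfolding T_def using n k by (intro NT_NW) simp
  define a where "a x = prob (A \<inter> {\<omega> \<in> space M. X j \<omega> = x})" for x
  define b where "b x = prob {\<omega> \<in> space M. P (NW j k' \<omega>) \<and> fU (map (T (NW j k' \<omega>)) x) = u}" for x
  have NWe: "{\<omega> \<in> space M. R (NW j k' \<omega>)} \<in> events" for R by (rule sets_Collect_M[OF NW_M])
  have AF: "A \<in> sets (F j)" by (rule remote_past_F[OF A])
  have Aev: "A \<in> events" using A remote_past_events by blast
  have AX: "A \<inter> {\<omega> \<in> space M. X j \<omega> = x} \<in> sets (F j)" for x
    using AF sets_Collect_F[OF measurable_F(1)[of j j], of "\<lambda>y. y = x"] by (intro sets.Int) auto
  have Ue: "{\<omega> \<in> space M. fU (X k \<omega>) = u} \<in> events" by (rule sets_Collect_M[OF X_measurable])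
  let ?E = "A \<inter> {\<omega> \<in> space M. P (NW j k' \<omega>)} \<inter> {\<omega> \<in> space M. fU (X k \<omega>) = u}"
  have Ee: "?E \<in> events" using Aev NWe Ue by (intro sets.Int)
  have Xe: "{\<omega> \<in> space M. X j \<omega> = x} \<in> events" for x by (rule sets_Collect_M[OF X_measurable])
  have "prob ?E = (\<Sum>x\<in>W_mu \<mu>. prob (?E \<inter> {\<omega> \<in> space M. X j \<omega> = x}))"
    by (intro prob_partition finite_W_mu AE_W_mu X_measurable Ee)
  also have "\<dots> = (\<Sum>x\<in>W_mu \<mu>. a x * b x)"
  proof (rule sum.cong[OF refl])
    fix x
    have "prob (?E \<inter> {\<omega> \<in> space M. X j \<omega> = x}) =
        prob (A \<inter> {\<omega> \<in> space M. X j \<omega> = x} \<inter> {\<omega> \<in> space M. P (NW j k' \<omega>) \<and> fU (map (T (NW j k' \<omega>)) x) = u})"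
    proof (rule finite_measure_eq_AE)
      show "AE \<omega> in M. (\<omega> \<in> ?E \<inter> {\<omega> \<in> space M. X j \<omega> = x}) = (\<omega> \<in> A \<inter> {\<omega> \<in> space M. X j \<omega> = x} \<inter>
          {\<omega> \<in> space M. P (NW j k' \<omega>) \<and> fU (map (T (NW j k' \<omega>)) x) = u})"
        using AE_regular
      proof eventually_elim
        case (elim \<omega>)
        have "X k \<omega> = map (T (NW j k' \<omega>)) (X j \<omega>)"
          using regular_NT[OF elim, of j n] by (simp only: n T)
        then show ?case by auto
      qed
      show "?E \<inter> {\<omega> \<in> space M. X j \<omega> = x} \<in> events" by (intro sets.Int[OF Ee Xe])
      show "A \<inter> {\<omega> \<in> space M. X j \<omega> = x} \<inter> {\<omega> \<in> space M. P (NW j k' \<omega>) \<and> fU (map (T (NW j k' \<omega>)) x) = u} \<in> events"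
        using NWe[of "\<lambda>\<phi>. P \<phi> \<and> fU (map (T \<phi>) x) = u"] by (intro sets.Int Aev Xe)
    qed
    also have "\<dots> = a x * b x"
      unfolding a_def b_def by (rule prob_NW[OF AX, of x "\<lambda>\<phi>. P \<phi> \<and> fU (map (T \<phi>) x) = u"])
    finally show "prob (?E \<inter> {\<omega> \<in> space M. X j \<omega> = x}) = a x * b x" .
  qed
  finally have sum: "prob ?E = (\<Sum>x\<in>W_mu \<mu>. a x * b x)" .
  have a_shift: "a (shift h x) = a x" if "x \<in> W_mu \<mu>" "h \<in> H" for x h
    unfolding a_def using remote_past_law[OF A] shift_comps[OF that] that by simp
  \<comment> \<open>For each path of the noise exactly one h brings the residual to u, namely
    \<open>Z\<close>; so the events for h in \<open>H\<close> split the noise event into disjoint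
    parts.\<close>
  have b_sum: "(\<Sum>h\<in>H. b (shift h x)) = prob {\<omega> \<in> space M. P (NW j k' \<omega>)}" if x: "x \<in> W_mu \<mu>" for x
  proof -
    define Z where "Z \<omega> = inv\<^bsub>G\<^esub> (fU (map (T (NW j k' \<omega>)) x)) \<circ> u" for \<omega>
    have Z_H: "Z \<omega> \<in> H" for \<omega> unfolding Z_def using H_comp[OF H_inv[OF fU_mem] u] .
    have Z: "Z \<in> measurable M (count_space UNIV)"
      using measurable_discrete1[OF NW_M, where F="\<lambda>\<phi>. inv\<^bsub>G\<^esub> (fU (map (T \<phi>) x)) \<circ> u"] by (simp only: Z_def[abs_def])
    have Z_iff: "Z \<omega> = h \<longleftrightarrow> fU (map (T (NW j k' \<omega>)) x) \<circ> h = u" if h: "h \<in> H" for \<omega> h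
    proof -
      let ?v = "fU (map (T (NW j k' \<omega>)) x)"
      have v: "?v \<in> carrier G" by (rule H_G[OF fU_mem])
      have u': "e \<circ> u = u" "e \<circ> h = h" using G_unit(1)[OF H_G[OF u]] G_unit(1)[OF H_G[OF h]] by blast+
      show ?thesis unfolding Z_def using G_inv_comp[OF v] u' by (metis comp_assoc)
    qed
    have "prob {\<omega> \<in> space M. P (NW j k' \<omega>)} =
        (\<Sum>h\<in>H. prob ({\<omega> \<in> space M. P (NW j k' \<omega>)} \<inter> {\<omega> \<in> space M. Z \<omega> = h}))"
      using Z_H by (intro prob_partition Z NWe) auto
    also have "\<dots> = (\<Sum>h\<in>H. b (shift h x))"
      unfolding b_def
    proof (intro sum.cong refl finite_measure_eq_AE)
      fix h assume h: "h \<in> H"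
      show "AE \<omega> in M. (\<omega> \<in> {\<omega> \<in> space M. P (NW j k' \<omega>)} \<inter> {\<omega> \<in> space M. Z \<omega> = h}) =
          (\<omega> \<in> {\<omega> \<in> space M. P (NW j k' \<omega>) \<and> fU (map (T (NW j k' \<omega>)) (shift h x)) = u})"
        using AE_regular
      proof eventually_elim
        case (elim \<omega>)
        have "T (NW j k' \<omega>) \<in> S \<or> T (NW j k' \<omega>) = id"
          unfolding T using NT_S[OF elim, of n j] by (cases "n = 0") simp_all
        from fU_shift[OF this x h] show ?case using Z_iff[OF h, of \<omega>] by auto
      qed
      show "{\<omega> \<in> space M. P (NW j k' \<omega>)} \<inter> {\<omega> \<in> space M. Z \<omega> = h} \<in> events"
        by (intro sets.Int NWe sets_Collect_M[OF Z])
      show "{\<omega> \<in> space M. P (NW j k' \<omega>) \<and> fU (map (T (NW j k' \<omega>)) (shift h x)) = u} \<in> events"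
        by (rule NWe[of "\<lambda>\<phi>. P \<phi> \<and> fU (map (T \<phi>) (shift h x)) = u"])
    qed
    finally show ?thesis by simp
  qed
  \<comment> \<open>Averaging over \<open>H\<close>: every shift permutes \<open>W_mu \<mu>\<close>
    and preserves the weights \<open>a\<close>, so reindexing by it leaves the sum
    unchanged.\<close>
  have "card H * prob ?E = (\<Sum>h\<in>H. \<Sum>x\<in>W_mu \<mu>. a x * b x)" by (simp add: sum)
  also have "\<dots> = (\<Sum>h\<in>H. \<Sum>x\<in>W_mu \<mu>. a (shift h x) * b (shift h x))"
    by (intro sum.cong refl sum.reindex_bij_betw[OF shift_bij, symmetric])
  also have "\<dots> = (\<Sum>h\<in>H. \<Sum>x\<in>W_mu \<mu>. a x * b (shift h x))"
    by (intro sum.cong refl) (simp only: a_shift)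
  also have "\<dots> = (\<Sum>x\<in>W_mu \<mu>. a x * (\<Sum>h\<in>H. b (shift h x)))"
    by (subst sum.swap) (simp only: sum_distrib_left)
  also have "\<dots> = (\<Sum>x\<in>W_mu \<mu>. a x) * prob {\<omega> \<in> space M. P (NW j k' \<omega>)}"
    by (simp add: b_sum sum_distrib_right)
  also have "(\<Sum>x\<in>W_mu \<mu>. a x) = prob A"
    unfolding a_def by (rule prob_partition[symmetric, OF finite_W_mu AE_W_mu X_measurable Aev])
  finally have "prob ?E * card H = prob A * prob {\<omega> \<in> space M. P (NW j k' \<omega>)}"
    by (simp only: mult.commute)
  then show ?thesis using card_H_pos e_H by (subst nonzero_eq_divide_eq) auto
qed

lemma fU_law: "distr M (count_space UNIV) (\<lambda>\<omega>. fU (X k \<omega>)) = measure_pmf (pmf_of_set H)"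
proof -
  have meas: "(\<lambda>\<omega>. fU (X k \<omega>)) \<in> measurable M (count_space UNIV)" by (rule measurable_discrete1[OF X_measurable])
  have point: "prob {\<omega> \<in> space M. fU (X k \<omega>) = u} = pmf (pmf_of_set H) u" for u
  proof (cases "u \<in> H")
    case True
    have "prob {\<omega> \<in> space M. fU (X k \<omega>) = u} = 1 / card H"
      using residual_uniform[OF space_remote True, of k k k "\<lambda>_. True"] by (simp add: prob_space Int_def)
    then show ?thesis using True by (subst pmf_of_set) auto
  next
    case False
    then have "{\<omega> \<in> space M. fU (X k \<omega>) = u} = {}" using fU_mem by blast
    moreover have "pmf (pmf_of_set H) u = 0" using False by (simp add: pmf_eq_0_set_pmf set_H)
    ultimately show ?thesis by (simp only: measure_empty)
  qed
  show ?thesis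
  proof (rule measure_eqI_finite[where A=UNIV])
    fix u :: "'v \<Rightarrow> 'v"
    have "emeasure (distr M (count_space UNIV) (\<lambda>\<omega>. fU (X k \<omega>))) {u} = emeasure M {\<omega> \<in> space M. fU (X k \<omega>) = u}"
      by (subst emeasure_distr[OF meas]) (auto intro: arg_cong[where f="emeasure M"])
    then show "emeasure (distr M (count_space UNIV) (\<lambda>\<omega>. fU (X k \<omega>))) {u} = emeasure (measure_pmf (pmf_of_set H)) {u}"
      by (simp only: emeasure_eq_measure point emeasure_pmf_single)
  qed auto
qed

subsection \<open>One-dimensional laws\<close>

text \<open>In \<open>prob_X\<close> the L-component enters only through the factor from \<eta>^L.
  Summing over the other two components gives this factor times a constant free of l, and total mass
  1 makes the constant 1.\<close>

lemma xL_point: "prob {\<omega> \<in> space M. xL (X k \<omega>) = l} = pmf (etaL_of \<mu> e) l"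
proof -
  have meas: "(\<lambda>\<omega>. xL (X k \<omega>)) \<in> measurable M (count_space UNIV)" by (rule measurable_discrete1[OF X_measurable])
  have ev: "{\<omega> \<in> space M. xL (X k \<omega>) = l} \<in> events" for l by (rule sets_Collect_M[OF X_measurable])
  define \<kappa> where "\<kappa> = (\<Sum>(g, w)\<in>carrier G \<times> W. prob {\<omega> \<in> space M. Y \<omega> = (ph k g, w)} / card H)"
  have eq: "prob {\<omega> \<in> space M. xL (X k \<omega>) = l} = pmf (etaL_of \<mu> e) l * \<kappa>" if l: "l \<in> L" for l
  proof -
    have img: "{x \<in> W_mu \<mu>. xL x = l} = (\<lambda>(g, w). map (l \<circ> g) w) ` (carrier G \<times> W)"
    proof (intro equalityI subsetI)
      fix x assume "x \<in> {x \<in> W_mu \<mu>. xL x = l}"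
      then have x: "x \<in> W_mu \<mu>" "xL x = l" by blast+
      have "(xG x, xW x) \<in> carrier G \<times> W" "x = (\<lambda>(g, w). map (l \<circ> g) w) (xG x, xW x)"
        using comps_mem[OF x(1)] x(2) by simp_all
      then show "x \<in> (\<lambda>(g, w). map (l \<circ> g) w) ` (carrier G \<times> W)" by (rule rev_image_eqI)
    next
      fix x assume "x \<in> (\<lambda>(g, w). map (l \<circ> g) w) ` (carrier G \<times> W)"
      then obtain y where y: "y \<in> carrier G \<times> W" "x = (\<lambda>(g, w). map (l \<circ> g) w) y" by (elim imageE)
      obtain g w where "y = (g, w)" by (rule prod.exhaust)
      then have gw: "g \<in> carrier G" "w \<in> W" "x = map (l \<circ> g) w" using y by simp_all
      then show "x \<in> {x \<in> W_mu \<mu>. xL x = l}" using LGW_mem[OF l gw(1,2)] LGW_comps(1)[OF l gw(1,2)] by (simp only: mem_Collect_eq)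
    qed
    have inj: "inj_on (\<lambda>(g, w). map (l \<circ> g) w) (carrier G \<times> W)"
    proof (rule inj_onI)
      fix y y' assume y: "y \<in> carrier G \<times> W" "y' \<in> carrier G \<times> W"
        "(\<lambda>(g, w). map (l \<circ> g) w) y = (\<lambda>(g, w). map (l \<circ> g) w) y'"
      obtain g w g' w' where "y = (g, w)" "y' = (g', w')" by (metis prod.collapse)
      then show "y = y'" using LGW_unique[OF l l, of g g' w w'] y by (simp del: map_map)
    qed
    have "prob {\<omega> \<in> space M. xL (X k \<omega>) = l} =
        (\<Sum>x\<in>W_mu \<mu>. prob ({\<omega> \<in> space M. xL (X k \<omega>) = l} \<inter> {\<omega> \<in> space M. X k \<omega> = x}))"
      by (intro prob_partition finite_W_mu AE_W_mu X_measurable ev)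
    also have "\<dots> = (\<Sum>x\<in>W_mu \<mu>. if xL x = l then prob {\<omega> \<in> space M. X k \<omega> = x} else 0)"
    proof (rule sum.cong[OF refl])
      fix x
      have "{\<omega> \<in> space M. xL (X k \<omega>) = l} \<inter> {\<omega> \<in> space M. X k \<omega> = x} =
        (if xL x = l then {\<omega> \<in> space M. X k \<omega> = x} else {})" by auto
      then show "prob ({\<omega> \<in> space M. xL (X k \<omega>) = l} \<inter> {\<omega> \<in> space M. X k \<omega> = x}) =
        (if xL x = l then prob {\<omega> \<in> space M. X k \<omega> = x} else 0)" by simp
    qed
    also have "\<dots> = (\<Sum>x\<in>{x \<in> W_mu \<mu>. xL x = l}. prob {\<omega> \<in> space M. X k \<omega> = x})"
      by (rule sum.inter_filter[OF finite_W_mu, symmetric])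
    also have "\<dots> = (\<Sum>(g, w)\<in>carrier G \<times> W. prob {\<omega> \<in> space M. X k \<omega> = map (l \<circ> g) w})"
      unfolding img by (subst sum.reindex[OF inj]) (simp only: o_def case_prod_beta')
    also have "\<dots> = (\<Sum>(g, w)\<in>carrier G \<times> W. pmf (etaL_of \<mu> e) l * (prob {\<omega> \<in> space M. Y \<omega> = (ph k g, w)} / card H))"
    proof (rule sum.cong[OF refl], clarify)
      fix g w assume gw: "g \<in> carrier G" "w \<in> W"
      show "prob {\<omega> \<in> space M. X k \<omega> = map (l \<circ> g) w} = pmf (etaL_of \<mu> e) l * (prob {\<omega> \<in> space M. Y \<omega> = (ph k g, w)} / card H)"
        unfolding prob_X[OF LGW_mem[OF l gw]] kap_def yv_def LGW_comps[OF l gw] by simp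
    qed
    also have "\<dots> = pmf (etaL_of \<mu> e) l * \<kappa>"
      unfolding \<kappa>_def case_prod_beta' by (rule sum_distrib_left[symmetric])
    finally show ?thesis .
  qed
  have mem: "AE \<omega> in M. xL (X k \<omega>) \<in> L" using AE_W_mu[of k] by eventually_elim (rule comps_mem(1))
  have "1 = (\<Sum>l\<in>L. prob (space M \<inter> {\<omega> \<in> space M. xL (X k \<omega>) = l}))"
    using prob_partition[OF _ mem meas sets.top] by (simp add: prob_space)
  also have "\<dots> = (\<Sum>l\<in>L. pmf (etaL_of \<mu> e) l) * \<kappa>" by (simp add: eq Int_def sum_distrib_right)
  also have "(\<Sum>l\<in>L. pmf (etaL_of \<mu> e) l) = 1" by (rule sum_pmf_eq_1) (use set_etaL in auto)
  finally have "\<kappa> = 1" by simp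
  show ?thesis
  proof (cases "l \<in> L")
    case True
    then show ?thesis using eq \<open>\<kappa> = 1\<close> by simp
  next
    case False
    have "AE \<omega> in M. \<omega> \<notin> {\<omega> \<in> space M. xL (X k \<omega>) = l}"
      using mem by eventually_elim (use False in blast)
    then have "prob {\<omega> \<in> space M. xL (X k \<omega>) = l} = 0" using prob_eq_0[OF ev] by blast
    moreover have "pmf (etaL_of \<mu> e) l = 0" using False set_etaL by (auto simp: pmf_eq_0_set_pmf)
    ultimately show ?thesis by simp
  qed
qed

lemma xL_law: "distr M (count_space UNIV) (\<lambda>\<omega>. xL (X k \<omega>)) = measure_pmf (etaL_of \<mu> e)"
proof (rule measure_eqI_finite[where A=UNIV])
  fix l :: "'v \<Rightarrow> 'v"
  have meas: "(\<lambda>\<omega>. xL (X k \<omega>)) \<in> measurable M (count_space UNIV)" by (rule measurable_discrete1[OF X_measurable])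
  have "emeasure (distr M (count_space UNIV) (\<lambda>\<omega>. xL (X k \<omega>))) {l} = emeasure M {\<omega> \<in> space M. xL (X k \<omega>) = l}"
    by (subst emeasure_distr[OF meas]) (auto intro: arg_cong[where f="emeasure M"])
  then show "emeasure (distr M (count_space UNIV) (\<lambda>\<omega>. xL (X k \<omega>))) {l} = emeasure (measure_pmf (etaL_of \<mu> e)) {l}"
    by (simp only: emeasure_eq_measure xL_point emeasure_pmf_single)
qed auto

lemma pmf_eq_prob:
  assumes "distr M (count_space UNIV) (X k) = measure_pmf \<rho>"
  shows "pmf \<rho> x = prob {\<omega> \<in> space M. X k \<omega> = x}"
proof -
  have "pmf \<rho> x = measure (distr M (count_space UNIV) (X k)) {x}" by (simp add: assms pmf.rep_eq)
  also have "\<dots> = prob (X k -` {x} \<inter> space M)" by (rule measure_distr) auto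
  finally show ?thesis by (simp add: vimage_def Int_def conj_commute)
qed

text \<open>The weights and laws are a disintegration of the law of \<open>Y\<close>: \<alpha> is
  the law of its first component, and \<open>\<Lambda>W r\<close> the conditional law of the second
  given the first.\<close>

lemma phase_decomposition_exists:
  assumes law: "\<And>k. distr M (count_space UNIV) (X k) = measure_pmf (\<Lambda> k)"
  shows "\<exists>\<alpha> \<Lambda>W. phase_decomposition \<mu> e \<gamma> W \<Lambda> \<alpha> \<Lambda>W"
proof -
  define q where "q = map_pmf (\<lambda>x. (fP 0 x, fW x)) (\<Lambda> 0)"
  have q: "pmf q y = prob {\<omega> \<in> space M. Y \<omega> = y}" for y
  proof -
    have "pmf q y = measure (distr M (count_space UNIV) (X 0)) {x. (fP 0 x, fW x) = y}"
      by (simp add: q_def pmf_map vimage_def law)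
    also have "\<dots> = prob (X 0 -` {x. (fP 0 x, fW x) = y} \<inter> space M)" by (rule measure_distr) auto
    finally show ?thesis by (simp add: vimage_def Int_def conj_commute Y_def)
  qed
  have qset: "set_pmf q \<subseteq> C \<times> W" unfolding q_def using fP_mem fW_mem by auto
  define B where "B r = {y :: ('v \<Rightarrow> 'v) \<times> 'v list. fst y = \<gamma> [^]\<^bsub>G\<^esub> r}" for r :: nat
  define \<alpha> where "\<alpha> r = measure (measure_pmf q) (B r)" for r
  \<comment> \<open>A phase of probability 0 gets a dummy law on \<open>W\<close>; its weight
    \<alpha> is 0.\<close>
  define \<Lambda>W where "\<Lambda>W r = (if set_pmf q \<inter> B r = {} then return_pmf w0 else map_pmf snd (cond_pmf q (B r)))" for r
  have joint: "\<alpha> r * pmf (\<Lambda>W r) w = pmf q (\<gamma> [^]\<^bsub>G\<^esub> r, w)" for r w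
  proof (cases "set_pmf q \<inter> B r = {}")
    case True
    then have "\<alpha> r = 0" unfolding \<alpha>_def by (simp add: measure_pmf_zero_iff)
    moreover have "(\<gamma> [^]\<^bsub>G\<^esub> r, w) \<notin> set_pmf q" using True by (auto simp: B_def)
    ultimately show ?thesis by (simp add: pmf_eq_0_set_pmf)
  next
    case False
    have "pmf (\<Lambda>W r) w = measure (measure_pmf (cond_pmf q (B r))) (snd -` {w})"
      using False by (simp add: \<Lambda>W_def pmf_map)
    also have "\<dots> = measure (measure_pmf (cond_pmf q (B r))) {(\<gamma> [^]\<^bsub>G\<^esub> r, w)}"
      using False by (intro measure_pmf.finite_measure_eq_AE) (auto simp: AE_measure_pmf_iff B_def)
    also have "\<dots> = pmf q (\<gamma> [^]\<^bsub>G\<^esub> r, w) / \<alpha> r"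
      using False by (simp add: measure_pmf_single pmf_cond \<alpha>_def B_def)
    finally show ?thesis using False by (simp add: \<alpha>_def measure_pmf_zero_iff)
  qed
  have W: "set_pmf (\<Lambda>W r) \<subseteq> W" for r
    using qset fW_mem[of "[]"] W_nonempty by (auto simp: \<Lambda>W_def w0_def some_in_eq)
  have "(\<Sum>r<p. \<alpha> r) = measure (measure_pmf q) (\<Union>r<p. B r)"
    unfolding \<alpha>_def using gamma_pow_inj
    by (intro measure_pmf.finite_measure_finite_Union[symmetric]) (auto simp: disjoint_family_on_def B_def inj_on_def)
  also have "\<dots> = 1"
  proof (subst measure_pmf.prob_eq_1)
    have "\<exists>r<p. fst y = \<gamma> [^]\<^bsub>G\<^esub> r" if "y \<in> set_pmf q" for y
    proof -
      have "fst y \<in> C" using qset that by auto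
      then show ?thesis by (simp only: C_iff)
    qed
    then show "AE y in measure_pmf q. y \<in> (\<Union>r<p. B r)" unfolding AE_measure_pmf_iff B_def by blast
  qed simp
  finally have total: "(\<Sum>r<p. \<alpha> r) = 1" .
  have "pmf (\<Lambda> k) x = (\<Sum>r<p. \<alpha> r *
      pmf (etaL_of \<mu> e \<star> return_pmf (\<gamma> [^]\<^bsub>G\<^esub> (k + int r)) \<star> pmf_of_set H \<triangleright> \<Lambda>W r) x)" for k x
  proof (cases "x \<in> W_mu \<mu>")
    case True
    obtain r where r: "r < p" "ph k (xG x) = \<gamma> [^]\<^bsub>G\<^esub> r" using ph_power[OF comps_mem(2)[OF True]] by blast
    show ?thesis
      unfolding phase_sum[OF W True r] joint q pmf_eq_prob[OF law] prob_X[OF True] yv_def r(2) ..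
  next
    case False
    have "AE \<omega> in M. \<omega> \<notin> {\<omega> \<in> space M. X k \<omega> = x}" using AE_W_mu[of k] by eventually_elim (use False in auto)
    then have "pmf (\<Lambda> k) x = 0"
      unfolding pmf_eq_prob[OF law] using prob_eq_0[OF sets_Collect_M[OF X_measurable[of k], of "\<lambda>y. y = x"]] by (simp only:)
    then show ?thesis by (simp add: pmf_law_W[OF gamma_pow_G W] False)
  qed
  then have "phase_decomposition \<mu> e \<gamma> W \<Lambda> \<alpha> \<Lambda>W"
    unfolding phase_decomposition_def using W total by (simp add: \<alpha>_def)
  then show ?thesis by blast
qed

text \<open>It suffices to compare both formulas at time 0 in one tuple with the given phase and
  W-component; an L-component charged by \<eta>^L makes the common factor \<open>kap x\<close>
  positive, so that it cancels.\<close>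

lemma phase_decomposition_unique:
  assumes law: "\<And>k. distr M (count_space UNIV) (X k) = measure_pmf (\<Lambda> k)"
    and dec: "phase_decomposition \<mu> e \<gamma> W \<Lambda> \<alpha> \<Lambda>W" and r: "r < p" and w: "w \<in> W"
  shows "prob {\<omega> \<in> space M. Y \<omega> = (\<gamma> [^]\<^bsub>G\<^esub> r, w)} = \<alpha> r * pmf (\<Lambda>W r) w"
proof -
  obtain l where l': "l \<in> set_pmf (etaL_of \<mu> e)" using set_pmf_not_empty by fast
  then have l: "l \<in> L" using set_etaL by blast
  have c: "\<gamma> [^]\<^bsub>G\<^esub> r \<in> C" using r C_iff by blast
  then have cG: "\<gamma> [^]\<^bsub>G\<^esub> r \<in> carrier G" using C_subset by blast
  define x where "x = map (l \<circ> \<gamma> [^]\<^bsub>G\<^esub> r) w"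
  note x = LGW_mem[OF l cG w, folded x_def] LGW_comps[OF l cG w, folded x_def]
  have "Cp (\<gamma> [^]\<^bsub>G\<^esub> r \<circ> e) = \<gamma> [^]\<^bsub>G\<^esub> r" by (rule Cp_eqI[OF c e_H])
  then have ph: "ph 0 (xG x) = \<gamma> [^]\<^bsub>G\<^esub> r" unfolding x(3) ph_0[OF cG] by (simp only: G_unit(2)[OF cG])
  have "kap x > 0" using l' card_H_pos by (simp add: kap_def x(2) pmf_positive)
  moreover have "kap x * prob {\<omega> \<in> space M. Y \<omega> = (\<gamma> [^]\<^bsub>G\<^esub> r, w)} = pmf (\<Lambda> 0) x"
    unfolding pmf_eq_prob[OF law] prob_X[OF x(1)] yv_def ph x(4) ..
  moreover have "pmf (\<Lambda> 0) x = kap x * (\<alpha> r * pmf (\<Lambda>W r) w)"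
    using phase_sum[OF _ x(1) r ph, of \<Lambda>W \<alpha>] dec unfolding phase_decomposition_def x(4) by simp
  ultimately show ?thesis by simp
qed

end

context clique_evolution
begin

subsection \<open>The remote past\<close>

text \<open>Given the state at \<open>j\<close>, the window is a function of later noise, and given
  \<open>Y\<close> the law of that state does not depend on \<open>A\<close>. This is conditional
  independence given \<open>Y = y\<close>, multiplied out because the condition may have probability
  0.\<close>

lemma remote_past_indep_window:
  assumes A: "A \<in> remote_past M X" and j: "j \<le> 0"
  shows "prob (A \<inter> {\<omega> \<in> space M. Y \<omega> = y} \<inter> {\<omega> \<in> space M. P (restrict (\<lambda>i. X i \<omega>) {j..0})}) * prob {\<omega> \<in> space M. Y \<omega> = y} =
    prob (A \<inter> {\<omega> \<in> space M. Y \<omega> = y}) * prob ({\<omega> \<in> space M. Y \<omega> = y} \<inter> {\<omega> \<in> space M. P (restrict (\<lambda>i. X i \<omega>) {j..0})})"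
proof -
  let ?Y = "{\<omega> \<in> space M. Y \<omega> = y}"
  let ?B = "{\<omega> \<in> space M. P (restrict (\<lambda>i. X i \<omega>) {j..0})}"
  have Be: "?B \<in> events" by (rule sets_Collect_M[OF measurable_window]) auto
  have Ye: "?Y \<in> events" by (rule sets_Collect_M[OF Y_measurable])
  have Xe: "{\<omega> \<in> space M. X j \<omega> = x} \<in> events" for x by (rule sets_Collect_M[OF X_measurable])
  \<comment> \<open>\<open>P\<close> rewritten for a window that starts in x at time
    \<open>j\<close> and is driven by the noise path \<phi>.\<close>
  define P' where "P' x \<phi> = P (restrict (\<lambda>i. map (trajectory j (nat (i - j)) \<phi>) x) {j..0})" for x and \<phi> :: "int \<Rightarrow> 'v \<Rightarrow> 'v"
  have Pe: "{\<omega> \<in> space M. P' x (NW j 0 \<omega>)} \<in> events" for x by (rule sets_Collect_M[OF NW_M])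
  define \<kappa> where "\<kappa> = (\<Sum>x\<in>W_mu \<mu>. of_bool (yv j x = y) * kap x * prob {\<omega> \<in> space M. P' x (NW j 0 \<omega>)})"
  \<comment> \<open>The factor \<kappa> does not involve the remote event; the instances for
    \<open>A\<close> and for the whole space then eliminate it.\<close>
  have main: "prob (A \<inter> ?Y \<inter> ?B) = prob (A \<inter> ?Y) * \<kappa>" if A: "A \<in> remote_past M X" for A
  proof -
    have Ae: "A \<in> events" using A remote_past_events by blast
    have AX: "A \<inter> {\<omega> \<in> space M. X j \<omega> = x} \<in> sets (F j)" for x
      using remote_past_F[OF A] sets_Collect_F[OF measurable_F(1)[of j j], of "\<lambda>y. y = x"] by (intro sets.Int) auto
    have AYB: "A \<inter> ?Y \<inter> ?B \<in> events" by (intro sets.Int Ae Ye Be)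
    have "prob (A \<inter> ?Y \<inter> ?B) = (\<Sum>x\<in>W_mu \<mu>. prob (A \<inter> ?Y \<inter> ?B \<inter> {\<omega> \<in> space M. X j \<omega> = x}))"
      by (intro prob_partition finite_W_mu AE_W_mu X_measurable AYB)
    also have "\<dots> = (\<Sum>x\<in>W_mu \<mu>. prob (A \<inter> ?Y) * (of_bool (yv j x = y) * kap x * prob {\<omega> \<in> space M. P' x (NW j 0 \<omega>)}))"
    proof (rule sum.cong[OF refl])
      fix x assume x: "x \<in> W_mu \<mu>"
      have "prob (A \<inter> ?Y \<inter> ?B \<inter> {\<omega> \<in> space M. X j \<omega> = x}) =
          prob (if yv j x = y then A \<inter> {\<omega> \<in> space M. X j \<omega> = x} \<inter> {\<omega> \<in> space M. P' x (NW j 0 \<omega>)} else {})"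
      proof (rule finite_measure_eq_AE)
        show "AE \<omega> in M. (\<omega> \<in> A \<inter> ?Y \<inter> ?B \<inter> {\<omega> \<in> space M. X j \<omega> = x}) =
            (\<omega> \<in> (if yv j x = y then A \<inter> {\<omega> \<in> space M. X j \<omega> = x} \<inter> {\<omega> \<in> space M. P' x (NW j 0 \<omega>)} else {}))"
          using AE_good
        proof eventually_elim
          case (elim \<omega>)
          have Y: "Y \<omega> = yv j (X j \<omega>)" using good_Y'[OF elim, of j] by (simp only: yv_def)
          have "X i \<omega> = map (trajectory j (nat (i - j)) (NW j 0 \<omega>)) (X j \<omega>)" if "i \<in> {j..0}" for i
            using that regular_between[OF goodD(1)[OF elim], of j i] NT_NW[of j "nat (i - j)" 0 \<omega>] by simp
          then have "restrict (\<lambda>i. X i \<omega>) {j..0} =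
              restrict (\<lambda>i. map (trajectory j (nat (i - j)) (NW j 0 \<omega>)) (X j \<omega>)) {j..0}"
            by (rule restrict_ext)
          then have "P (restrict (\<lambda>i. X i \<omega>) {j..0}) = P' (X j \<omega>) (NW j 0 \<omega>)" unfolding P'_def by (simp only:)
          then show ?case using Y by auto
        qed
        show "A \<inter> ?Y \<inter> ?B \<inter> {\<omega> \<in> space M. X j \<omega> = x} \<in> events" by (intro sets.Int[OF AYB Xe])
        show "(if yv j x = y then A \<inter> {\<omega> \<in> space M. X j \<omega> = x} \<inter> {\<omega> \<in> space M. P' x (NW j 0 \<omega>)} else {}) \<in> events"
          using sets.Int[OF sets.Int[OF Ae Xe] Pe] by simp
      qed
      also have "\<dots> = prob (A \<inter> ?Y) * (of_bool (yv j x = y) * kap x * prob {\<omega> \<in> space M. P' x (NW j 0 \<omega>)})"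
        using prob_NW[OF AX, of x "P' x" 0] remote_past_law[OF A x, of j] by simp
      finally show "prob (A \<inter> ?Y \<inter> ?B \<inter> {\<omega> \<in> space M. X j \<omega> = x}) =
          prob (A \<inter> ?Y) * (of_bool (yv j x = y) * kap x * prob {\<omega> \<in> space M. P' x (NW j 0 \<omega>)})" .
    qed
    finally show ?thesis unfolding \<kappa>_def sum_distrib_left .
  qed
  have "space M \<inter> ?Y = ?Y" by blast
  with main[OF space_remote] have "prob (?Y \<inter> ?B) = prob ?Y * \<kappa>" by (simp only:)
  then show ?thesis using main[OF A] by (simp only: mult.commute mult.left_commute)
qed

text \<open>Given \<open>Y\<close>, an event of the remote past is independent of all finite windows, hence of itself.\<close>

lemma remote_past_trivial:
  assumes A: "A \<in> remote_past M X"
  shows "prob (A \<inter> {\<omega> \<in> space M. Y \<omega> = y}) = 0 \<or>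
    prob (A \<inter> {\<omega> \<in> space M. Y \<omega> = y}) = prob {\<omega> \<in> space M. Y \<omega> = y}"
proof -
  let ?Y = "{\<omega> \<in> space M. Y \<omega> = y}"
  define W where "W j \<omega> = restrict (\<lambda>i. X i \<omega>) {j..0}" for j :: int and \<omega>
  define \<G> where "\<G> = {{\<omega> \<in> space M. P (W j \<omega>)} | j P. j \<le> 0}"
  have Ae: "A \<in> events" using A remote_past_events by blast
  have Ye: "?Y \<in> events" by (rule sets_Collect_M[OF Y_measurable])
  have W_M: "W j \<in> measurable M (count_space UNIV)" for j
    unfolding W_def by (rule measurable_window) auto
  have G_events: "\<G> \<subseteq> events" unfolding \<G>_def using sets_Collect_M[OF W_M] by blast
  have GI: "{\<omega> \<in> space M. P (W j \<omega>)} \<in> \<G>" if "j \<le> 0" for j P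
    unfolding \<G>_def by (rule CollectI, rule exI[of _ j], rule exI[of _ P]) (use that in simp)
  have Int: "Int_stable \<G>"
  proof (rule Int_stableI)
    fix a b assume "a \<in> \<G>" "b \<in> \<G>"
    then obtain j P j' P' where ab: "a = {\<omega> \<in> space M. P (W j \<omega>)}" "b = {\<omega> \<in> space M. P' (W j' \<omega>)}" "j \<le> 0" "j' \<le> 0"
      unfolding \<G>_def by blast
    let ?k = "min j j'"
    have "W j \<omega> = restrict (W ?k \<omega>) {j..0}" "W j' \<omega> = restrict (W ?k \<omega>) {j'..0}" for \<omega>
      unfolding W_def by (simp_all add: min_absorb2 min_absorb1 Int_absorb1)
    then have "a \<inter> b = {\<omega> \<in> space M. (\<lambda>\<phi>. P (restrict \<phi> {j..0}) \<and> P' (restrict \<phi> {j'..0})) (W ?k \<omega>)}"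
      unfolding ab by auto
    moreover have "?k \<le> 0" using ab by simp
    ultimately show "a \<inter> b \<in> \<G>" using GI[of ?k "\<lambda>\<phi>. P (restrict \<phi> {j..0}) \<and> P' (restrict \<phi> {j'..0})"] by (simp only:)
  qed
  have "past M X 0 \<subseteq> sigma_sets (space M) \<G>"
    unfolding past_def sigma_family_def
  proof (rule sigma_sets_mono, rule UN_least, rule subsetI)
    fix i b assume i: "i \<in> {..0 :: int}" and "b \<in> sigma_rv M (X i)"
    then obtain E where "b = X i -` E \<inter> space M" by (auto simp: sigma_rv_eq)
    then have "b = {\<omega> \<in> space M. (\<lambda>\<phi>. \<phi> i \<in> E) (W i \<omega>)}" using i unfolding W_def by auto
    then show "b \<in> sigma_sets (space M) \<G>" using i GI[of i "\<lambda>\<phi>. \<phi> i \<in> E"] by (intro sigma_sets.Basic) (simp only: atMost_iff)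
  qed
  moreover have "A \<in> past M X 0" using A unfolding remote_past_def by blast
  ultimately have A\<G>: "A \<in> sigma_sets (space M) \<G>" by blast
  have sub: "sigma_sets (space M) \<G> \<subseteq> events" by (rule sets.sigma_sets_subset[OF G_events])
  define AY where "AY = A \<inter> ?Y"
  have AYe: "AY \<in> events" unfolding AY_def using Ae Ye by (intro sets.Int)
  \<comment> \<open>Both sides are countably additive in B, so the identity passes from windows to
    the generated field by complements and disjoint unions.\<close>
  have "prob (AY \<inter> B) * prob ?Y = prob AY * prob (?Y \<inter> B)" if "B \<in> sigma_sets (space M) \<G>" for B
    using Int _ that
  proof (rule sigma_sets_induct_disjoint)
    show "\<G> \<subseteq> Pow (space M)" using G_events sets.space_closed by blast
    fix B assume "B \<in> \<G>"
    then obtain j P where "B = {\<omega> \<in> space M. P (restrict (\<lambda>i. X i \<omega>) {j..0})}" "j \<le> 0"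
      unfolding \<G>_def W_def by blast
    then show "prob (AY \<inter> B) * prob ?Y = prob AY * prob (?Y \<inter> B)"
      unfolding AY_def using remote_past_indep_window[OF A, of j y P] by (simp only:)
  next
    fix B assume B: "B \<in> sigma_sets (space M) \<G>" and IH: "prob (AY \<inter> B) * prob ?Y = prob AY * prob (?Y \<inter> B)"
    have Be: "B \<in> events" using B sub by blast
    have compl: "prob (D \<inter> (space M - B)) = prob D - prob (D \<inter> B)" if D: "D \<in> events" for D
    proof -
      have "D \<inter> (space M - B) = D - D \<inter> B" using sets.sets_into_space[OF D] by blast
      then show ?thesis using finite_measure_Diff[OF D sets.Int[OF D Be]] by simp
    qed
    show "prob (AY \<inter> (space M - B)) * prob ?Y = prob AY * prob (?Y \<inter> (space M - B))"
      unfolding compl[OF AYe] compl[OF Ye] using IH by (simp only: left_diff_distrib right_diff_distrib)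
  next
    fix B :: "nat \<Rightarrow> 'a set"
    assume B: "disjoint_family B" "range B \<subseteq> sigma_sets (space M) \<G>"
      and IH: "\<And>i. prob (AY \<inter> B i) * prob ?Y = prob AY * prob (?Y \<inter> B i)"
    have Be: "B i \<in> events" for i using B(2) sub by blast
    have sums: "(\<lambda>i. prob (D \<inter> B i)) sums prob (D \<inter> (\<Union>i. B i))" if D: "D \<in> events" for D
    proof -
      have "disjoint_family (\<lambda>i. D \<inter> B i)" using B(1) by (auto simp: disjoint_family_on_def)
      then have "(\<lambda>i. prob (D \<inter> B i)) sums prob (\<Union>i. D \<inter> B i)"
        using Be D by (intro finite_measure_UNION) auto
      then show ?thesis by (simp only: Int_UN_distrib)
    qed
    have "(\<lambda>i. prob (AY \<inter> B i) * prob ?Y) sums (prob (AY \<inter> (\<Union>i. B i)) * prob ?Y)"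
      by (rule sums_mult2[OF sums[OF AYe]])
    moreover have "(\<lambda>i. prob AY * prob (?Y \<inter> B i)) sums (prob AY * prob (?Y \<inter> (\<Union>i. B i)))"
      by (rule sums_mult[OF sums[OF Ye]])
    ultimately show "prob (AY \<inter> (\<Union>i. B i)) * prob ?Y = prob AY * prob (?Y \<inter> (\<Union>i. B i))"
      unfolding IH by (rule sums_unique2)
  qed simp
  \<comment> \<open>With B = A the identity reads t q = t^2 for t the probability of
    \<open>AY\<close>, so t is 0 or q.\<close>
  from this[OF A\<G>] have "prob AY * prob ?Y = prob AY * prob AY"
    by (simp only: AY_def Int_commute Int_left_absorb Int_assoc)
  then show ?thesis unfolding AY_def by auto
qed

text \<open>One inclusion is the triviality on each of the finitely many values of \<open>Y\<close>;
  for the other, \<open>Y\<close> is read at arbitrarily early times.\<close>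

lemma remote_past_eq_sigma: "as_equal M (remote_past M X) (sigma_rv M Y)"
proof (rule as_equalI)
  show re: "remote_past M X \<subseteq> events" by (rule remote_past_events)
  show se: "sigma_rv M Y \<subseteq> events" using measurable_sets[OF Y_measurable] by (auto simp: sigma_rv_eq)
  show "as_subset M (remote_past M X) (sigma_rv M Y)"
    unfolding as_subset_def
  proof
    fix A assume A: "A \<in> remote_past M X"
    let ?Y = "\<lambda>y. {\<omega> \<in> space M. Y \<omega> = y}"
    \<comment> \<open>The values of \<open>Y\<close> on whose event \<open>A\<close> is not null; by
      triviality \<open>A\<close> fills these events up to null sets.\<close>
    define T where "T = {y. prob (A \<inter> ?Y y) \<noteq> 0}"
    have Ae: "A \<in> events" using A re by blast
    have Ye: "?Y y \<in> events" for y by (rule sets_Collect_M[OF Y_measurable])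
    have "AE \<omega> in M. \<forall>y\<in>C \<times> W. Y \<omega> = y \<longrightarrow> (\<omega> \<in> A \<longleftrightarrow> y \<in> T)"
    proof (rule AE_finite_allI[OF finite_CW])
      fix y
      show "AE \<omega> in M. Y \<omega> = y \<longrightarrow> (\<omega> \<in> A \<longleftrightarrow> y \<in> T)"
      proof (cases "y \<in> T")
        case True
        then have "prob (A \<inter> ?Y y) = prob (?Y y)" using remote_past_trivial[OF A, of y] unfolding T_def by blast
        moreover have "?Y y - A \<inter> ?Y y = ?Y y - A" by blast
        ultimately have "prob (?Y y - A) = 0"
          using finite_measure_Diff[OF Ye[of y] sets.Int[OF Ae Ye[of y]]] by simp
        then have "AE \<omega> in M. \<omega> \<notin> ?Y y - A" using prob_eq_0[OF sets.Diff[OF Ye[of y] Ae]] by blast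
        then show ?thesis using AE_space by eventually_elim (use True in blast)
      next
        case False
        then have "prob (A \<inter> ?Y y) = 0" unfolding T_def by blast
        then have "AE \<omega> in M. \<omega> \<notin> A \<inter> ?Y y" using prob_eq_0[OF sets.Int[OF Ae Ye[of y]]] by blast
        then show ?thesis using AE_space by eventually_elim (use False in blast)
      qed
    qed
    then have ae: "AE \<omega> in M. \<omega> \<in> A \<longleftrightarrow> \<omega> \<in> Y -` T \<inter> space M"
      using AE_space by eventually_elim (use Y_mem in blast)
    have "Y -` T \<inter> space M \<in> sigma_rv M Y" by (auto simp: sigma_rv_eq)
    then have "Y -` T \<inter> space M \<in> sigma_join M (sigma_rv M Y) (null_sets M)"
      using sigma_join_null_mono(1) by blast
    then show "A \<in> sigma_join M (sigma_rv M Y) (null_sets M)"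
      by (rule AE_eq_in_join_null[OF _ Ae se ae])
  qed
  show "as_subset M (sigma_rv M Y) (remote_past M X)"
    unfolding as_subset_def
  proof
    fix b assume b: "b \<in> sigma_rv M Y"
    then obtain T where T: "b = Y -` T \<inter> space M" by (auto simp: sigma_rv_eq)
    \<comment> \<open>The condition on the invariant, read at time \<open>- int n\<close> instead of
      0. Asking for it eventually yields an exact member of the remote past, as opposed to one up to
      null events.\<close>
    define f where "f n \<omega> \<longleftrightarrow> (fP (- int n) (X (- int n) \<omega>), fW (X (- int n) \<omega>)) \<in> T" for n \<omega>
    define D where "D = {\<omega> \<in> space M. \<exists>n0. \<forall>n. n0 \<le> n \<longrightarrow> f n \<omega>}"
    have "D \<in> past M X k" for k
    proof -
      \<comment> \<open>Early indices n do not matter for an eventual property; dropping those below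
        \<open>nat (- k)\<close> leaves only times up to k.\<close>
      have tail: "(\<exists>n0. \<forall>n. n0 \<le> n \<longrightarrow> f n \<omega>) \<longleftrightarrow> (\<exists>n0. \<forall>n. n0 + nat (- k) \<le> n \<longrightarrow> f n \<omega>)" for \<omega>
        by (meson le_add1 order.trans)
      have "{\<omega> \<in> space (family_measure M {..k} X). n0 + nat (- k) \<le> n \<longrightarrow> f n \<omega>} \<in> sets (family_measure M {..k} X)" for n n0
      proof (cases "n0 + nat (- k) \<le> n")
        case True
        then have "- int n \<le> k" by linarith
        then have "X (- int n) \<in> measurable (family_measure M {..k} X) (count_space UNIV)"
          by (intro measurable_family) simp
        from sets_Collect_eq[OF this, of "\<lambda>x. (fP (- int n) x, fW x) \<in> T"] show ?thesis using True by (simp add: f_def)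
      next
        case False
        then show ?thesis using sets.top[of "family_measure M {..k} X"] by simp
      qed
      then have "{\<omega> \<in> space (family_measure M {..k} X). \<exists>n0. \<forall>n. n0 + nat (- k) \<le> n \<longrightarrow> f n \<omega>} \<in> sets (family_measure M {..k} X)"
        by (intro sets.sets_Collect_countable_Ex sets.sets_Collect_countable_All)
      then show ?thesis unfolding past_eq_sets D_def tail by simp
    qed
    then have D: "D \<in> remote_past M X" unfolding remote_past_def by blast
    have "AE \<omega> in M. \<omega> \<in> b \<longleftrightarrow> \<omega> \<in> D"
      using AE_good
    proof eventually_elim
      case (elim \<omega>)
      have "f n \<omega> \<longleftrightarrow> Y \<omega> \<in> T" for n unfolding f_def using good_Y[OF elim, of "- int n"] by (simp only:)
      then show ?case unfolding D_def T by auto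
    qed
    moreover have "D \<in> sigma_join M (remote_past M X) (null_sets M)" using D sigma_join_null_mono(1) by blast
    ultimately show "b \<in> sigma_join M (remote_past M X) (null_sets M)"
      using AE_eq_in_join_null[OF _ _ re] b se by blast
  qed
qed

subsection \<open>Structure of the past\<close>

definition Ginc where "Ginc j \<omega> = G_quot \<mu> e W (X j \<omega>) (X (j - 1) \<omega>)"

lemma G_quot_eq: "G_quot \<mu> e W x y = xG x \<circ> inv\<^bsub>G\<^esub> (xG y)"
  by (simp add: G_quot_def)

text \<open>Exhibits the increment as a function of one noise map and the previous L-component;
  since the latter is itself determined by the noise, so is the increment.\<close>

lemma good_Ginc:
  assumes "good \<omega>"
  shows "Ginc j \<omega> = e \<circ> N j \<omega> \<circ> xL (X (j - 1) \<omega>)"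
proof -
  have q: "e \<circ> N j \<omega> \<circ> xL (X (j - 1) \<omega>) \<in> carrier G"
    and eq: "xG (X j \<omega>) = (e \<circ> N j \<omega> \<circ> xL (X (j - 1) \<omega>)) \<circ> xG (X (j - 1) \<omega>)"
    using good_G_step(1,2)[OF assms, of "j - 1"] by simp_all
  show ?thesis
    unfolding Ginc_def G_quot_eq eq
    using G_inv_comp(2)[OF comps_mem(2)[OF goodD(2)[OF assms, of "j - 1"]]] G_unit(2)[OF q] by (simp only: comp_assoc)
qed

lemma good_telescope:
  assumes good: "good \<omega>" and "j \<le> k"
  shows "foldr (\<lambda>i g. Ginc i \<omega> \<circ> g) (rev [j + 1..k]) e = G_quot \<mu> e W (X k \<omega>) (X j \<omega>)"
  using \<open>j \<le> k\<close>
proof (induction k rule: int_ge_induct)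
  case base
  show ?case unfolding G_quot_eq using G_inv_comp(2)[OF comps_mem(2)[OF goodD(2)[OF good]]] by simp
next
  case (step k)
  note gk = comps_mem(2)[OF goodD(2)[OF good, of k]]
  have snoc: "foldr f (rev [j + 1..k + 1]) e = f (k + 1) (foldr f (rev [j + 1..k]) e)" for f :: "int \<Rightarrow> ('v \<Rightarrow> 'v) \<Rightarrow> 'v \<Rightarrow> 'v"
    using step.hyps by (simp add: upto_rec2)
  have "foldr (\<lambda>i g. Ginc i \<omega> \<circ> g) (rev [j + 1..k + 1]) e = Ginc (k + 1) \<omega> \<circ> G_quot \<mu> e W (X k \<omega>) (X j \<omega>)"
    unfolding snoc step.IH ..
  also have "\<dots> = xG (X (k + 1) \<omega>) \<circ> (inv\<^bsub>G\<^esub> (xG (X k \<omega>)) \<circ> xG (X k \<omega>)) \<circ> inv\<^bsub>G\<^esub> (xG (X j \<omega>))"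
    unfolding Ginc_def G_quot_eq add_diff_cancel_right' by (simp only: comp_assoc)
  also have "\<dots> = G_quot \<mu> e W (X (k + 1) \<omega>) (X j \<omega>)"
    unfolding G_quot_eq by (simp only: G_inv_comp(1)[OF gk] G_unit(2)[OF comps_mem(2)[OF goodD(2)[OF good, of "k + 1"]]])
  finally show ?case .
qed

lemma good_G_decomposition:
  assumes "good \<omega>"
  shows "xG (X k \<omega>) = Cp (\<gamma> [^]\<^bsub>G\<^esub> k \<circ> fst (Y \<omega>)) \<circ> fU (X k \<omega>)"
proof -
  note x = goodD(2)[OF assms, of k]
  note g = comps_mem(2)[OF x]
  have "Cp (\<gamma> [^]\<^bsub>G\<^esub> k \<circ> fst (Y \<omega>)) = Cp (xG (X k \<omega>))"
    unfolding good_Y'[OF assms, of k] fst_conv by (rule Cp_gamma_ph[OF g])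
  moreover have "Cp (xG (X k \<omega>)) \<circ> (inv\<^bsub>G\<^esub> (Cp (xG (X k \<omega>))) \<circ> xG (X k \<omega>)) =
      (Cp (xG (X k \<omega>)) \<circ> inv\<^bsub>G\<^esub> (Cp (xG (X k \<omega>)))) \<circ> xG (X k \<omega>)" by (simp only: comp_assoc)
  moreover have "fU (X k \<omega>) = inv\<^bsub>G\<^esub> (Cp (xG (X k \<omega>))) \<circ> xG (X k \<omega>)" unfolding fU_def using x by (simp only: if_True)
  ultimately show ?thesis by (simp only: G_inv_comp(2)[OF Cp_G[OF g]] G_unit(1)[OF g])
qed

lemma good_reconstruct:
  assumes "good \<omega>"
  shows "X j \<omega> = map (xL (X j \<omega>) \<circ> inv\<^bsub>G\<^esub> (G_quot \<mu> e W (X k \<omega>) (X j \<omega>)) \<circ>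
    Cp (\<gamma> [^]\<^bsub>G\<^esub> k \<circ> fst (Y \<omega>)) \<circ> fU (X k \<omega>)) (snd (Y \<omega>))"
proof -
  note x = goodD(2)[OF assms]
  note gj = comps_mem(2)[OF x, of j] and gk = comps_mem(2)[OF x, of k]
  have "inv\<^bsub>G\<^esub> (xG (X k \<omega>) \<circ> inv\<^bsub>G\<^esub> (xG (X j \<omega>))) = xG (X j \<omega>) \<circ> inv\<^bsub>G\<^esub> (xG (X k \<omega>))"
    using G.inv_mult_group[OF gk G.inv_closed[OF gj]] G.inv_inv[OF gj] by simp
  then have "inv\<^bsub>G\<^esub> (G_quot \<mu> e W (X k \<omega>) (X j \<omega>)) \<circ> xG (X k \<omega>) = xG (X j \<omega>) \<circ> (inv\<^bsub>G\<^esub> (xG (X k \<omega>)) \<circ> xG (X k \<omega>))"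
    unfolding G_quot_eq by (simp only: comp_assoc)
  then have quot: "inv\<^bsub>G\<^esub> (G_quot \<mu> e W (X k \<omega>) (X j \<omega>)) \<circ> xG (X k \<omega>) = xG (X j \<omega>)"
    by (simp only: G_inv_comp(1)[OF gk] G_unit(2)[OF gj])
  have "xL (X j \<omega>) \<circ> inv\<^bsub>G\<^esub> (G_quot \<mu> e W (X k \<omega>) (X j \<omega>)) \<circ> Cp (\<gamma> [^]\<^bsub>G\<^esub> k \<circ> fst (Y \<omega>)) \<circ> fU (X k \<omega>) =
      xL (X j \<omega>) \<circ> (inv\<^bsub>G\<^esub> (G_quot \<mu> e W (X k \<omega>) (X j \<omega>)) \<circ> xG (X k \<omega>))"
    unfolding good_G_decomposition[OF assms, of k] by (simp only: comp_assoc)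
  also have "\<dots> = xL (X j \<omega>) \<circ> xG (X j \<omega>)" by (simp only: quot)
  finally show ?thesis
    using comps_mem(4)[OF x, of j] unfolding good_Y'[OF assms, of j] snd_conv by (simp only:)
qed

lemma sigma_join_subset:
  assumes "sigma_algebra (space M) \<A>" "B \<subseteq> \<A>" "D \<subseteq> \<A>"
  shows "sigma_join M B D \<subseteq> \<A>"
  unfolding sigma_join_def using assms by (intro sigma_algebra.sigma_sets_subset) auto

lemma XL_Ginc_measurable:
  assumes "j \<le> k"
  shows "(\<lambda>\<omega>. (xL (X j \<omega>), Ginc j \<omega>)) \<in> measurable (family_measure M {..k} X) (count_space UNIV)"
proof -
  have "X j \<in> measurable (family_measure M {..k} X) (count_space UNIV)"
    "X (j - 1) \<in> measurable (family_measure M {..k} X) (count_space UNIV)"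
    using assms by (auto intro!: measurable_family)
  from measurable_discrete2[OF this, where F="\<lambda>x y. (xL x, G_quot \<mu> e W x y)"] show ?thesis by (simp only: Ginc_def)
qed

abbreviation GN where "GN k \<equiv> past M (\<lambda>j \<omega>. (xL (X j \<omega>), Ginc j \<omega>)) k"

lemma GN_subset_past: "GN k \<subseteq> past M X k"
  unfolding past_def by (rule measurable_family_comp) (use XL_Ginc_measurable in simp)

text \<open>An earlier state is rebuilt by \<open>good_reconstruct\<close> from its L-component, the
  increments up to \<open>k\<close>, the residual at \<open>k\<close> and \<open>Y\<close>;
  \<open>remote_past_eq_sigma\<close> exchanges \<open>Y\<close> for the remote past.\<close>

lemma past_structure:
  "as_equal M (past M X k)
    (sigma_join M (sigma_join M (GN k) (remote_past M X)) (sigma_rv M (\<lambda>\<omega>. fU (X k \<omega>))))"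
proof (rule as_equalI)
  define B where "B = sigma_join M (sigma_join M (GN k) (remote_past M X)) (sigma_rv M (\<lambda>\<omega>. fU (X k \<omega>)))"
  have alg: "sigma_algebra (space M) (past M X k)"
    using sets.sigma_algebra_axioms[of "family_measure M {..k} X"] by (simp add: past_eq_sets)
  have "(\<lambda>\<omega>. fU (X k \<omega>)) \<in> measurable (family_measure M {..k} X) (count_space UNIV)"
    by (rule measurable_discrete1[OF measurable_family]) simp
  from measurable_sets[OF this] have "sigma_rv M (\<lambda>\<omega>. fU (X k \<omega>)) \<subseteq> past M X k"
    by (auto simp: sigma_rv_eq past_eq_sets)
  moreover have "remote_past M X \<subseteq> past M X k" unfolding remote_past_def by blast
  ultimately have B_past: "B \<subseteq> past M X k"
    unfolding B_def using GN_subset_past by (intro sigma_join_subset[OF alg])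
  have Be: "B \<subseteq> events" using B_past past_X_events by blast
  show "past M X k \<subseteq> events" by (rule past_X_events)
  show "sigma_join M (sigma_join M (GN k) (remote_past M X)) (sigma_rv M (\<lambda>\<omega>. fU (X k \<omega>))) \<subseteq> events"
    using Be by (simp only: B_def)
  show "as_subset M (sigma_join M (sigma_join M (GN k) (remote_past M X)) (sigma_rv M (\<lambda>\<omega>. fU (X k \<omega>)))) (past M X k)"
    unfolding B_def[symmetric] as_subset_def using B_past sigma_join_null_mono(1) by blast
  have sub: "GN k \<subseteq> B" "remote_past M X \<subseteq> B" "sigma_rv M (\<lambda>\<omega>. fU (X k \<omega>)) \<subseteq> B"
    unfolding B_def sigma_join_def by (auto intro: sigma_sets.Basic)
  let ?J = "join_null_measure M B"
  have U: "(\<lambda>\<omega>. fU (X k \<omega>)) \<in> measurable ?J (count_space UNIV)"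
  proof (rule measurable_join_null[OF Be])
    fix A
    have "(\<lambda>\<omega>. fU (X k \<omega>)) -` A \<inter> space M \<in> sigma_rv M (\<lambda>\<omega>. fU (X k \<omega>))" by (auto simp: sigma_rv_eq)
    then show "(\<lambda>\<omega>. fU (X k \<omega>)) -` A \<inter> space M \<in> sigma_join M B (null_sets M)"
      using sub(3) sigma_join_null_mono(1) by blast
  qed
  have LM: "(\<lambda>\<omega>. (xL (X j \<omega>), Ginc j \<omega>)) \<in> measurable ?J (count_space UNIV)" if "j \<le> k" for j
  proof (rule measurable_join_null[OF Be])
    fix A
    have "(\<lambda>\<omega>. (xL (X j \<omega>), Ginc j \<omega>)) -` A \<inter> space M \<in> sigma_rv M (\<lambda>\<omega>. (xL (X j \<omega>), Ginc j \<omega>))" by (auto simp: sigma_rv_eq)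
    moreover have "sigma_rv M (\<lambda>\<omega>. (xL (X j \<omega>), Ginc j \<omega>)) \<subseteq> GN k"
      unfolding past_def using that by (intro sigma_rv_subset_family[where Z="\<lambda>j \<omega>. (xL (X j \<omega>), Ginc j \<omega>)"]) simp
    ultimately show "(\<lambda>\<omega>. (xL (X j \<omega>), Ginc j \<omega>)) -` A \<inter> space M \<in> sigma_join M B (null_sets M)"
      using sub(1) sigma_join_null_mono(1) by blast
  qed
  have Yj: "Y \<in> measurable ?J (count_space UNIV)"
  proof (rule measurable_join_null[OF Be])
    fix A
    have "Y -` A \<inter> space M \<in> sigma_rv M Y" by (auto simp: sigma_rv_eq)
    then have "Y -` A \<inter> space M \<in> sigma_join M (sigma_rv M Y) (null_sets M)"
      using sigma_join_null_mono(1) by blast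
    then have "Y -` A \<inter> space M \<in> sigma_join M (remote_past M X) (null_sets M)"
      using remote_past_eq_sigma unfolding as_equal_def by simp
    moreover have "sigma_join M (remote_past M X) (null_sets M) \<subseteq> sigma_join M B (null_sets M)"
      unfolding sigma_join_def using sub(2) by (intro sigma_sets_mono') auto
    ultimately show "Y -` A \<inter> space M \<in> sigma_join M B (null_sets M)" by blast
  qed
  have "as_subset M (past M X k) B"
    unfolding past_def
  proof (rule as_subset_familyI[OF X_measurable Be])
    fix j assume "j \<in> {..k}"
    then have j: "j \<le> k" by simp
    \<comment> \<open>The product of the increments as a function of a whole path, to be evaluated
      on a finite window only, where \<open>measurable_window\<close> applies.\<close>
    define R where "R \<phi> = foldr (\<lambda>i g. \<phi> i \<circ> g) (rev [j + 1..k]) e" for \<phi> :: "int \<Rightarrow> 'v \<Rightarrow> 'v"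
    define r where "r \<omega> = R (restrict (\<lambda>i. Ginc i \<omega>) {j<..k})" for \<omega>
    have r: "r \<omega> = foldr (\<lambda>i g. Ginc i \<omega> \<circ> g) (rev [j + 1..k]) e" for \<omega>
      unfolding r_def R_def by (rule foldr_cong) auto
    have Gincm: "Ginc i \<in> measurable ?J (count_space UNIV)" if "i \<le> k" for i
      using measurable_discrete1[OF LM[OF that], where F=snd] by simp
    have XLm: "(\<lambda>\<omega>. xL (X j \<omega>)) \<in> measurable ?J (count_space UNIV)"
      using measurable_discrete1[OF LM[OF j], where F=fst] by simp
    have "(\<lambda>\<omega>. restrict (\<lambda>i. Ginc i \<omega>) {j<..k}) \<in> measurable ?J (count_space UNIV)"
      by (rule measurable_window) (use Gincm in auto)
    then have rm: "r \<in> measurable ?J (count_space UNIV)"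
      unfolding r_def by (rule measurable_discrete1)
    have m1: "(\<lambda>\<omega>. (xL (X j \<omega>), r \<omega>)) \<in> measurable ?J (count_space UNIV)"
      by (rule measurable_discrete2[OF XLm rm])
    have m2: "(\<lambda>\<omega>. (Y \<omega>, fU (X k \<omega>))) \<in> measurable ?J (count_space UNIV)"
      by (rule measurable_discrete2[OF Yj U])
    define V where "V a b = map (fst a \<circ> inv\<^bsub>G\<^esub> (snd a) \<circ> Cp (\<gamma> [^]\<^bsub>G\<^esub> k \<circ> fst (fst b)) \<circ> snd b) (snd (fst b))"
      for a :: "('v \<Rightarrow> 'v) \<times> ('v \<Rightarrow> 'v)" and b :: "(('v \<Rightarrow> 'v) \<times> 'v list) \<times> ('v \<Rightarrow> 'v)"
    show "\<exists>Z\<in>measurable ?J (count_space UNIV). AE \<omega> in M. X j \<omega> = Z \<omega>"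
    proof (rule bexI)
      show "(\<lambda>\<omega>. V (xL (X j \<omega>), r \<omega>) (Y \<omega>, fU (X k \<omega>))) \<in> measurable ?J (count_space UNIV)"
        by (rule measurable_discrete2[OF m1 m2])
      show "AE \<omega> in M. X j \<omega> = V (xL (X j \<omega>), r \<omega>) (Y \<omega>, fU (X k \<omega>))"
        using AE_good
      proof eventually_elim
        case (elim \<omega>)
        show ?case
          unfolding V_def fst_conv snd_conv r good_telescope[OF elim j] by (rule good_reconstruct[OF elim])
      qed
    qed
  qed
  then show "as_subset M (past M X k)
      (sigma_join M (sigma_join M (GN k) (remote_past M X)) (sigma_rv M (\<lambda>\<omega>. fU (X k \<omega>))))"
    by (simp only: B_def)
qed

text \<open>Once a block of noise ending at j has its product in \<open>K\<close>, that product
  determines the L-component at j by \<open>xL_map_K\<close>. The block has random length, but it is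
  found from the noise alone.\<close>

lemma GN_subset_past_N: "as_subset M (GN k) (past M N k)"
proof -
  have Ne: "past M N k \<subseteq> events" unfolding past_def by (rule sigma_family_events) simp
  let ?J = "join_null_measure M (past M N k)"
  have Nj: "N i \<in> measurable ?J (count_space UNIV)" if "i \<le> k" for i
  proof (rule measurable_join_null[OF Ne])
    fix A
    have "N i \<in> measurable (family_measure M {..k} N) (count_space UNIV)" using that by (intro measurable_family) simp
    from measurable_sets[OF this, of A] have "N i -` A \<inter> space M \<in> past M N k" by (simp add: past_eq_sets)
    then show "N i -` A \<inter> space M \<in> sigma_join M (past M N k) (null_sets M)" using sigma_join_null_mono(1) by blast
  qed
  \<comment> \<open>The shortest block ending at j with product in \<open>K\<close>; it exists on
    good paths.\<close>
  define \<tau> where "\<tau> j \<omega> = (LEAST n. NT (j - int n) n \<omega> \<in> K)" for j \<omega>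
  define \<xi> where "\<xi> j \<omega> = fst (LGR_inv \<mu> e (NT (j - int (\<tau> j \<omega>)) (\<tau> j \<omega>) \<omega>))" for j \<omega>
  have NTj: "NT (j - int n) n \<in> measurable ?J (count_space UNIV)" if "j \<le> k" for j n
    by (rule NT_measurable) (use that Nj in auto)
  have \<xi>_meas: "\<xi> j \<in> measurable ?J (count_space UNIV)" if j: "j \<le> k" for j
  proof -
    have "(\<lambda>\<omega>. NT (j - int n) n \<omega> \<in> K) \<in> measurable ?J (count_space UNIV)" for n
      using measurable_discrete1[OF NTj[OF j], where F="\<lambda>z. z \<in> K"] .
    then have \<tau>: "\<tau> j \<in> measurable ?J (count_space UNIV)" unfolding \<tau>_def by (rule measurable_Least)
    have "(\<lambda>\<omega>. fst (LGR_inv \<mu> e (NT (j - int n) n \<omega>))) \<in> measurable ?J (count_space UNIV)" for n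
      by (rule measurable_discrete1[OF NTj[OF j]])
    from measurable_compose_countable[OF this \<tau>] show ?thesis unfolding \<xi>_def .
  qed
  have \<xi>_eq: "xL (X j \<omega>) = \<xi> j \<omega>" if "good \<omega>" for j \<omega>
  proof -
    have K: "NT (j - int (\<tau> j \<omega>)) (\<tau> j \<omega>) \<omega> \<in> K"
      unfolding \<tau>_def by (rule LeastI_ex[OF goodD(3)[OF that]])
    have "X j \<omega> = map (NT (j - int (\<tau> j \<omega>)) (\<tau> j \<omega>) \<omega>) (X (j - int (\<tau> j \<omega>)) \<omega>)"
      using regular_NT[OF goodD(1)[OF that], of "j - int (\<tau> j \<omega>)" "\<tau> j \<omega>"] by simp
    then show ?thesis using xL_map_K[OF K goodD(2)[OF that]] unfolding \<xi>_def by (simp only:)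
  qed
  show ?thesis
    unfolding past_def[of M "\<lambda>j \<omega>. (xL (X j \<omega>), Ginc j \<omega>)"]
  proof (rule as_subset_familyI[OF _ Ne])
    fix j assume "j \<in> {..k}"
    then have j: "j \<le> k" by simp
    show "(\<lambda>\<omega>. (xL (X j \<omega>), Ginc j \<omega>)) \<in> measurable M (count_space UNIV)"
      using measurable_discrete2[OF X_measurable[of j] X_measurable[of "j - 1"], where F="\<lambda>x y. (xL x, G_quot \<mu> e W x y)"]
      by (simp only: Ginc_def)
    have "(\<lambda>\<omega>. e \<circ> N j \<omega> \<circ> \<xi> (j - 1) \<omega>) \<in> measurable ?J (count_space UNIV)"
      using measurable_discrete2[OF Nj[OF j] \<xi>_meas[of "j - 1"], where F="\<lambda>n l. e \<circ> n \<circ> l"] j by simp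
    from measurable_discrete2[OF \<xi>_meas[OF j] this, where F=Pair]
    have meas: "(\<lambda>\<omega>. (\<xi> j \<omega>, e \<circ> N j \<omega> \<circ> \<xi> (j - 1) \<omega>)) \<in> measurable ?J (count_space UNIV)" .
    have ae: "AE \<omega> in M. (xL (X j \<omega>), Ginc j \<omega>) = (\<xi> j \<omega>, e \<circ> N j \<omega> \<circ> \<xi> (j - 1) \<omega>)"
      using AE_good by eventually_elim (simp only: good_Ginc \<xi>_eq)
    show "\<exists>Z\<in>measurable ?J (count_space UNIV). AE \<omega> in M. (xL (X j \<omega>), Ginc j \<omega>) = Z \<omega>"
    proof (rule bexI)
      show "AE \<omega> in M. (xL (X j \<omega>), Ginc j \<omega>) = (\<xi> j \<omega>, e \<circ> N j \<omega> \<circ> \<xi> (j - 1) \<omega>)" by (rule ae)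
    qed (rule meas)
  qed
qed

text \<open>\<open>residual_uniform\<close> gives the product formula for windows of noise around
  time \<open>k\<close>. These windows are stable under intersection and generate the noise
  field.\<close>

lemma noise_remote_residual_indep:
  "indep_sets (\<lambda>i. [sigma_family M UNIV N, remote_past M X, sigma_rv M (\<lambda>\<omega>. fU (X k \<omega>))] ! i) {..<3 :: nat}"
proof -
  define \<G> where "\<G> = {{\<omega> \<in> space M. P (NW j k' \<omega>)} | j k' P. j \<le> k \<and> k \<le> k'}"
  define \<U> where "\<U> = sigma_rv M (\<lambda>\<omega>. fU (X k \<omega>))"
  have GI: "{\<omega> \<in> space M. P (NW j k' \<omega>)} \<in> \<G>" if "j \<le> k" "k \<le> k'" for j k' P
    unfolding \<G>_def by (rule CollectI, rule exI[of _ j], rule exI[of _ k'], rule exI[of _ P]) (use that in simp)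
  have \<U>_eq: "\<U> = {{\<omega> \<in> space M. fU (X k \<omega>) \<in> E} | E. True}"
    unfolding \<U>_def sigma_rv_eq by (auto simp: vimage_def Int_def conj_commute)
  have G_events: "\<G> \<subseteq> events" unfolding \<G>_def using sets_Collect_M[OF NW_M] by blast
  have U_events: "\<U> \<subseteq> events" unfolding \<U>_eq using sets_Collect_M[OF X_measurable[of k], of "\<lambda>x. fU x \<in> _"] by blast
  have indep: "indep_sets (\<lambda>i. [\<G>, remote_past M X, \<U>] ! i) {..<3 :: nat}"
  proof (rule indep_sets3I[OF G_events remote_past_events U_events _ space_remote])
    show "space M \<in> \<G>" using GI[of k k "\<lambda>_. True"] by simp
    show "space M \<in> \<U>" unfolding \<U>_eq by (rule CollectI, rule exI[of _ UNIV]) simp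
    fix a b c assume a: "a \<in> \<G>" and b: "b \<in> remote_past M X" and c: "c \<in> \<U>"
    obtain j k' P where jk: "a = {\<omega> \<in> space M. P (NW j k' \<omega>)}" "j \<le> k" "k \<le> k'" using a unfolding \<G>_def by blast
    obtain E where E: "c = {\<omega> \<in> space M. fU (X k \<omega>) \<in> E}" using c unfolding \<U>_eq by blast
    have Ue: "{\<omega> \<in> space M. fU (X k \<omega>) = u} \<in> events" for u by (rule sets_Collect_M[OF measurable_discrete1[OF X_measurable]])
    have c_UN: "c = (\<Union>u\<in>H \<inter> E. {\<omega> \<in> space M. fU (X k \<omega>) = u})" unfolding E using fU_mem by auto
    have sum: "prob (D \<inter> c) = (\<Sum>u\<in>H \<inter> E. prob (D \<inter> {\<omega> \<in> space M. fU (X k \<omega>) = u}))" if D: "D \<in> events" for D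
      unfolding c_UN Int_UN_distrib using D Ue
      by (intro finite_measure_finite_Union) (auto simp: disjoint_family_on_def)
    have ae: "a \<in> events" "b \<in> events" using a b G_events remote_past_events by blast+
    have "prob (a \<inter> b \<inter> c) = (\<Sum>u\<in>H \<inter> E. prob a * prob b / card H)"
    proof (subst sum[OF sets.Int[OF ae]], rule sum.cong[OF refl])
      fix u assume "u \<in> H \<inter> E"
      then show "prob (a \<inter> b \<inter> {\<omega> \<in> space M. fU (X k \<omega>) = u}) = prob a * prob b / card H"
        using residual_uniform[OF b, of u j k k' P] jk by (simp add: Int_commute mult.commute)
    qed
    moreover have "prob c = (\<Sum>u\<in>H \<inter> E. 1 / card H)"
    proof -
      have "prob (space M \<inter> c) = (\<Sum>u\<in>H \<inter> E. 1 / card H)"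
      proof (subst sum[OF sets.top], rule sum.cong[OF refl])
        fix u assume "u \<in> H \<inter> E"
        then show "prob (space M \<inter> {\<omega> \<in> space M. fU (X k \<omega>) = u}) = 1 / card H"
          using residual_uniform[OF space_remote, of u k k k "\<lambda>_. True"] by (simp add: prob_space Int_def)
      qed
      moreover have "space M \<inter> c = c" unfolding E by blast
      ultimately show ?thesis by simp
    qed
    ultimately show "prob (a \<inter> b \<inter> c) = prob a * prob b * prob c" by simp
  qed
  have stable: "Int_stable ([\<G>, remote_past M X, \<U>] ! i)" if "i \<in> {..<3}" for i :: nat
  proof -
    have "Int_stable \<G>"
    proof (rule Int_stableI)
      fix a b assume "a \<in> \<G>" "b \<in> \<G>"
      then obtain j l P j' l' P' where ab: "a = {\<omega> \<in> space M. P (NW j l \<omega>)}" "b = {\<omega> \<in> space M. P' (NW j' l' \<omega>)}"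
          and le: "j \<le> k" "k \<le> l" "j' \<le> k" "k \<le> l'"
        unfolding \<G>_def by blast
      let ?j = "min j j'" and ?l = "max l l'"
      have "{j<..l} \<subseteq> {?j<..?l}" "{j'<..l'} \<subseteq> {?j<..?l}" by auto
      then have "NW j l \<omega> = restrict (NW ?j ?l \<omega>) {j<..l}" "NW j' l' \<omega> = restrict (NW ?j ?l \<omega>) {j'<..l'}" for \<omega>
        unfolding NW_def by (simp_all add: Int_absorb1)
      then have "a \<inter> b = {\<omega> \<in> space M. (\<lambda>\<phi>. P (restrict \<phi> {j<..l}) \<and> P' (restrict \<phi> {j'<..l'})) (NW ?j ?l \<omega>)}"
        unfolding ab by auto
      moreover have "?j \<le> k" "k \<le> ?l" using le by auto
      ultimately show "a \<inter> b \<in> \<G>"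
        using GI[of ?j ?l "\<lambda>\<phi>. P (restrict \<phi> {j<..l}) \<and> P' (restrict \<phi> {j'<..l'})"] by (simp only:)
    qed
    moreover have "Int_stable (remote_past M X)"
      unfolding remote_past_def past_eq_sets by (rule Int_stableI) blast
    moreover have "Int_stable \<U>"
      unfolding \<U>_def sigma_rv_def by (rule Int_stableI) blast
    moreover have "i = 0 \<or> i = 1 \<or> i = 2" using that by auto
    ultimately show ?thesis by auto
  qed
  have "sigma_family M UNIV N \<subseteq> sigma_sets (space M) \<G>"
    unfolding sigma_family_def
  proof (rule sigma_sets_mono, rule UN_least, rule subsetI)
    fix i b assume "b \<in> sigma_rv M (N i)"
    then obtain E where b: "b = N i -` E \<inter> space M" by (auto simp: sigma_rv_eq)
    \<comment> \<open>Windows are open on the left, hence \<open>i - 1\<close>; minimum and maximum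
      with \<open>k\<close> provide the bounds on both sides of \<open>k\<close> that
      \<open>\<G>\<close> demands.\<close>
    have "b = {\<omega> \<in> space M. (\<lambda>\<phi>. \<phi> i \<in> E) (NW (min (i - 1) k) (max i k) \<omega>)}" unfolding b NW_def by auto
    moreover have "min (i - 1) k \<le> k" "k \<le> max i k" by auto
    ultimately show "b \<in> sigma_sets (space M) \<G>"
      using GI[of "min (i - 1) k" "max i k" "\<lambda>\<phi>. \<phi> i \<in> E"] by (intro sigma_sets.Basic) (simp only:)
  qed
  then have mono: "[sigma_family M UNIV N, remote_past M X, \<U>] ! i \<subseteq> sigma_sets (space M) ([\<G>, remote_past M X, \<U>] ! i)"
    if "i \<in> {..<3}" for i :: nat
  proof -
    have "i = 0 \<or> i = 1 \<or> i = 2" using that by auto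
    then show ?thesis using \<open>sigma_family M UNIV N \<subseteq> sigma_sets (space M) \<G>\<close> by (auto intro: sigma_sets.Basic)
  qed
  have "indep_sets (\<lambda>i. sigma_sets (space M) ([\<G>, remote_past M X, \<U>] ! i)) {..<3 :: nat}"
    by (rule indep_sets_sigma[OF indep stable])
  then show ?thesis
    unfolding \<U>_def[symmetric] by (rule indep_sets_mono_sets) (rule mono)
qed

end

theorem theorem5p3:
  fixes \<mu> :: "('v :: finite \<Rightarrow> 'v) pmf"
    and e \<gamma> :: "'v \<Rightarrow> 'v"
    and W :: "'v list set"
    and M :: "'a measure"
    and X :: "int \<Rightarrow> 'a \<Rightarrow> 'v list"
    and N :: "int \<Rightarrow> 'a \<Rightarrow> 'v \<Rightarrow> 'v"
    and \<Lambda> :: "int \<Rightarrow> 'v list pmf"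
  defines "p \<equiv> p_of \<mu>"
    and "m \<equiv> m_of \<mu>"
    and "L \<equiv> L_of \<mu> e"
    and "G \<equiv> G_of \<mu> e"
    and "H \<equiv> H_of \<mu> e"
    and "C \<equiv> C_of \<mu> e \<gamma>"
    and "XL \<equiv> (\<lambda>k \<omega>. L_comp \<mu> e W (X k \<omega>))"
    and "XG \<equiv> (\<lambda>k \<omega>. G_comp \<mu> e W (X k \<omega>))"
    and "XW \<equiv> (\<lambda>k \<omega>. W_comp \<mu> e W (X k \<omega>))"
    and "MG \<equiv> (\<lambda>j \<omega>. G_quot \<mu> e W (X j \<omega>) (X (j - 1) \<omega>))"
    and "MGG \<equiv> (\<lambda>k j \<omega>. G_quot \<mu> e W (X k \<omega>) (X j \<omega>))"
  assumes e: "e \<in> idempotents (set_pmf (eta_of \<mu>))"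
    and \<gamma>: "admissible_gamma \<mu> e \<gamma>"
    and W: "minimal_W \<mu> e W"
    and evolution: "evolution \<mu> m M X N"
    and distinct_sequences:
      "AE \<omega> in M. \<forall>i<m. \<forall>j<m. i \<noteq> j \<longrightarrow> (\<lambda>k. X k \<omega> ! i) \<noteq> (\<lambda>k. X k \<omega> ! j)"
    and law: "\<And>k. distr M (count_space UNIV) (X k) = measure_pmf (\<Lambda> k)"
  shows
    \<comment> \<open>(a)\<close>
    "(\<forall>k. AE \<omega> in M. distinct (X k \<omega>) \<and> F_clique \<mu> (set (X k \<omega>))) \<and>
     \<comment> \<open>(b)\<close>
     (\<forall>k. set_pmf (\<Lambda> k) \<subseteq> distinct_tuples m) \<and>
     (\<forall>k. \<Lambda> k = \<mu> \<triangleright> \<Lambda> (k - 1)) \<and>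
     (\<exists>\<alpha> \<Lambda>W. phase_decomposition \<mu> e \<gamma> W \<Lambda> \<alpha> \<Lambda>W) \<and>
     \<comment> \<open>(i)\<close>
     W_mu \<mu> = set_act L (set_act (carrier G) W) \<and>
     (\<forall>k. (AE \<omega> in M. X k \<omega> \<in> W_mu \<mu>) \<and>
          distr M (count_space UNIV) (XL k) = measure_pmf (etaL_of \<mu> e)) \<and>
     (\<exists>YC U ZW.
       YC \<in> measurable M (count_space C) \<and>
       (\<forall>k::int. U k \<in> measurable M (count_space H)) \<and>
       ZW \<in> measurable M (count_space W) \<and>
       \<comment> \<open>(ii)\<close>
       (\<forall>k. (AE \<omega> in M. XG k \<omega> = C_part \<mu> e \<gamma> (\<gamma> [^]\<^bsub>G\<^esub> k \<otimes>\<^bsub>G\<^esub> YC \<omega>) \<otimes>\<^bsub>G\<^esub> U k \<omega>) \<and>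
            distr M (count_space UNIV) (U k) = measure_pmf (pmf_of_set H)) \<and>
       \<comment> \<open>(iii)\<close>
       (\<forall>k. AE \<omega> in M. XW k \<omega> = ZW \<omega>) \<and>
       \<comment> \<open>(iv)\<close>
       (\<forall>k j. j \<le> k \<longrightarrow>
         (AE \<omega> in M. MGG k j \<omega> = foldr (\<lambda>i g. MG i \<omega> \<otimes>\<^bsub>G\<^esub> g) (rev [j + 1..k]) \<one>\<^bsub>G\<^esub>) \<and>
         (AE \<omega> in M. X j \<omega> =
           map (XL j \<omega> \<circ> inv\<^bsub>G\<^esub> (MGG k j \<omega>) \<circ> C_part \<mu> e \<gamma> (\<gamma> [^]\<^bsub>G\<^esub> k \<otimes>\<^bsub>G\<^esub> YC \<omega>) \<circ> U k \<omega>)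
             (ZW \<omega>))) \<and>
       \<comment> \<open>(v)\<close>
       (\<forall>k. as_equal M (past M X k)
              (sigma_join M (sigma_join M (past M (\<lambda>j \<omega>. (XL j \<omega>, MG j \<omega>)) k) (remote_past M X))
                (sigma_rv M (U k))) \<and>
            as_subset M (past M (\<lambda>j \<omega>. (XL j \<omega>, MG j \<omega>)) k) (past M N k) \<and>
            prob_space.indep_sets M
              (\<lambda>i. [sigma_family M UNIV N, remote_past M X, sigma_rv M (U k)] ! i) {..<3::nat}) \<and>
       as_equal M (remote_past M X) (sigma_rv M (\<lambda>\<omega>. (YC \<omega>, ZW \<omega>))) \<and>
       \<comment> \<open>(vi)\<close>
       (\<forall>\<alpha> \<Lambda>W. phase_decomposition \<mu> e \<gamma> W \<Lambda> \<alpha> \<Lambda>W \<longrightarrow>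
         (\<forall>r<p. \<forall>w\<in>W.
           measure M {\<omega> \<in> space M. YC \<omega> = \<gamma> [^]\<^bsub>G\<^esub> r \<and> ZW \<omega> = w} = \<alpha> r * pmf (\<Lambda>W r) w)))"
proof -
  have "prob_space M" using evolution unfolding evolution_def by blast
  then interpret prob_space M .
  interpret clique_evolution \<mu> e W \<gamma> M X N
    by unfold_locales (use e \<gamma> W evolution distinct_sequences in \<open>simp_all add: m_def\<close>)
  have MG_eq: "MG = Ginc" by (intro ext) (simp only: MG_def Ginc_def)
  have a: "AE \<omega> in M. distinct (X k \<omega>) \<and> F_clique \<mu> (set (X k \<omega>))" for k
    using AE_W_mu[of k] by eventually_elim (simp add: W_mu_def distinct_tuples_def)
  have b1: "set_pmf (\<Lambda> k) \<subseteq> distinct_tuples m" for k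
  proof
    fix x assume "x \<in> set_pmf (\<Lambda> k)"
    then have "prob {\<omega> \<in> space M. X k \<omega> = x} \<noteq> 0"
      by (simp add: pmf_eq_prob[OF law, symmetric] set_pmf_iff)
    then have "\<not> (AE \<omega> in M. \<omega> \<notin> {\<omega> \<in> space M. X k \<omega> = x})"
      using prob_eq_0[OF sets_Collect_M[OF X_measurable[of k], of "\<lambda>y. y = x"]] by (simp only: simp_thms)
    moreover have "AE \<omega> in M. \<omega> \<notin> {\<omega> \<in> space M. X k \<omega> = x}" if "x \<notin> W_mu \<mu>"
      using AE_W_mu[of k] by eventually_elim (use that in blast)
    ultimately show "x \<in> distinct_tuples m" unfolding m_def by (auto simp: W_mu_def)
  qed
  have b2: "\<Lambda> k = \<mu> \<triangleright> \<Lambda> (k - 1)" for k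
  proof (rule pmf_eqI)
    fix x
    let ?T = "{xs :: 'v list. length xs = m_of \<mu>}"
    have A: "{\<omega> \<in> space M. X (k - 1) \<omega> = y} \<in> sets (F (k - 1))" for y
      by (rule sets_Collect_F[OF measurable_F(1)]) simp
    have Xe: "{\<omega> \<in> space M. X i \<omega> = y} \<in> events" for i y by (rule sets_Collect_M[OF X_measurable])
    have T: "set_pmf (\<Lambda> (k - 1)) \<subseteq> ?T" using b1[of "k - 1"] unfolding m_def distinct_tuples_def by auto
    have "pmf (\<Lambda> k) x = (\<Sum>y\<in>?T. prob ({\<omega> \<in> space M. X k \<omega> = x} \<inter> {\<omega> \<in> space M. X (k - 1) \<omega> = y}))"
      unfolding pmf_eq_prob[OF law]
      by (rule prob_partition[OF finite_tuples _ X_measurable Xe]) (auto intro: AE_I2 X_length)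
    \<comment> \<open>The step is treated as a block of length 1 starting at \<open>k - 1\<close>,
      hence independent of the state there.\<close>
    also have "\<dots> = (\<Sum>y\<in>?T. prob ({\<omega> \<in> space M. X (k - 1) \<omega> = y} \<inter> {\<omega> \<in> space M. map (NT (k - 1) 1 \<omega>) y = x}))"
    proof (intro sum.cong refl finite_measure_eq_AE)
      fix y
      show "AE \<omega> in M. (\<omega> \<in> {\<omega> \<in> space M. X k \<omega> = x} \<inter> {\<omega> \<in> space M. X (k - 1) \<omega> = y}) =
          (\<omega> \<in> {\<omega> \<in> space M. X (k - 1) \<omega> = y} \<inter> {\<omega> \<in> space M. map (NT (k - 1) 1 \<omega>) y = x})"
        using AE_regular
      proof eventually_elim
        case (elim \<omega>)
        have "X k \<omega> = map (NT (k - 1) 1 \<omega>) (X (k - 1) \<omega>)"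
          using regular_NT[OF elim, of "k - 1" 1] by (simp only: of_nat_1 diff_add_cancel)
        then show ?case by auto
      qed
      show "{\<omega> \<in> space M. X k \<omega> = x} \<inter> {\<omega> \<in> space M. X (k - 1) \<omega> = y} \<in> events" by (intro sets.Int Xe)
      show "{\<omega> \<in> space M. X (k - 1) \<omega> = y} \<inter> {\<omega> \<in> space M. map (NT (k - 1) 1 \<omega>) y = x} \<in> events"
        using sets.Int[OF Xe sets_Collect_M[OF NT_M, of "\<lambda>z. map z y = x"]] .
    qed
    also have "\<dots> = (\<Sum>y\<in>?T. pmf (\<Lambda> (k - 1)) y * pmf (\<mu> \<triangleright> return_pmf y) x)"
      using prob_NT_F_Collect[OF A, of _ "\<lambda>z. map z _ = x" 1]
      by (simp add: pmf_eq_prob[OF law] pmf_act_return)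
    also have "\<dots> = pmf (\<mu> \<triangleright> \<Lambda> (k - 1)) x"
      unfolding act_eq_bind_right[of \<mu> "\<Lambda> (k - 1)"] pmf_bind
      using T by (subst integral_measure_pmf_real[OF finite_tuples]) (auto simp: mult.commute)
    finally show "pmf (\<Lambda> k) x = pmf (\<mu> \<triangleright> \<Lambda> (k - 1)) x" .
  qed
  \<comment> \<open>The total versions \<open>fP\<close>, \<open>fU\<close>, \<open>fW\<close> take
    values in \<open>C\<close>, \<open>H\<close>, \<open>W\<close> at every point, as the
    measurability claims into these sets demand.\<close>
  define YC where "YC \<omega> = fP 0 (X 0 \<omega>)" for \<omega>
  define U where "U k \<omega> = fU (X k \<omega>)" for k \<omega>
  define ZW where "ZW \<omega> = fW (X 0 \<omega>)" for \<omega>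
  have Y: "Y \<omega> = (YC \<omega>, ZW \<omega>)" for \<omega> by (simp add: Y_def YC_def ZW_def)
  have into: "(\<lambda>\<omega>. f (X k \<omega>)) \<in> measurable M (count_space A)" if "\<And>x. f x \<in> A" for f k and A :: "'c set"
    using that measurable_sets[OF X_measurable[of k], of "f -` _"] by (intro measurableI) (simp_all add: vimage_def)
  have meas: "YC \<in> measurable M (count_space C)" "U k \<in> measurable M (count_space H)"
    "ZW \<in> measurable M (count_space W)" for k
    unfolding YC_def U_def ZW_def C_def H_def by (intro into fP_mem fU_mem fW_mem)+
  have ii: "AE \<omega> in M. XG k \<omega> = C_part \<mu> e \<gamma> (\<gamma> [^]\<^bsub>G\<^esub> k \<otimes>\<^bsub>G\<^esub> YC \<omega>) \<otimes>\<^bsub>G\<^esub> U k \<omega>" for k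
    using AE_good
  proof eventually_elim
    case (elim \<omega>)
    show ?case
      using good_G_decomposition[OF elim, of k] unfolding XG_def G_def mult_G U_def Y fst_conv .
  qed
  have ii': "distr M (count_space UNIV) (U k) = measure_pmf (pmf_of_set H)" for k
    unfolding U_def H_def by (rule fU_law)
  have iii: "AE \<omega> in M. XW k \<omega> = ZW \<omega>" for k
    using AE_good
  proof eventually_elim
    case (elim \<omega>)
    show ?case using good_Y'[OF elim, of k] unfolding XW_def Y by simp
  qed
  have iv: "AE \<omega> in M. MGG k j \<omega> = foldr (\<lambda>i g. MG i \<omega> \<otimes>\<^bsub>G\<^esub> g) (rev [j + 1..k]) \<one>\<^bsub>G\<^esub>" if "j \<le> k" for k j
    using AE_good
  proof eventually_elim
    case (elim \<omega>)
    show ?case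
      using good_telescope[OF elim that, symmetric]
      unfolding MGG_def MG_eq G_def mult_G one_G .
  qed
  have iv': "AE \<omega> in M. X j \<omega> = map (XL j \<omega> \<circ> inv\<^bsub>G\<^esub> (MGG k j \<omega>) \<circ>
      C_part \<mu> e \<gamma> (\<gamma> [^]\<^bsub>G\<^esub> k \<otimes>\<^bsub>G\<^esub> YC \<omega>) \<circ> U k \<omega>) (ZW \<omega>)" for k j
    using AE_good
  proof eventually_elim
    case (elim \<omega>)
    show ?case
      using good_reconstruct[OF elim, of j k] unfolding XL_def MGG_def G_def mult_G U_def Y fst_conv snd_conv .
  qed
  have GN: "(\<lambda>j \<omega>. (XL j \<omega>, MG j \<omega>)) = (\<lambda>j \<omega>. (xL (X j \<omega>), Ginc j \<omega>))"
    unfolding XL_def MG_eq ..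
  have U_eq: "(\<lambda>\<omega>. fU (X k \<omega>)) = U k" for k by (rule ext) (simp only: U_def)
  have Y_eq: "Y = (\<lambda>\<omega>. (YC \<omega>, ZW \<omega>))" by (rule ext) (rule Y)
  have vi: "measure M {\<omega> \<in> space M. YC \<omega> = \<gamma> [^]\<^bsub>G\<^esub> r \<and> ZW \<omega> = w} = \<alpha> r * pmf (\<Lambda>W r) w"
    if "phase_decomposition \<mu> e \<gamma> W \<Lambda> \<alpha> \<Lambda>W" "r < p" "w \<in> W" for \<alpha> \<Lambda>W r w
    using phase_decomposition_unique[OF law that(1) that(2)[unfolded p_def] that(3)]
    unfolding Y prod.inject G_def .
  show ?thesis
    apply (intro conjI allI)
    subgoal by (rule a)
    subgoal by (rule b1)
    subgoal by (rule b2)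
    subgoal by (rule phase_decomposition_exists[OF law])
    subgoal unfolding L_def G_def by (rule W_mu_eq_LGW)
    subgoal by (rule AE_W_mu)
    subgoal unfolding XL_def by (rule xL_law)
    apply (rule exI[of _ YC], rule exI[of _ U], rule exI[of _ ZW])
    apply (intro conjI allI impI ballI)
    subgoal by (rule meas(1))
    subgoal by (rule meas(2))
    subgoal by (rule meas(3))
    subgoal by (rule ii)
    subgoal by (rule ii')
    subgoal by (rule iii)
    subgoal by (rule iv)
    subgoal by (rule iv')
    subgoal unfolding GN U_eq[symmetric] by (rule past_structure)
    subgoal unfolding GN by (rule GN_subset_past_N)
    subgoal unfolding U_eq[symmetric] by (rule noise_remote_residual_indep)
    subgoal unfolding Y_eq[symmetric] by (rule remote_past_eq_sigma)
    subgoal by (rule vi)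
    done
qed

end
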